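(* Let $n\ge3$ and let $f=(f_1,\dots,f_n,f_{n+1}):(\mathbb{C}^n,0)\to(\mathbb{C}^{n+1},0)$ be a finitely determined, quasihomogeneous, corank 1 map germ. Consider that $f$ is written in the quasihomogeneous normal form $$f(x_1,\dots,x_n)=(x_1,\dots,x_{n-1},\ \alpha x_n^{m_1}+p(x_1,\dots,x_n),\ \beta x_n^{m_2}+q(x_1,\dots,x_n)),$$ for some $\alpha,\beta\in\mathbb{C}$ not both zero, $p(x_1,\dots,x_{n-1},0)=0=q(x_1,\dots,x_{n-1},0)$ and $m_1\le m_2$. Suppose that $f$ is of type $(w_1,\dots,w_{n-1},d_n,d_{n+1};w_1,\dots,w_n)$. Then: (a) if $w_n$ divides $d_n$, then $m(f(\mathbb{C}^n),0)=d_n/w_n$; (b) if $w_n$ does not divide $d_n$, then $m(f(\mathbb{C}^n),0)=d_{n+1}/w_n$. In particular, the multiplicity of the image of $f$ is determined by the weights and degrees of $f$.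
   Context: A polynomial $P(x_1,\dots,x_n)$ is quasihomogeneous of type $(d;w_1,\dots,w_n)$ if $w_1,\dots,w_n$ are positive integers with no common factor, $d$ is a positive integer, and $P(k^{w_1}x_1,\dots,k^{w_n}x_n)=k^dP(x_1,\dots,x_n)$. The integers $w_i$ are called weights and $d$ the weighted degree. A map germ $f=(f_1,\dots,f_{n+1})$ is quasihomogeneous of type $(d_1,\dots,d_{n+1};w_1,\dots,w_n)$ if each $f_i$ is quasihomogeneous of type $(d_i;w_1,\dots,w_n)$. Two germs $f,g:(\mathbb{C}^n,0)\to(\mathbb{C}^{n+1},0)$ are $\mathcal{A}$-equivalent if $g=\Psi\circ f\circ\Phi$ for germs of (holomorphic) diffeomorphisms $\Phi$ of $(\mathbb{C}^n,0)$ and $\Psi$ of $(\mathbb{C}^{n+1},0)$. A germ $f$ is finitely determined if there is a positive integer $k$ such that every germ with the same $k$-jet at $0$ as $f$ is $\mathcal{A}$-equivalent to $f$. Map germs are holomorphic, finite and generically one-to-one. Corank 1 means that the differential at $0$ has rank $n-1$. Here $m_1,m_2$ are positive integers. The image $(f(\mathbb{C}^n),0)$ is a hypersurface germ. If $F$ is a reduced defining equation of it, $F=F_m+F_{m+1}+\cdots$ with $F_k$ homogeneous of (ordinary) degree $k$ and $F_m\not\equiv0$, then its multiplicity is $m(f(\mathbb{C}^n),0):=m$.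
   Formalization: m_1, m_2 are assumed to be the exponents given by the type: d_n = m_1 w_n if w_n divides d_n, and d_{n+1} = m_2 w_n if w_n divides d_{n+1}. Otherwise (x,y,xt+yt^2,t^3+yt), alpha=0, m_1=1, m_2=3, of multiplicity 3 and not 4, is a counterexample. *)

theory Defs
  imports "HOL-Analysis.Analysis"
begin

text \<open>
  A germ at the origin is represented by a function on all of \<open>\<complex>\<^sup>n\<close> whose values matter only
  near \<open>0\<close>: two functions have the same germ iff they are eventually equal w.r.t. \<open>nhds 0\<close>.
\<close>

subsection \<open>Holomorphic germs\<close>

definition holo_on :: "(complex ^ 'n \<Rightarrow> complex) \<Rightarrow> (complex ^ 'n) set \<Rightarrow> bool" where
  "holo_on F U \<longleftrightarrow>
     (\<forall>x\<in>U. \<exists>D. (F has_derivative D) (at x) \<and> (\<forall>c v. D (c *s v) = c * D v))"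

definition holo_germ :: "(complex ^ 'n \<Rightarrow> complex) \<Rightarrow> bool" where
  "holo_germ F \<longleftrightarrow> (\<exists>U. open U \<and> 0 \<in> U \<and> holo_on F U)"

definition holo_map_germ :: "(complex ^ 'n \<Rightarrow> complex ^ 'm) \<Rightarrow> bool" where
  "holo_map_germ f \<longleftrightarrow> f 0 = 0 \<and> (\<forall>j. holo_germ (\<lambda>x. f x $ j))"

definition diffeo_germ :: "(complex ^ 'n \<Rightarrow> complex ^ 'n) \<Rightarrow> bool" where
  "diffeo_germ \<Phi> \<longleftrightarrow> holo_map_germ \<Phi> \<and>
     (\<exists>\<Theta>. holo_map_germ \<Theta> \<and> (\<forall>\<^sub>F x in nhds 0. \<Theta> (\<Phi> x) = x) \<and> (\<forall>\<^sub>F x in nhds 0. \<Phi> (\<Theta> x) = x))"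

subsection \<open>\<open>\<A>\<close>-equivalence and finite determinacy\<close>

definition A_equivalent ::
    "(complex ^ 'n \<Rightarrow> complex ^ 'm) \<Rightarrow> (complex ^ 'n \<Rightarrow> complex ^ 'm) \<Rightarrow> bool" where
  "A_equivalent f g \<longleftrightarrow>
     (\<exists>\<Phi> \<Psi>. diffeo_germ \<Phi> \<and> diffeo_germ \<Psi> \<and> (\<forall>\<^sub>F x in nhds 0. g x = \<Psi> (f (\<Phi> x))))"

definition cpartial :: "'n \<Rightarrow> (complex ^ 'n \<Rightarrow> complex) \<Rightarrow> complex ^ 'n \<Rightarrow> complex" where
  "cpartial i F = (\<lambda>x. deriv (\<lambda>t. F (x + axis i t)) 0)"

primrec iter_cpartial :: "'n list \<Rightarrow> (complex ^ 'n \<Rightarrow> complex) \<Rightarrow> complex ^ 'n \<Rightarrow> complex" where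
  "iter_cpartial [] F = F"
| "iter_cpartial (i # is) F = cpartial i (iter_cpartial is F)"

definition same_jet ::
    "nat \<Rightarrow> (complex ^ 'n \<Rightarrow> complex ^ 'm) \<Rightarrow> (complex ^ 'n \<Rightarrow> complex ^ 'm) \<Rightarrow> bool" where
  "same_jet k f g \<longleftrightarrow>
     (\<forall>j is. length is \<le> k \<longrightarrow>
        iter_cpartial is (\<lambda>x. f x $ j) 0 = iter_cpartial is (\<lambda>x. g x $ j) 0)"

definition finitely_determined :: "(complex ^ 'n \<Rightarrow> complex ^ 'm) \<Rightarrow> bool" where
  "finitely_determined f \<longleftrightarrow>
     (\<exists>k>0. \<forall>g. holo_map_germ g \<and> same_jet k f g \<longrightarrow> A_equivalent f g)"

subsection \<open>Finite, generically one-to-one, corank 1\<close>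

text \<open>A finite map is a closed continuous map with finite fibres; a germ is finite if it has a
  representative that is a finite map between open neighbourhoods of the origins.\<close>

definition finite_germ :: "(complex ^ 'n \<Rightarrow> complex ^ 'm) \<Rightarrow> bool" where
  "finite_germ f \<longleftrightarrow>
     (\<exists>U V. open U \<and> 0 \<in> U \<and> open V \<and> 0 \<in> V \<and> f ` U \<subseteq> V \<and> continuous_on U f \<and>
        closed_map (top_of_set U) (top_of_set V) f \<and> (\<forall>y\<in>V. finite {x\<in>U. f x = y}))"

text \<open>The generic point \<open>x\<close> of a small neighbourhood \<open>U\<close> (that is, every point of a dense open
  subset \<open>W\<close> of \<open>U\<close>) is the only point of \<open>U\<close> in its fibre.\<close>

definition generically_one_to_one :: "(complex ^ 'n \<Rightarrow> complex ^ 'm) \<Rightarrow> bool" where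
  "generically_one_to_one f \<longleftrightarrow>
     (\<exists>U W. open U \<and> 0 \<in> U \<and> open W \<and> W \<subseteq> U \<and> U \<subseteq> closure W \<and>
        (\<forall>x\<in>W. \<forall>y\<in>U. f x = f y \<longrightarrow> x = y))"

definition jacobian0 :: "(complex ^ 'n \<Rightarrow> complex ^ 'm) \<Rightarrow> complex ^ 'n ^ 'm" where
  "jacobian0 f = (\<chi> j i. cpartial i (\<lambda>x. f x $ j) 0)"

definition corank1 :: "(complex ^ 'n \<Rightarrow> complex ^ 'm) \<Rightarrow> bool" where
  "corank1 f \<longleftrightarrow> rank (jacobian0 f) = CARD('n) - 1"

subsection \<open>Quasihomogeneous polynomials and map germs\<close>

text \<open>Polynomials are identified with the functions they induce, which is faithful over \<open>\<complex>\<close>.\<close>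

definition polynomial_fun :: "(complex ^ 'n \<Rightarrow> complex) \<Rightarrow> bool" where
  "polynomial_fun P \<longleftrightarrow>
     (\<exists>(A :: ('n \<Rightarrow> nat) set) c. finite A \<and> P = (\<lambda>x. \<Sum>a\<in>A. c a * (\<Prod>i\<in>UNIV. x $ i ^ a i)))"

definition quasihomogeneous :: "nat \<Rightarrow> ('n \<Rightarrow> nat) \<Rightarrow> (complex ^ 'n \<Rightarrow> complex) \<Rightarrow> bool" where
  "quasihomogeneous d w P \<longleftrightarrow> polynomial_fun P \<and> (\<forall>i. w i > 0) \<and> Gcd (range w) = 1 \<and> d > 0 \<and>
     (\<forall>k x. P (\<chi> i. k ^ w i * x $ i) = k ^ d * P x)"

definition quasihomogeneous_map ::
    "('m \<Rightarrow> nat) \<Rightarrow> ('n \<Rightarrow> nat) \<Rightarrow> (complex ^ 'n \<Rightarrow> complex ^ 'm) \<Rightarrow> bool" where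
  "quasihomogeneous_map d w f \<longleftrightarrow> (\<forall>j. quasihomogeneous (d j) w (\<lambda>x. f x $ j))"

text \<open>
  Coordinates. The source \<open>\<complex>\<^sup>n\<close> is \<open>complex ^ 'n\<close>, and \<open>l :: 'n\<close> is the index of the
  last coordinate \<open>x\<^sub>n\<close>; the other indices stand for \<open>1, \<dots>, n - 1\<close>. The target
  \<open>\<complex>\<^sup>n\<^sup>+\<^sup>1\<close> is \<open>complex ^ 'n option\<close>, where \<open>Some i\<close> with \<open>i \<noteq> l\<close> is the \<open>i\<close>-th
  coordinate, \<open>Some l\<close> the \<open>n\<close>-th and \<open>None\<close> the \<open>(n+1)\<close>-st. So \<open>d\<^sub>n = d (Some l)\<close> and
  \<open>d\<^sub>n\<^sub>+\<^sub>1 = d None\<close>.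

  The last two conjuncts say that \<open>m\<^sub>1\<close> and \<open>m\<^sub>2\<close> are the exponents prescribed by the type: if
  some power of \<open>x\<^sub>n\<close> has weighted degree \<open>d\<^sub>n\<close> (resp. \<open>d\<^sub>n\<^sub>+\<^sub>1\<close>), then it is \<open>x\<^sub>n\<close> to the
  \<open>m\<^sub>1\<close> (resp. \<open>m\<^sub>2\<close>). This is automatic where the monomial really occurs, but has to be said for
  \<open>\<alpha> = 0\<close> or \<open>\<beta> = 0\<close>, since otherwise \<open>m\<^sub>1 \<le> m\<^sub>2\<close> would carry no information there: the
  germ \<open>(x, y, t) \<mapsto> (x, y, xt + yt\<^sup>2, t\<^sup>3 + yt)\<close> of type \<open>(3,2,4,3; 3,2,1)\<close> would be admitted
  with \<open>\<alpha> = 0\<close>, \<open>m\<^sub>1 = 1\<close>, \<open>m\<^sub>2 = 3\<close>, while its image has multiplicity \<open>3\<close> and not \<open>4\<close>.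
\<close>

definition qh_normal_form ::
    "'n \<Rightarrow> ('n option \<Rightarrow> nat) \<Rightarrow> ('n \<Rightarrow> nat) \<Rightarrow> complex \<Rightarrow> complex \<Rightarrow> nat \<Rightarrow> nat \<Rightarrow>
     (complex ^ 'n \<Rightarrow> complex) \<Rightarrow> (complex ^ 'n \<Rightarrow> complex) \<Rightarrow>
     (complex ^ 'n \<Rightarrow> complex ^ 'n option) \<Rightarrow> bool" where
  "qh_normal_form l d w \<alpha> \<beta> m\<^sub>1 m\<^sub>2 p q f \<longleftrightarrow>
     (\<forall>x. f x = (\<chi> j. case j of
                    Some i \<Rightarrow> if i = l then \<alpha> * x $ l ^ m\<^sub>1 + p x else x $ i
                  | None \<Rightarrow> \<beta> * x $ l ^ m\<^sub>2 + q x)) \<and>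
     (\<alpha> \<noteq> 0 \<or> \<beta> \<noteq> 0) \<and>
     (\<forall>x. x $ l = 0 \<longrightarrow> p x = 0 \<and> q x = 0) \<and>
     0 < m\<^sub>1 \<and> m\<^sub>1 \<le> m\<^sub>2 \<and>
     (w l dvd d (Some l) \<longrightarrow> d (Some l) = m\<^sub>1 * w l) \<and>
     (w l dvd d None \<longrightarrow> d None = m\<^sub>2 * w l)"

subsection \<open>Multiplicity of the image\<close>

text \<open>\<open>X\<close> represents the germ \<open>(f(\<complex>\<^sup>n), 0)\<close>: near \<open>0\<close> it coincides with \<open>f ` U\<close> for all
  sufficiently small open neighbourhoods \<open>U\<close> of \<open>0\<close>.\<close>

definition represents_image ::
    "(complex ^ 'n \<Rightarrow> complex ^ 'm) \<Rightarrow> (complex ^ 'm) set \<Rightarrow> bool" where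
  "represents_image f X \<longleftrightarrow>
     (\<exists>U\<^sub>0. open U\<^sub>0 \<and> 0 \<in> U\<^sub>0 \<and>
        (\<forall>U. open U \<and> 0 \<in> U \<and> U \<subseteq> U\<^sub>0 \<longrightarrow> (\<forall>\<^sub>F y in nhds 0. y \<in> X \<longleftrightarrow> y \<in> f ` U)))"

text \<open>\<open>F\<close> defines \<open>(X, 0)\<close> as a set and generates the ideal of all germs vanishing on it, i.e.
  defines it with its reduced structure.\<close>

definition reduced_equation :: "(complex ^ 'm) set \<Rightarrow> (complex ^ 'm \<Rightarrow> complex) \<Rightarrow> bool" where
  "reduced_equation X F \<longleftrightarrow> holo_germ F \<and> (\<forall>\<^sub>F y in nhds 0. y \<in> X \<longleftrightarrow> F y = 0) \<and>
     (\<forall>G. holo_germ G \<and> (\<forall>\<^sub>F y in nhds 0. y \<in> X \<longrightarrow> G y = 0) \<longrightarrow>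
        (\<exists>H. holo_germ H \<and> (\<forall>\<^sub>F y in nhds 0. G y = H y * F y)))"

definition homogeneous_poly :: "nat \<Rightarrow> (complex ^ 'm \<Rightarrow> complex) \<Rightarrow> bool" where
  "homogeneous_poly k P \<longleftrightarrow> polynomial_fun P \<and> (\<forall>c y. P (c *s y) = c ^ k * P y)"

definition has_multiplicity :: "(complex ^ 'm \<Rightarrow> complex) \<Rightarrow> nat \<Rightarrow> bool" where
  "has_multiplicity F m \<longleftrightarrow>
     (\<exists>Fh. (\<forall>k. homogeneous_poly k (Fh k)) \<and> (\<forall>\<^sub>F y in nhds 0. (\<lambda>k. Fh k y) sums F y) \<and>
        (\<forall>k<m. Fh k = (\<lambda>_. 0)) \<and> Fh m \<noteq> (\<lambda>_. 0))"

definition image_multiplicity :: "(complex ^ 'n \<Rightarrow> complex ^ 'm) \<Rightarrow> nat" where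
  "image_multiplicity f =
     (THE m. \<exists>X F. represents_image f X \<and> reduced_equation X F \<and> has_multiplicity F m)"

end

theory Submission
  imports Defs "HOL-Complex_Analysis.Complex_Analysis" "Jordan_Normal_Form.Char_Poly"
begin

text \<open>
  Write \<open>f (x', t) = (x', A (x', t), B (x', t))\<close>. By quasihomogeneity \<open>A\<close> is a sum
  \<open>\<Sum>\<^sub>j a\<^sub>j (x') t\<^sup>j\<close> whose coefficient \<open>a\<^sub>j\<close> has weighted degree \<open>d\<^sub>n - j w\<^sub>n\<close>, so on the
  axis \<open>x' = 0\<close> it is a multiple of \<open>t\<^sup>m\<close> with \<open>m = d\<^sub>n / w\<^sub>n\<close> if \<open>w\<^sub>n\<close> divides \<open>d\<^sub>n\<close>, and zero
  otherwise; the same holds for \<open>B\<close>.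

  \<^emph>\<open>The multiplicity.\<close> Let \<open>P\<close> be one of \<open>A\<close>, \<open>B\<close> and \<open>Q\<close> the other one. Suppose that \<open>P\<close> has
  weighted degree \<open>r w\<^sub>n\<close> and does not vanish on the axis, while \<open>Q\<close> has order at least \<open>r\<close>
  there. Then \<open>P\<close> is, on the whole space, a constant times a Weierstrass polynomial of degree \<open>r\<close>
  in \<open>t\<close>, and the image of \<open>f\<close> is the zero set of
  \<open>F (x', Y, Z) = \<Prod> (Z - Q (x', t))\<close>, the product over the roots \<open>t\<close> of \<open>P (x', t) = Y\<close>.
  This \<open>F\<close> is the characteristic polynomial of the multiplication by \<open>Q\<close> modulo \<open>P - Y\<close>, hence a
  polynomial in all variables, monic of degree \<open>r\<close> in \<open>Z\<close>. The roots satisfy \<open>t\<^sup>r = O(|y|)\<close>, so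
  every factor is \<open>O(|y|)\<close> and \<open>F\<close> has order exactly \<open>r\<close> (\<open>F_multiplicity\<close>). As \<open>f\<close> is generically
  one-to-one, \<open>F (x', Y, \<cdot>)\<close> has \<open>r\<close> distinct zeros for a dense set of parameters
  (\<open>generic_simple_roots\<close>). There the quotient \<open>G / F\<close>, for a germ \<open>G\<close> vanishing on the image, is
  holomorphic in \<open>Z\<close>; Cauchy's formula on a fixed circle extends it holomorphically to all
  parameters, so that \<open>F\<close> generates the ideal of the image (\<open>F_reduced\<close>). Two generators divide each
  other and therefore have the same order, so the multiplicity of the image is \<open>r\<close>
  (\<open>image_multiplicity_eqI\<close>, \<open>image_multiplicity_quasihomogeneous\<close>).

  \<^emph>\<open>Which component leads.\<close> If \<open>w\<^sub>n\<close> does not divide \<open>d\<^sub>n\<close>, then \<open>A\<close> vanishes on the axis, so \<open>B\<close>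
  does not because \<open>f\<close> is finite, and \<open>P = B\<close>. If \<open>w\<^sub>n\<close> divides \<open>d\<^sub>n\<close> and \<open>A\<close> does not vanish on the
  axis, then \<open>P = A\<close> since \<open>m\<^sub>1 \<le> m\<^sub>2\<close>. There remains the case that \<open>w\<^sub>n\<close> divides \<open>d\<^sub>n\<close> but
  the coefficient of \<open>t\<close> to the \<open>m\<^sub>1\<close> in \<open>A\<close> is zero. If \<open>m\<^sub>1 = m\<^sub>2\<close>, then \<open>P = B\<close> gives the same
  answer. The case \<open>m\<^sub>1 < m\<^sub>2\<close> contradicts finite determinacy
  (\<open>not_finitely_determined_if_leading_term_vanishes\<close>): \<open>A\<close> has degree less than \<open>m\<^sub>1\<close> in \<open>t\<close>, and over each point \<open>(0, 0, Z)\<close> with \<open>Z \<noteq> 0\<close> there lie \<open>m\<^sub>2\<close>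
  immersed sheets, too many for their \<open>m\<^sub>2\<close> tangent hyperplanes to be in general position.
  Adding \<open>\<epsilon> (x', B) t\<^sup>m\<close> to \<open>A\<close>, with \<open>m = m\<^sub>1\<close> and \<open>\<epsilon>\<close> a sum of high powers of suitable
  variables, gives a germ with the same jet for which the tangent spaces at any \<open>m\<^sub>2\<close> points with
  a common image have strictly fewer directions in common. Since the dimension of the space of
  common directions is an invariant of \<open>\<A>\<close>-equivalence
  (\<open>A_equivalent_common_tangent_space\<close>), the two germs are not equivalent.
\<close>

no_notation vec_index (infixl "$" 100)
no_notation fps_nth (infixl "$" 75)

section \<open>Polynomial functions\<close>

lemma polynomial_fun_const: "polynomial_fun (\<lambda>_. k)"
  unfolding polynomial_fun_def
  by (rule exI[of _ "{\<lambda>_. 0}"], rule exI[of _ "\<lambda>_. k"]) simp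

lemma polynomial_fun_coord:
  fixes i :: "'n::finite"
  shows "polynomial_fun (\<lambda>x. x $ i)"
proof -
  have "(\<Prod>j\<in>UNIV. x $ j ^ (if j = i then 1 else 0)) = x $ i" for x :: "complex ^ 'n"
    by (subst prod.remove[of _ i]) auto
  then show ?thesis unfolding polynomial_fun_def
    by (intro exI[of _ "{\<lambda>j. if j = i then 1 else 0}"] exI[of _ "\<lambda>_. 1"]) simp
qed

lemma polynomial_fun_add:
  assumes "polynomial_fun P" "polynomial_fun Q"
  shows "polynomial_fun (\<lambda>x. P x + Q x)"
proof -
  obtain A c where A: "finite A" "P = (\<lambda>x. \<Sum>a\<in>A. c a * (\<Prod>i\<in>UNIV. x $ i ^ a i))"
    using assms(1) unfolding polynomial_fun_def by blast
  obtain B d where B: "finite B" "Q = (\<lambda>x. \<Sum>a\<in>B. d a * (\<Prod>i\<in>UNIV. x $ i ^ a i))"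
    using assms(2) unfolding polynomial_fun_def by blast
  let ?e = "\<lambda>a. (if a \<in> A then c a else 0) + (if a \<in> B then d a else 0)"
  have "P x + Q x = (\<Sum>a\<in>A \<union> B. ?e a * (\<Prod>i\<in>UNIV. x $ i ^ a i))" for x
  proof -
    have "P x = (\<Sum>a\<in>A \<union> B. (if a \<in> A then c a else 0) * (\<Prod>i\<in>UNIV. x $ i ^ a i))"
      unfolding A(2) by (rule sum.mono_neutral_cong_left) (use A B in auto)
    moreover have "Q x = (\<Sum>a\<in>A \<union> B. (if a \<in> B then d a else 0) * (\<Prod>i\<in>UNIV. x $ i ^ a i))"
      unfolding B(2) by (rule sum.mono_neutral_cong_left) (use A B in auto)
    ultimately show ?thesis by (simp add: sum.distrib distrib_right)
  qed
  then show ?thesis unfolding polynomial_fun_def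
    by (intro exI[of _ "A \<union> B"] exI[of _ ?e]) (use A(1) B(1) in auto)
qed

lemma polynomial_fun_sum:
  assumes "\<And>s. s \<in> S \<Longrightarrow> polynomial_fun (P s)"
  shows "polynomial_fun (\<lambda>x. \<Sum>s\<in>S. P s x)"
  using assms
  by (induction S rule: infinite_finite_induct) (auto intro: polynomial_fun_const polynomial_fun_add)

lemma polynomial_fun_mult:
  assumes "polynomial_fun P" "polynomial_fun Q"
  shows "polynomial_fun (\<lambda>x. P x * Q x)"
proof -
  obtain A c where A: "finite A" "P = (\<lambda>x. \<Sum>a\<in>A. c a * (\<Prod>i\<in>UNIV. x $ i ^ a i))"
    using assms(1) unfolding polynomial_fun_def by blast
  obtain B d where B: "finite B" "Q = (\<lambda>x. \<Sum>a\<in>B. d a * (\<Prod>i\<in>UNIV. x $ i ^ a i))"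
    using assms(2) unfolding polynomial_fun_def by blast
  have "(\<lambda>x. P x * Q x) = (\<lambda>x. \<Sum>a\<in>A. \<Sum>b\<in>B. (c a * d b) * (\<Prod>i\<in>UNIV. x $ i ^ (a i + b i)))"
    unfolding A(2) B(2) sum_product
    by (intro ext sum.cong refl) (simp add: power_add prod.distrib mult_ac)
  moreover have "polynomial_fun (\<lambda>x. (c a * d b) * (\<Prod>i\<in>UNIV. x $ i ^ (a i + b i)))" for a b
    unfolding polynomial_fun_def
    by (rule exI[of _ "{\<lambda>i. a i + b i}"], rule exI[of _ "\<lambda>_. c a * d b"]) simp
  ultimately show ?thesis by (auto intro!: polynomial_fun_sum)
qed

lemma polynomial_fun_power:
  "polynomial_fun P \<Longrightarrow> polynomial_fun (\<lambda>x. P x ^ k)"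
  by (induction k) (auto intro: polynomial_fun_const polynomial_fun_mult)

lemma polynomial_fun_prod:
  assumes "\<And>s. s \<in> S \<Longrightarrow> polynomial_fun (P s)"
  shows "polynomial_fun (\<lambda>x. \<Prod>s\<in>S. P s x)"
  using assms
  by (induction S rule: infinite_finite_induct) (auto intro: polynomial_fun_const polynomial_fun_mult)

lemma polynomial_fun_diff:
  assumes "polynomial_fun P" "polynomial_fun Q"
  shows "polynomial_fun (\<lambda>x. P x - Q x)"
  using polynomial_fun_add[OF assms(1) polynomial_fun_mult[OF polynomial_fun_const[of "-1"] assms(2)]]
  by simp

lemmas polynomial_fun_intros =
  polynomial_fun_const polynomial_fun_coord polynomial_fun_add polynomial_fun_diff
  polynomial_fun_mult polynomial_fun_power polynomial_fun_sum polynomial_fun_prod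

lemma polynomial_fun_induct [consumes 1, case_names const coord add mult]:
  assumes "polynomial_fun P"
    and const: "\<And>k. R (\<lambda>_. k)"
    and coord: "\<And>i. R (\<lambda>x. x $ i)"
    and add: "\<And>P Q. polynomial_fun P \<Longrightarrow> polynomial_fun Q \<Longrightarrow> R P \<Longrightarrow> R Q \<Longrightarrow> R (\<lambda>x. P x + Q x)"
    and mult: "\<And>P Q. polynomial_fun P \<Longrightarrow> polynomial_fun Q \<Longrightarrow> R P \<Longrightarrow> R Q \<Longrightarrow> R (\<lambda>x. P x * Q x)"
  shows "R P"
proof -
  obtain A c where A: "finite A" "P = (\<lambda>x. \<Sum>a\<in>A. c a * (\<Prod>i\<in>UNIV. x $ i ^ a i))"
    using assms(1) unfolding polynomial_fun_def by blast
  have pow: "polynomial_fun (\<lambda>x. x $ i ^ k) \<and> R (\<lambda>x. x $ i ^ k)" for i and k :: nat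
    by (induction k) (auto intro!: const coord mult polynomial_fun_intros)
  have prod: "polynomial_fun (\<lambda>x. \<Prod>i\<in>I. x $ i ^ a i) \<and> R (\<lambda>x. \<Prod>i\<in>I. x $ i ^ a i)"
    if "finite I" for I and a :: "'a \<Rightarrow> nat"
    using that by (induction I) (use pow in \<open>auto intro!: const mult polynomial_fun_intros\<close>)
  have "polynomial_fun (\<lambda>x. \<Sum>a\<in>B. c a * (\<Prod>i\<in>UNIV. x $ i ^ a i)) \<and>
        R (\<lambda>x. \<Sum>a\<in>B. c a * (\<Prod>i\<in>UNIV. x $ i ^ a i))" if "finite B" for B
    using that
    by (induction B) (use prod in \<open>auto intro!: const mult add polynomial_fun_intros\<close>)
  with A show ?thesis by simp
qed

lemma polynomial_fun_has_clinear_derivative: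
  assumes "polynomial_fun P"
  shows "\<exists>D. (P has_derivative D) (at x) \<and> (\<forall>c v. D (c *s v) = c * D v)"
  using assms
proof (induction rule: polynomial_fun_induct)
  case (const k)
  show ?case by (intro exI[of _ "\<lambda>_. 0"]) auto
next
  case (coord i)
  show ?case by (intro exI[of _ "\<lambda>v. v $ i"])
    (auto intro!: bounded_linear_imp_has_derivative bounded_linear_vec_nth)
next
  case (add P Q)
  then obtain D E where "(P has_derivative D) (at x)" "\<forall>c v. D (c *s v) = c * D v"
    "(Q has_derivative E) (at x)" "\<forall>c v. E (c *s v) = c * E v" by blast
  then show ?case
    by (intro exI[of _ "\<lambda>v. D v + E v"]) (auto intro!: derivative_eq_intros simp: algebra_simps)
next
  case (mult P Q)
  then obtain D E where "(P has_derivative D) (at x)" "\<forall>c v. D (c *s v) = c * D v"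
    "(Q has_derivative E) (at x)" "\<forall>c v. E (c *s v) = c * E v" by blast
  then show ?case
    by (intro exI[of _ "\<lambda>v. P x * E v + D v * Q x"])
      (auto intro!: derivative_eq_intros simp: algebra_simps)
qed

lemma polynomial_fun_holo_on: "polynomial_fun P \<Longrightarrow> holo_on P U"
  unfolding holo_on_def using polynomial_fun_has_clinear_derivative by blast

lemma polynomial_fun_holo_germ: "polynomial_fun P \<Longrightarrow> holo_germ P"
  unfolding holo_germ_def using polynomial_fun_holo_on by (intro exI[of _ UNIV]) auto

lemma polynomial_fun_has_derivative:
  assumes "polynomial_fun P"
  shows "(P has_derivative frechet_derivative P (at x)) (at x)"
  using polynomial_fun_has_clinear_derivative[OF assms, of x]
  by (meson differentiableI frechet_derivative_works)

lemma polynomial_fun_continuous_on: "polynomial_fun P \<Longrightarrow> continuous_on U P"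
  by (meson continuous_at_imp_continuous_on has_derivative_continuous polynomial_fun_has_derivative)

text \<open>Used to see that a polynomial without constant term is \<open>O(|x|)\<close>, with an explicit domain for the estimate.\<close>

lemma polynomial_fun_lipschitz_at_0:
  assumes "polynomial_fun P"
  shows "\<exists>K\<ge>0. \<forall>x. norm x \<le> 1 \<longrightarrow> norm (P x - P 0) \<le> K * norm x"
  using assms
proof (induction rule: polynomial_fun_induct)
  case (const k)
  show ?case by (intro exI[of _ 0]) auto
next
  case (coord i)
  show ?case by (intro exI[of _ 1]) (auto simp: Finite_Cartesian_Product.norm_nth_le)
next
  case (add P Q)
  then obtain K L where K: "K \<ge> 0" "\<And>x. norm x \<le> 1 \<Longrightarrow> norm (P x - P 0) \<le> K * norm x"
    and L: "L \<ge> 0" "\<And>x. norm x \<le> 1 \<Longrightarrow> norm (Q x - Q 0) \<le> L * norm x" by blast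
  have "norm (P x + Q x - (P 0 + Q 0)) \<le> (K + L) * norm x" if "norm x \<le> 1" for x
  proof -
    have "norm (P x + Q x - (P 0 + Q 0)) \<le> norm (P x - P 0) + norm (Q x - Q 0)"
      by (metis add_diff_add norm_triangle_ineq)
    then show ?thesis using K(2)[OF that] L(2)[OF that] by (simp add: algebra_simps)
  qed
  then show ?case using K L by (intro exI[of _ "K + L"]) auto
next
  case (mult P Q)
  then obtain K L where K: "K \<ge> 0" "\<And>x. norm x \<le> 1 \<Longrightarrow> norm (P x - P 0) \<le> K * norm x"
    and L: "L \<ge> 0" "\<And>x. norm x \<le> 1 \<Longrightarrow> norm (Q x - Q 0) \<le> L * norm x" by blast
  have "norm (P x * Q x - P 0 * Q 0) \<le> ((norm (P 0) + K) * L + K * norm (Q 0)) * norm x"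
    if "norm x \<le> 1" for x
  proof -
    have Px: "norm (P x) \<le> norm (P 0) + K"
    proof -
      have "norm (P x) \<le> norm (P 0) + norm (P x - P 0)"
        by (metis norm_triangle_sub)
      also have "norm (P x - P 0) \<le> K" using K(2)[OF that] K(1) that
        by (meson mult_left_le order_trans)
      finally show ?thesis by simp
    qed
    have "P x * Q x - P 0 * Q 0 = P x * (Q x - Q 0) + (P x - P 0) * Q 0"
      by (simp add: algebra_simps)
    then have "norm (P x * Q x - P 0 * Q 0) \<le> norm (P x) * norm (Q x - Q 0) + norm (P x - P 0) * norm (Q 0)"
      by (metis norm_mult norm_triangle_ineq)
    also have "\<dots> \<le> (norm (P 0) + K) * (L * norm x) + (K * norm x) * norm (Q 0)"
      by (intro add_mono mult_mono Px L(2)[OF that] K(2)[OF that])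
        (use K(1) L(1) in auto)
    finally show ?thesis by (simp add: algebra_simps)
  qed
  then show ?case using K L by (intro exI[of _ "(norm (P 0) + K) * L + K * norm (Q 0)"]) auto
qed

lemma polynomial_fun_cpartial:
  assumes "polynomial_fun P"
  shows "polynomial_fun (cpartial i P) \<and>
    (\<forall>x. ((\<lambda>t. P (x + axis i t)) has_field_derivative cpartial i P x) (at 0))"
proof -
  have "\<exists>P'. polynomial_fun P' \<and> (\<forall>x. ((\<lambda>t. P (x + axis i t)) has_field_derivative P' x) (at 0))"
    using assms
  proof (induction rule: polynomial_fun_induct)
    case (const k)
    show ?case by (intro exI[of _ "\<lambda>_. 0"]) (auto intro: polynomial_fun_const)
  next
    case (coord j)
    show ?case
    proof (cases "j = i")
      case True
      then show ?thesis
        by (intro exI[of _ "\<lambda>_. 1"])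
          (auto intro!: polynomial_fun_const derivative_eq_intros simp: axis_def)
    next
      case False
      then show ?thesis
        by (intro exI[of _ "\<lambda>_. 0"])
          (auto intro!: polynomial_fun_const derivative_eq_intros simp: axis_def)
    qed
  next
    case (add P Q)
    then obtain P' Q' where P': "polynomial_fun P'" "\<forall>x. ((\<lambda>t. P (x + axis i t)) has_field_derivative P' x) (at 0)"
      and Q': "polynomial_fun Q'" "\<forall>x. ((\<lambda>t. Q (x + axis i t)) has_field_derivative Q' x) (at 0)" by blast
    have "((\<lambda>t. P (x + axis i t) + Q (x + axis i t)) has_field_derivative P' x + Q' x) (at 0)" for x
      by (rule DERIV_add[OF P'(2)[rule_format] Q'(2)[rule_format]])
    then show ?case
      by (intro exI[of _ "\<lambda>x. P' x + Q' x"])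
        (use P' Q' in \<open>auto intro!: polynomial_fun_intros\<close>)
  next
    case (mult P Q)
    then obtain P' Q' where P': "polynomial_fun P'" "\<forall>x. ((\<lambda>t. P (x + axis i t)) has_field_derivative P' x) (at 0)"
      and Q': "polynomial_fun Q'" "\<forall>x. ((\<lambda>t. Q (x + axis i t)) has_field_derivative Q' x) (at 0)" by blast
    have "((\<lambda>t. P (x + axis i t) * Q (x + axis i t)) has_field_derivative P' x * Q x + Q' x * P x) (at 0)" for x
      using DERIV_mult[OF P'(2)[rule_format, of x] Q'(2)[rule_format, of x]] by (simp add: axis_eq_0_iff[THEN iffD2])
    then show ?case using mult(1,2)
      by (intro exI[of _ "\<lambda>x. P' x * Q x + Q' x * P x"])
        (use P' Q' in \<open>auto intro!: polynomial_fun_intros\<close>)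
  qed
  then obtain P' where P': "polynomial_fun P'"
    "\<forall>x. ((\<lambda>t. P (x + axis i t)) has_field_derivative P' x) (at 0)" by blast
  then have "cpartial i P = P'" unfolding cpartial_def by (auto intro!: ext DERIV_imp_deriv)
  with P' show ?thesis by simp
qed

section \<open>Partial derivatives and jets\<close>

lemma cpartial_eqI:
  assumes "\<And>x. ((\<lambda>t. P (x + axis i t)) has_field_derivative D x) (at 0)"
  shows "cpartial i P = D"
  unfolding cpartial_def by (auto intro!: ext DERIV_imp_deriv assms)

lemma cpartial_add:
  assumes "polynomial_fun P" "polynomial_fun Q"
  shows "cpartial i (\<lambda>x. P x + Q x) = (\<lambda>x. cpartial i P x + cpartial i Q x)"
  by (rule cpartial_eqI) (intro DERIV_add; use assms polynomial_fun_cpartial in blast)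

lemma polynomial_fun_iter_cpartial: "polynomial_fun P \<Longrightarrow> polynomial_fun (iter_cpartial is P)"
  by (induction "is") (auto simp: polynomial_fun_cpartial)

lemma iter_cpartial_add:
  assumes "polynomial_fun P" "polynomial_fun Q"
  shows "iter_cpartial is (\<lambda>x. P x + Q x) = (\<lambda>x. iter_cpartial is P x + iter_cpartial is Q x)"
  by (induction "is") (auto simp: cpartial_add polynomial_fun_iter_cpartial assms)

text \<open>Each derivative lowers the exponent of \<open>h\<close> by at most one, by the product rule.\<close>

lemma iter_cpartial_power_mult:
  assumes "polynomial_fun h" "polynomial_fun s" "length is \<le> N"
  shows "\<exists>s'. polynomial_fun s' \<and>
    iter_cpartial is (\<lambda>x. h x ^ N * s x) = (\<lambda>x. h x ^ (N - length is) * s' x)"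
  using assms(3)
proof (induction "is")
  case Nil
  then show ?case using assms by auto
next
  case (Cons i "is")
  then obtain s' where s': "polynomial_fun s'"
    "iter_cpartial is (\<lambda>x. h x ^ N * s x) = (\<lambda>x. h x ^ (N - length is) * s' x)" by auto
  obtain M where M: "N - length is = Suc M" using Cons.prems by (metis Suc_diff_Suc Suc_le_lessD length_Cons)
  let ?s = "\<lambda>x. of_nat (Suc M) * cpartial i h x * s' x + h x * cpartial i s' x"
  have "cpartial i (\<lambda>x. h x ^ Suc M * s' x) = (\<lambda>x. h x ^ M * ?s x)"
  proof (rule cpartial_eqI)
    fix x
    have "((\<lambda>t. h (x + axis i t)) has_field_derivative cpartial i h x) (at 0)"
      "((\<lambda>t. s' (x + axis i t)) has_field_derivative cpartial i s' x) (at 0)"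
      using polynomial_fun_cpartial assms(1) s'(1) by blast+
    note * = DERIV_mult[OF DERIV_power[OF this(1), of "Suc M"] this(2)]
    have [simp]: "axis i (0::complex) = 0" by (simp add: axis_eq_0_iff)
    show "((\<lambda>t. h (x + axis i t) ^ Suc M * s' (x + axis i t)) has_field_derivative h x ^ M * ?s x) (at 0)"
      by (rule DERIV_cong[OF *]) (simp add: algebra_simps)
  qed
  moreover have "polynomial_fun ?s"
    by (intro polynomial_fun_intros) (auto simp: polynomial_fun_cpartial assms s')
  moreover have "N - length (i # is) = M" using M by simp
  ultimately show ?case using s'(2) M by (auto intro!: exI[of _ ?s])
qed

lemma iter_cpartial_power_mult_eq_0:
  assumes "polynomial_fun h" "polynomial_fun s" "h 0 = 0" "length is < N"
  shows "iter_cpartial is (\<lambda>x. h x ^ N * s x) 0 = 0"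
proof -
  obtain s' where "iter_cpartial is (\<lambda>x. h x ^ N * s x) = (\<lambda>x. h x ^ (N - length is) * s' x)"
    using iter_cpartial_power_mult[OF assms(1,2)] assms(4) by (meson less_imp_le)
  then show ?thesis using assms(3,4) by simp
qed

section \<open>Quasihomogeneous polynomials as polynomials in one variable\<close>

text \<open>For fixed \<open>x\<close> the homogeneity equation is an identity between polynomials in the scaling factor
  \<open>k\<close>. Comparing the coefficients of \<open>k\<^sup>d\<close> discards all monomials of another weighted degree; this
  avoids having to know that the coefficients of a polynomial function are unique.\<close>

lemma quasihomogeneous_monomials:
  fixes P :: "complex ^ 'n \<Rightarrow> complex"
  assumes "quasihomogeneous d w P"
  shows "\<exists>A c. finite A \<and> (\<forall>a\<in>A. (\<Sum>i\<in>UNIV. w i * a i) = d) \<and>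
    P = (\<lambda>x. \<Sum>a\<in>A. c a * (\<Prod>i\<in>UNIV. x $ i ^ a i))"
proof -
  have P: "polynomial_fun P" and hom: "\<And>k x. P (\<chi> i. k ^ w i * x $ i) = k ^ d * P x"
    using assms unfolding quasihomogeneous_def by auto
  obtain A c where A: "finite A" "P = (\<lambda>x. \<Sum>a\<in>A. c a * (\<Prod>i\<in>UNIV. x $ i ^ a i))"
    using P unfolding polynomial_fun_def by blast
  let ?wt = "\<lambda>a. \<Sum>i\<in>UNIV. w i * a i"
  let ?A = "{a \<in> A. ?wt a = d}"
  have "P x = (\<Sum>a\<in>?A. c a * (\<Prod>i\<in>UNIV. x $ i ^ a i))" for x
  proof -
    define q where "q = (\<Sum>a\<in>A. monom (c a * (\<Prod>i\<in>UNIV. x $ i ^ a i)) (?wt a))"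
    have "poly q k = poly (monom (P x) d) k" for k
    proof -
      have "poly q k = (\<Sum>a\<in>A. c a * (\<Prod>i\<in>UNIV. (k ^ w i * x $ i) ^ a i))"
        unfolding q_def poly_sum
        by (intro sum.cong refl)
          (simp add: poly_monom power_mult_distrib prod.distrib power_sum power_mult[symmetric] mult_ac)
      also have "\<dots> = P (\<chi> i. k ^ w i * x $ i)" by (simp add: A(2))
      finally show ?thesis unfolding hom by (simp add: poly_monom mult.commute)
    qed
    then have "q = monom (P x) d" by (intro poly_eq_poly_eq_iff[THEN iffD1] ext)
    then have "P x = coeff q d" by simp
    also have "\<dots> = (\<Sum>a\<in>A. if ?wt a = d then c a * (\<Prod>i\<in>UNIV. x $ i ^ a i) else 0)"
      unfolding q_def coeff_sum by (intro sum.cong refl) (simp add: coeff_monom)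
    also have "\<dots> = (\<Sum>a\<in>?A. c a * (\<Prod>i\<in>UNIV. x $ i ^ a i))"
      by (rule sum.mono_neutral_cong_right) (use A(1) in auto)
    finally show ?thesis .
  qed
  then show ?thesis using A(1) by (intro exI[of _ ?A] exI[of _ c]) auto
qed

lemma has_derivative_mult_at_common_zero:
  fixes g h :: "'a::real_normed_vector \<Rightarrow> complex"
  assumes "(g has_derivative G) (at x)" "(h has_derivative H) (at x)" "g x = 0" "h x = 0"
  shows "((\<lambda>y. g y * h y) has_derivative (\<lambda>_. 0)) (at x)"
  by (rule has_derivative_eq_rhs[OF has_derivative_mult[OF assms(1,2)]]) (simp add: assms)

text \<open>The coefficient \<open>a j\<close> of \<open>x\<^sub>l\<^sup>j\<close> is quasihomogeneous of weighted degree \<open>d - j w\<^sub>l\<close> in the other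
  variables. So it vanishes if that number is negative and is constant if it is zero. Otherwise a
  monomial of \<open>a j\<close> that contains a variable of weight \<open>d - j w\<^sub>l\<close> is that variable alone; all
  other monomials involve only lighter variables, at least two of them counted with multiplicity.
  This splits \<open>a j\<close> into the linear part with coefficients \<open>\<kappa> j\<close> and the remainder \<open>r j\<close>, which is
  triangular with respect to the weights and has derivative zero at the origin.\<close>

lemma quasihomogeneous_expansion:
  fixes P :: "complex ^ 'n \<Rightarrow> complex" and l :: 'n
  assumes "quasihomogeneous d w P"
  obtains a \<kappa> r where
    "\<And>j. polynomial_fun (a j)"
    "\<And>j x x'. (\<And>i. i \<noteq> l \<Longrightarrow> x $ i = x' $ i) \<Longrightarrow> a j x = a j x'"
    "\<And>x. P x = (\<Sum>j\<le>d. a j x * x $ l ^ j)"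
    "\<And>j x. d < j * w l \<Longrightarrow> a j x = 0"
    "\<And>j x. j * w l = d \<Longrightarrow> a j x = a j 0"
    "\<And>j. j * w l \<noteq> d \<Longrightarrow> a j 0 = 0"
    "\<And>j x. j * w l < d \<Longrightarrow> a j x = (\<Sum>i | i \<noteq> l \<and> w i + j * w l = d. \<kappa> j i * x $ i) + r j x"
    "\<And>j. polynomial_fun (r j)"
    "\<And>j x x'. (\<And>i. i \<noteq> l \<Longrightarrow> w i + j * w l < d \<Longrightarrow> x $ i = x' $ i) \<Longrightarrow> r j x = r j x'"
    "\<And>j. j * w l < d \<Longrightarrow> r j 0 = 0"
    "\<And>j. j * w l < d \<Longrightarrow> (r j has_derivative (\<lambda>_. 0)) (at 0)"
proof -
  obtain A c where A: "finite A" and wt: "\<And>a. a \<in> A \<Longrightarrow> (\<Sum>i\<in>UNIV. w i * a i) = d"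
    and P: "P = (\<lambda>x. \<Sum>a\<in>A. c a * (\<Prod>i\<in>UNIV. x $ i ^ a i))"
    using quasihomogeneous_monomials[OF assms] by blast
  have wpos: "w i > 0" for i using assms unfolding quasihomogeneous_def by auto
  define m where "m = (\<lambda>a (x :: complex ^ 'n). \<Prod>i\<in>-{l}. x $ i ^ a i)"
  have m_poly: "polynomial_fun (m a)" for a unfolding m_def by (intro polynomial_fun_intros)
  have m0: "m a 0 = 0" if "i \<noteq> l" "a i > 0" for a i
    unfolding m_def by (rule prod_zero) (use that in auto)
  have wt': "(\<Sum>i\<in>-{l}. w i * a i) + a l * w l = d" if "a \<in> A" for a
  proof -
    have "(\<Sum>i\<in>UNIV. w i * a i) = w l * a l + (\<Sum>i\<in>-{l}. w i * a i)"
      by (subst sum.remove[of UNIV l]) (auto simp: Compl_eq_Diff_UNIV)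
    then show ?thesis using wt[OF that] by (simp add: mult.commute)
  qed
  have wt_le: "w i * a i + a l * w l \<le> d" if "a \<in> A" "i \<noteq> l" for a i
  proof -
    have "w i * a i \<le> (\<Sum>i\<in>-{l}. w i * a i)" by (rule member_le_sum) (use that in auto)
    then show ?thesis using wt'[OF that(1)] by simp
  qed
  define B where "B = (\<lambda>j. {a \<in> A. a l = j})"
  have finB: "finite (B j)" for j unfolding B_def using A by auto
  define a where "a = (\<lambda>j x. \<Sum>e\<in>B j. c e * m e x)"
  define s where "s = (\<lambda>j i i'. if i' = l then j else if i' = i then 1 else (0::nat))"
  define E where "E = (\<lambda>j. {i. i \<noteq> l \<and> w i + j * w l = d})"
  define \<kappa> where "\<kappa> = (\<lambda>j i. if s j i \<in> A then c (s j i) else 0)"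
  define R where "R = (\<lambda>j. {e \<in> B j. \<forall>i. i \<noteq> l \<longrightarrow> e \<noteq> s j i})"
  define r where "r = (\<lambda>j x. if j * w l < d then \<Sum>e\<in>R j. c e * m e x else 0)"
  have finR: "finite (R j)" for j unfolding R_def using finB by auto
  have m_s: "m (s j i) x = x $ i" if "i \<noteq> l" for j i x
  proof -
    have "m (s j i) x = x $ i * (\<Prod>i'\<in>-{l}-{i}. x $ i' ^ s j i i')"
      unfolding m_def using that by (subst prod.remove[of _ i]) (auto simp: s_def)
    also have "(\<Prod>i'\<in>-{l}-{i}. x $ i' ^ s j i i') = 1"
      by (rule prod.neutral) (auto simp: s_def)
    finally show ?thesis by simp
  qed
  have s_inj: "inj_on (s j) {i. i \<noteq> l}" for j
    by (rule inj_onI) (metis (mono_tags, lifting) mem_Collect_eq one_neq_zero s_def)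
  have s_E: "i \<in> E j" if "s j i \<in> A" "i \<noteq> l" for i j
  proof -
    have "(\<Sum>i'\<in>-{l}. w i' * s j i i') = w i"
      using that(2) by (subst sum.remove[of _ i]) (auto simp: s_def intro!: sum.neutral)
    then show ?thesis using wt'[OF that(1)] that(2) by (simp add: E_def s_def)
  qed
  have nonconst: "\<exists>i. i \<noteq> l \<and> e i > 0" if "e \<in> B j" "j * w l < d" for e j
  proof (rule ccontr)
    assume "\<not> ?thesis"
    then have "(\<Sum>i\<in>-{l}. w i * e i) = 0" by (intro sum.neutral) auto
    moreover have e: "e \<in> A" "e l = j" using that by (auto simp: B_def)
    ultimately have "j * w l = d" using wt'[OF e(1)] by (simp only: e(2) add_0)
    then show False using that(2) by simp
  qed
  \<comment> \<open>A variable of the full weight \<open>d - j w\<^sub>l\<close> leaves no room for another factor.\<close>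
  have light: "w i + j * w l < d" if e: "e \<in> R j" and i: "i \<noteq> l" "e i > 0" for e j i
  proof (rule ccontr)
    assume *: "\<not> w i + j * w l < d"
    have eA: "e \<in> A" "e l = j" using e by (auto simp: R_def B_def)
    have "w i * e i + j * w l \<le> d" using wt_le[OF eA(1) i(1)] eA by simp
    moreover have "w i \<le> w i * e i" using i by simp
    ultimately have "w i * e i = w i" and wi: "w i + j * w l = d" using * by linarith+
    then have ei: "e i = 1" using wpos[of i] by simp
    have "(\<Sum>i'\<in>-{l}. w i' * e i') = w i * e i + (\<Sum>i'\<in>-{l}-{i}. w i' * e i')"
      using i by (subst sum.remove[of _ i]) auto
    then have "(\<Sum>i'\<in>-{l}-{i}. w i' * e i') = 0" using wt'[OF eA(1)] wi ei eA by (simp del: sum_eq_0_iff)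
    then have "\<forall>i'\<in>-{l}-{i}. w i' * e i' = 0" by (subst (asm) sum_eq_0_iff) auto
    then have "e i' = 0" if "i' \<noteq> l" "i' \<noteq> i" for i'
      using that wpos[of i'] by force
    then have "e = s j i" using ei eA by (auto simp: s_def)
    then show False using e i by (auto simp: R_def)
  qed
  show ?thesis
  proof (rule that[of a \<kappa> r])
    show "polynomial_fun (a j)" for j
      unfolding a_def by (intro polynomial_fun_intros m_poly)
    show "a j x = a j x'" if "\<And>i. i \<noteq> l \<Longrightarrow> x $ i = x' $ i" for j x x'
      unfolding a_def m_def using that by (intro sum.cong refl arg_cong2[of _ _ _ _ "(*)"] prod.cong) auto
    show "P x = (\<Sum>j\<le>d. a j x * x $ l ^ j)" for x
    proof -
      have le: "e l \<le> d" if "e \<in> A" for e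
      proof -
        have "e l \<le> e l * w l" using wpos[of l] by simp
        then show ?thesis using wt'[OF that] by linarith
      qed
      have "P x = (\<Sum>e\<in>A. c e * m e x * x $ l ^ e l)"
        unfolding P m_def
        by (intro sum.cong refl, subst prod.remove[of UNIV l]) (auto simp: Compl_eq_Diff_UNIV mult_ac)
      also have "\<dots> = (\<Sum>j\<le>d. \<Sum>e\<in>B j. c e * m e x * x $ l ^ e l)"
        unfolding B_def by (rule sum.group[symmetric]) (use A le in auto)
      also have "\<dots> = (\<Sum>j\<le>d. a j x * x $ l ^ j)"
        unfolding a_def sum_distrib_right by (intro sum.cong refl) (auto simp: B_def)
      finally show ?thesis .
    qed
    show "a j x = 0" if "d < j * w l" for j x
    proof -
      have "B j = {}" using wt' that by (force simp: B_def)
      then show ?thesis by (simp add: a_def)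
    qed
    show "a j x = a j 0" if "j * w l = d" for j x
    proof -
      have "e i = 0" if "e \<in> B j" "i \<noteq> l" for e i
        using wt_le[of e i] that \<open>j * w l = d\<close> wpos[of i] by (auto simp: B_def)
      then have "x $ i ^ e i = 0 $ i ^ e i" if "e \<in> B j" "i \<in> -{l}" for e i
        using that by (metis ComplD power_0 singletonI)
      then have "m e x = m e 0" if "e \<in> B j" for e
        unfolding m_def using that by (intro prod.cong) auto
      then show ?thesis unfolding a_def by (intro sum.cong refl) simp
    qed
    show "a j 0 = 0" if "j * w l \<noteq> d" for j
    proof (cases "j * w l < d")
      case True
      then have "m e 0 = 0" if "e \<in> B j" for e using nonconst[OF that] m0 by blast
      then show ?thesis unfolding a_def by simp
    next
      case False
      then have "B j = {}" using wt' that by (force simp: B_def)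
      then show ?thesis by (simp add: a_def)
    qed
    show "a j x = (\<Sum>i | i \<noteq> l \<and> w i + j * w l = d. \<kappa> j i * x $ i) + r j x"
      if "j * w l < d" for j x
    proof -
      let ?I = "{i. i \<noteq> l \<and> s j i \<in> A}"
      have split: "B j = s j ` ?I \<union> R j" "s j ` ?I \<inter> R j = {}"
        by (auto simp: B_def R_def s_def)
      have "a j x = (\<Sum>e\<in>s j ` ?I. c e * m e x) + (\<Sum>e\<in>R j. c e * m e x)"
        unfolding a_def split(1) by (rule sum.union_disjoint) (use finR split(2) in auto)
      also have "(\<Sum>e\<in>s j ` ?I. c e * m e x) = (\<Sum>i\<in>?I. c (s j i) * m (s j i) x)"
        by (subst sum.reindex) (use s_inj[of j] in \<open>auto simp: inj_on_def\<close>)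
      also have "\<dots> = (\<Sum>i\<in>E j. \<kappa> j i * x $ i)"
        by (rule sum.mono_neutral_cong_left) (use s_E m_s in \<open>auto simp: \<kappa>_def E_def\<close>)
      finally show ?thesis using that by (simp add: r_def E_def)
    qed
    show "polynomial_fun (r j)" for j
      unfolding r_def by (cases "j * w l < d") (auto intro!: polynomial_fun_intros m_poly)
    show "r j x = r j x'" if "\<And>i. i \<noteq> l \<Longrightarrow> w i + j * w l < d \<Longrightarrow> x $ i = x' $ i" for j x x'
    proof -
      have "m e x = m e x'" if "e \<in> R j" for e
        unfolding m_def
      proof (rule prod.cong[OF refl])
        fix i assume i: "i \<in> -{l}"
        show "x $ i ^ e i = x' $ i ^ e i"
        proof (cases "e i = 0")
          case False
          then have "x $ i = x' $ i" using light[OF that, of i] i \<open>\<And>i. i \<noteq> l \<Longrightarrow> w i + j * w l < d \<Longrightarrow> x $ i = x' $ i\<close> by auto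
          then show ?thesis by simp
        qed simp
      qed
      then show ?thesis unfolding r_def by (auto intro: sum.cong)
    qed
    show "r j 0 = 0" if "j * w l < d" for j
    proof -
      have "m e 0 = 0" if "e \<in> R j" for e using nonconst[of e j] m0 that \<open>j * w l < d\<close> by (auto simp: R_def)
      then show ?thesis unfolding r_def by simp
    qed
    show "(r j has_derivative (\<lambda>_. 0)) (at 0)" if j: "j * w l < d" for j
    proof -
      have "(m e has_derivative (\<lambda>_. 0)) (at 0)" if e: "e \<in> R j" for e
      proof -
        obtain i where i: "i \<noteq> l" "e i > 0" using nonconst[of e j] e j by (auto simp: R_def)
        define e' where "e' = e(i := e i - 1)"
        have m_e: "m e = (\<lambda>x. x $ i * m e' x)"
        proof
          fix x
          have "m e x = x $ i ^ e i * (\<Prod>i'\<in>-{l}-{i}. x $ i' ^ e i')"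
            unfolding m_def using i by (subst prod.remove[of _ i]) auto
          also have "x $ i ^ e i = x $ i * x $ i ^ (e i - 1)"
            using i by (simp add: power_eq_if)
          finally have "m e x = x $ i * (x $ i ^ (e i - 1) * (\<Prod>i'\<in>-{l}-{i}. x $ i' ^ e i'))"
            by (simp only: mult.assoc)
          moreover have "m e' x = x $ i ^ e' i * (\<Prod>i'\<in>-{l}-{i}. x $ i' ^ e' i')"
            unfolding m_def using i by (subst prod.remove[of _ i]) auto
          moreover have "(\<Prod>i'\<in>-{l}-{i}. x $ i' ^ e' i') = (\<Prod>i'\<in>-{l}-{i}. x $ i' ^ e i')"
            by (rule prod.cong) (auto simp: e'_def)
          ultimately show "m e x = x $ i * m e' x" by (simp add: e'_def)
        qed
        have "\<exists>i'. i' \<noteq> l \<and> e' i' > 0"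
        proof (rule ccontr)
          assume "\<not> ?thesis"
          then have "e = s j i" using i e by (fastforce simp: e'_def s_def R_def B_def)
          then show False using e i by (auto simp: R_def)
        qed
        then have "m e' 0 = 0" using m0 by blast
        then show ?thesis unfolding m_e
          by (intro has_derivative_mult_at_common_zero[OF polynomial_fun_has_derivative
              polynomial_fun_has_derivative] polynomial_fun_coord m_poly) auto
      qed
      then have "((\<lambda>x. \<Sum>e\<in>R j. c e * m e x) has_derivative (\<lambda>x. \<Sum>e\<in>R j. c e * 0)) (at 0)"
        by (intro has_derivative_sum has_derivative_mult_right)
      then show ?thesis using j by (simp add: r_def)
    qed
  qed
qed

section \<open>Holomorphic germs in several variables\<close>

lemma norm_vector_scalar_mult: "norm (c *s x) = norm c * norm (x :: complex ^ 'n)"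
  by (simp add: norm_vec_def norm_mult L2_set_right_distrib)

lemma tendsto_vector_scalar_mult_0: "((\<lambda>c. c *s y) \<longlongrightarrow> 0) (at (0::complex))"
proof -
  have "((\<lambda>c. norm (c *s y)) \<longlongrightarrow> 0) (at (0::complex))"
    unfolding norm_vector_scalar_mult by (auto intro!: tendsto_eq_intros)
  then show ?thesis by (simp add: tendsto_norm_zero_iff)
qed

lemma has_derivative_line:
  "((\<lambda>c. y + c *s h) has_derivative (\<lambda>c. c *s h)) (at (c0 :: complex))"
proof -
  have "linear (\<lambda>c::complex. c *s h)"
    by (rule linearI) (simp_all add: Finite_Cartesian_Product.vec_eq_iff algebra_simps)
  then have "bounded_linear (\<lambda>c::complex. c *s h)" by (rule linear_conv_bounded_linear[THEN iffD1])
  then show ?thesis by (auto intro!: derivative_eq_intros bounded_linear_imp_has_derivative)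
qed

lemma clinear_derivative_along_line:
  fixes g :: "complex ^ 'n \<Rightarrow> complex"
  assumes "(g has_derivative D) (at (y + c *s h))" "\<And>c v. D (c *s v) = c * D v"
  shows "((\<lambda>c. g (y + c *s h)) has_field_derivative D h) (at c)"
proof -
  have "((\<lambda>c. g (y + c *s h)) has_derivative (\<lambda>c. D (c *s h))) (at c)"
    using diff_chain_at[OF has_derivative_line assms(1)] by (simp add: o_def)
  then show ?thesis by (simp add: has_field_derivative_def assms(2) mult.commute[of _ "D h"])
qed

lemma holo_germ_isCont_0: "holo_germ H \<Longrightarrow> isCont H 0"
  unfolding holo_germ_def holo_on_def using has_derivative_continuous by blast

section \<open>Uniqueness of the multiplicity\<close>

text \<open>Along a complex line through the origin the expansion in homogeneous parts is a power series in
  one variable, whose lowest term is the value of the first nonzero homogeneous part.\<close>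

lemma has_multiplicity_limit:
  assumes "has_multiplicity F m"
  obtains P \<delta> where "homogeneous_poly m P" "P \<noteq> (\<lambda>_. 0)" "\<delta> > 0"
    "\<And>y. norm y < \<delta> \<Longrightarrow> ((\<lambda>c. F (c *s y) / c ^ m) \<longlongrightarrow> P y) (at 0)"
proof -
  obtain Fh where Fh: "\<And>k. homogeneous_poly k (Fh k)" "\<forall>\<^sub>F y in nhds 0. (\<lambda>k. Fh k y) sums F y"
    "\<And>k. k < m \<Longrightarrow> Fh k = (\<lambda>_. 0)" "Fh m \<noteq> (\<lambda>_. 0)"
    using assms unfolding has_multiplicity_def by blast
  obtain \<delta> where \<delta>: "\<delta> > 0" "\<And>y. norm y < \<delta> \<Longrightarrow> (\<lambda>k. Fh k y) sums F y"
    using Fh(2) unfolding eventually_nhds_metric by auto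
  have "((\<lambda>c. F (c *s y) / c ^ m) \<longlongrightarrow> Fh m y) (at 0)" if y: "norm y < \<delta>" for y
  proof -
    let ?f = "\<lambda>c. if c = 0 then Fh m y else F (c *s y) / c ^ m"
    have "(\<lambda>k. Fh (k + m) y * c ^ k) sums ?f c" if c: "norm c < 1" for c
    proof (cases "c = 0")
      case True
      then show ?thesis using powser_sums_zero[of "\<lambda>k. Fh (k + m) y"] by simp
    next
      case False
      have "norm (c *s y) \<le> 1 * norm y" unfolding norm_vector_scalar_mult
        by (intro mult_right_mono) (use c in auto)
      then have "norm (c *s y) < \<delta>" using y by simp
      then have "(\<lambda>k. Fh k (c *s y)) sums F (c *s y)" by (rule \<delta>(2))
      then have "(\<lambda>k. Fh (k + m) (c *s y)) sums (F (c *s y) - (\<Sum>k<m. Fh k (c *s y)))"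
        by (rule sums_split_initial_segment)
      also have "(\<Sum>k<m. Fh k (c *s y)) = 0" using Fh(3) by (intro sum.neutral) auto
      finally have "(\<lambda>k. Fh (k + m) (c *s y) / c ^ m) sums (F (c *s y) / c ^ m)"
        by (intro sums_divide) simp
      then show ?thesis using False Fh(1)
        by (simp add: homogeneous_poly_def power_add mult_ac)
    qed
    then have "(?f \<longlongrightarrow> Fh (0 + m) y) (at 0)"
      by (intro powser_limit_0[of 1]) auto
    moreover have "\<forall>\<^sub>F c in at 0. ?f c = F (c *s y) / c ^ m"
      by (auto simp: eventually_at_filter)
    ultimately show ?thesis by (simp add: tendsto_cong)
  qed
  then show ?thesis using Fh(1,4) \<delta>(1) by (intro that[of "Fh m" \<delta>]) auto
qed

text \<open>Divide \<open>F (c y) = H (c y) F' (c y)\<close> by \<open>c\<^sup>m\<close> and let \<open>c \<rightarrow> 0\<close>: if \<open>F'\<close> had larger order, the right-hand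
  side would tend to zero for every \<open>y\<close>, the left-hand side does not.\<close>

lemma has_multiplicity_dvd_le:
  assumes F: "has_multiplicity F m" and F': "has_multiplicity F' m'"
    and H: "holo_germ H" and eq: "\<forall>\<^sub>F y in nhds 0. F y = H y * F' y"
  shows "m' \<le> m"
proof (rule ccontr)
  assume "\<not> m' \<le> m"
  then obtain k where k: "m' = m + Suc k" by (metis add_Suc_right less_iff_Suc_add not_le)
  obtain P \<delta> where P: "homogeneous_poly m P" "P \<noteq> (\<lambda>_. 0)" "\<delta> > 0"
    "\<And>y. norm y < \<delta> \<Longrightarrow> ((\<lambda>c. F (c *s y) / c ^ m) \<longlongrightarrow> P y) (at 0)"
    by (rule has_multiplicity_limit[OF F]) blast
  obtain P' \<delta>' where P': "\<delta>' > 0"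
    "\<And>y. norm y < \<delta>' \<Longrightarrow> ((\<lambda>c. F' (c *s y) / c ^ m') \<longlongrightarrow> P' y) (at 0)"
    by (rule has_multiplicity_limit[OF F']) blast
  obtain y0 where y0: "P y0 \<noteq> 0" using P(2) by auto
  define e where "e = min \<delta> \<delta>' / (2 * (norm y0 + 1))"
  define y where "y = complex_of_real e *s y0"
  have e: "e > 0" using P(3) P'(1) by (simp add: e_def add_nonneg_pos)
  have "norm y = e * norm y0" using e by (simp add: y_def norm_vector_scalar_mult)
  also have "\<dots> < e * (2 * (norm y0 + 1))" using e by (simp add: add_strict_increasing2)
  also have "\<dots> = min \<delta> \<delta>'" unfolding e_def
    by (intro nonzero_eq_divide_eq[THEN iffD1] refl) (simp add: add_nonneg_eq_0_iff)
  finally have y: "norm y < \<delta>" "norm y < \<delta>'" by auto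
  have Py: "P y \<noteq> 0" using P(1) y0 e by (simp add: homogeneous_poly_def y_def)
  have "((\<lambda>c. H (c *s y)) \<longlongrightarrow> H 0) (at 0)"
    using isCont_tendsto_compose[OF holo_germ_isCont_0[OF H] tendsto_vector_scalar_mult_0] .
  moreover have "((\<lambda>c. F' (c *s y) / c ^ m') \<longlongrightarrow> P' y) (at 0)" by (rule P'(2)[OF y(2)])
  ultimately have "((\<lambda>c. H (c *s y) * (F' (c *s y) / c ^ m') * c ^ Suc k) \<longlongrightarrow> H 0 * P' y * 0 ^ Suc k) (at 0)"
    by (intro tendsto_intros)
  moreover have "\<forall>\<^sub>F c in at 0. H (c *s y) * (F' (c *s y) / c ^ m') * c ^ Suc k = F (c *s y) / c ^ m"
  proof -
    have "\<forall>\<^sub>F c in at 0. F (c *s y) = H (c *s y) * F' (c *s y)"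
      by (rule eventually_compose_filterlim[OF eq tendsto_vector_scalar_mult_0])
    moreover have "\<forall>\<^sub>F c in at (0::complex). c \<noteq> 0" by (simp add: eventually_at_filter)
    ultimately show ?thesis by eventually_elim (simp add: k power_add)
  qed
  ultimately have "((\<lambda>c. F (c *s y) / c ^ m) \<longlongrightarrow> 0) (at 0)"
    by (simp add: tendsto_cong)
  with P(4)[OF y(1)] have "P y = 0" using tendsto_unique trivial_limit_at by blast
  with Py show False by simp
qed

text \<open>Two sets that represent the image agree near the origin, so their reduced equations divide each
  other, and \<open>has_multiplicity_dvd_le\<close> applies in both directions.\<close>

lemma image_multiplicity_eqI:
  assumes "represents_image f X" "reduced_equation X F" "has_multiplicity F m"
  shows "image_multiplicity f = m"
  unfolding image_multiplicity_def
proof (rule the_equality)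
  show "\<exists>X F. represents_image f X \<and> reduced_equation X F \<and> has_multiplicity F m"
    using assms by blast
next
  fix m' assume "\<exists>X F. represents_image f X \<and> reduced_equation X F \<and> has_multiplicity F m'"
  then obtain X' F' where *: "represents_image f X'" "reduced_equation X' F'" "has_multiplicity F' m'"
    by blast
  obtain U1 where U1: "open U1" "0 \<in> U1"
    "\<And>U. open U \<Longrightarrow> 0 \<in> U \<Longrightarrow> U \<subseteq> U1 \<Longrightarrow> \<forall>\<^sub>F y in nhds 0. y \<in> X \<longleftrightarrow> y \<in> f ` U"
    using assms(1) unfolding represents_image_def by blast
  obtain U2 where U2: "open U2" "0 \<in> U2"
    "\<And>U. open U \<Longrightarrow> 0 \<in> U \<Longrightarrow> U \<subseteq> U2 \<Longrightarrow> \<forall>\<^sub>F y in nhds 0. y \<in> X' \<longleftrightarrow> y \<in> f ` U"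
    using *(1) unfolding represents_image_def by blast
  have "\<forall>\<^sub>F y in nhds 0. y \<in> X \<longleftrightarrow> y \<in> f ` (U1 \<inter> U2)"
    "\<forall>\<^sub>F y in nhds 0. y \<in> X' \<longleftrightarrow> y \<in> f ` (U1 \<inter> U2)"
    by (rule U1(3) U2(3); use U1 U2 in \<open>simp add: open_Int\<close>)+
  then have XX: "\<forall>\<^sub>F y in nhds 0. y \<in> X \<longleftrightarrow> y \<in> X'" by eventually_elim blast
  have le: "n' \<le> n" if red: "reduced_equation Y G" "reduced_equation Y' G'"
    and mul: "has_multiplicity G n" "has_multiplicity G' n'"
    and YY: "\<forall>\<^sub>F y in nhds 0. y \<in> Y \<longleftrightarrow> y \<in> Y'" for Y Y' G G' n n'
  proof -
    have "\<forall>\<^sub>F y in nhds 0. y \<in> Y \<longleftrightarrow> G y = 0" "holo_germ G"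
      using red(1) unfolding reduced_equation_def by auto
    with YY have "holo_germ G \<and> (\<forall>\<^sub>F y in nhds 0. y \<in> Y' \<longrightarrow> G y = 0)"
      by (auto elim: eventually_elim2)
    then obtain H where "holo_germ H" "\<forall>\<^sub>F y in nhds 0. G y = H y * G' y"
      using red(2) unfolding reduced_equation_def by blast
    with mul show ?thesis by (rule has_multiplicity_dvd_le)
  qed
  have XX': "\<forall>\<^sub>F y in nhds 0. y \<in> X' \<longleftrightarrow> y \<in> X" using XX by eventually_elim blast
  show "m' = m"
    using le[OF assms(2) *(2) assms(3) *(3) XX] le[OF *(2) assms(2) *(3) assms(3) XX'] by simp
qed

section \<open>Holomorphic dependence of an integral on parameters\<close>

text \<open>On a complex line through \<open>y\<close> this is Taylor's formula of order one, with the second derivative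
  bounded by Cauchy's inequality. The point is that the constant depends on \<open>M\<close> and \<open>\<rho>\<close> only, which
  makes the estimate uniform in families of functions.\<close>

lemma holo_second_order_bound:
  fixes g :: "complex ^ 'n \<Rightarrow> complex"
  assumes g: "holo_on g (ball y \<rho>)" and M: "\<And>x. x \<in> ball y \<rho> \<Longrightarrow> norm (g x) < M"
    and D: "(g has_derivative D) (at y)" "\<And>c v. D (c *s v) = c * D v"
    and h: "norm h < \<rho> / 2"
  shows "norm (g (y + h) - g y - D h) \<le> 8 * M / \<rho>\<^sup>2 * (norm h)\<^sup>2"
proof (cases "h = 0")
  case True
  moreover have "D 0 = 0" using D(2)[of 0 0] by simp
  ultimately show ?thesis by simp
next
  case False
  then have nh: "norm h > 0" by simp
  define R where "R = \<rho> / norm h"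
  define \<phi> where "\<phi> = (\<lambda>c. g (y + c *s h))"
  have R: "R > 2" using h nh by (simp add: R_def field_simps)
  have inball: "y + c *s h \<in> ball y \<rho>" if "norm c < R" for c
    using that nh by (simp add: dist_norm norm_vector_scalar_mult R_def field_simps)
  have der: "\<exists>d. (\<phi> has_field_derivative d) (at c)" if c: "norm c < R" for c
  proof -
    obtain E where "(g has_derivative E) (at (y + c *s h))" "\<forall>c v. E (c *s v) = c * E v"
      using g inball[OF c] unfolding holo_on_def by blast
    then show ?thesis unfolding \<phi>_def using clinear_derivative_along_line by blast
  qed
  have hol: "\<phi> holomorphic_on ball 0 R"
    using der unfolding holomorphic_on_def field_differentiable_def
    by (metis has_field_derivative_at_within mem_ball_0)
  have d0: "deriv \<phi> 0 = D h"
    unfolding \<phi>_def by (rule DERIV_imp_deriv, rule clinear_derivative_along_line) (use D in auto)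
  have bound: "norm ((deriv ^^ 2) \<phi> c) \<le> 8 * M / \<rho>\<^sup>2 * (norm h)\<^sup>2" if c: "norm c \<le> 1" for c
  proof -
    have sub: "cball c (R/2) \<subseteq> ball 0 R"
    proof
      fix z assume "z \<in> cball c (R/2)"
      then have "norm z \<le> norm c + R / 2"
        by (metis add_left_mono dist_norm mem_cball norm_minus_commute norm_triangle_sub order_trans)
      then show "z \<in> ball 0 R" using c R by simp
    qed
    have "norm ((deriv ^^ 2) \<phi> c) \<le> fact 2 * M / (R/2) ^ 2"
    proof (rule Cauchy_higher_deriv_bound[where y = 0])
      show "\<phi> holomorphic_on ball c (R/2)"
        using hol sub ball_subset_cball by (blast intro: holomorphic_on_subset)
      show "continuous_on (cball c (R/2)) \<phi>"
        using hol sub holomorphic_on_imp_continuous_on continuous_on_subset by blast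
      show "\<phi> w \<in> ball 0 M" if "w \<in> ball c (R/2)" for w
      proof -
        have "w \<in> ball 0 R" using that sub ball_subset_cball[of c "R/2"] by blast
        then have "norm w < R" by simp
        then show ?thesis using M[OF inball] by (simp add: \<phi>_def)
      qed
    qed (use R in auto)
    also have "\<dots> = 8 * M / \<rho>\<^sup>2 * (norm h)\<^sup>2" by (simp add: R_def power_divide)
    finally show ?thesis .
  qed
  have "norm ((deriv ^^ 0) \<phi> 1 - (\<Sum>i\<le>1. (deriv ^^ i) \<phi> 0 * (1 - 0) ^ i / fact i))
      \<le> (8 * M / \<rho>\<^sup>2 * (norm h)\<^sup>2) * norm (1 - 0 :: complex) ^ Suc 1 / fact 1"
  proof (rule complex_Taylor[where S = "cball 0 1" and n = 1])
    show "((deriv ^^ i) \<phi> has_field_derivative (deriv ^^ Suc i) \<phi> x) (at x within cball 0 1)"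
      if "x \<in> cball 0 1" "i \<le> 1" for i x
    proof -
      have "(deriv ^^ i) \<phi> holomorphic_on ball 0 R" by (intro holomorphic_higher_deriv hol) auto
      then have "((deriv ^^ i) \<phi> has_field_derivative deriv ((deriv ^^ i) \<phi>) x) (at x)"
        using holomorphic_derivI[of _ "ball 0 R" x] that R by simp
      then show ?thesis by (simp add: has_field_derivative_at_within)
    qed
    show "norm ((deriv ^^ Suc 1) \<phi> x) \<le> 8 * M / \<rho>\<^sup>2 * (norm h)\<^sup>2" if "x \<in> cball 0 1" for x
      using bound[of x] that by (simp add: numeral_2_eq_2)
  qed auto
  moreover have "(\<Sum>i\<le>1. (deriv ^^ i) \<phi> 0 * (1 - 0) ^ i / fact i) = \<phi> 0 + deriv \<phi> 0"
    by simp
  ultimately show ?thesis by (simp add: d0) (simp add: \<phi>_def diff_diff_eq)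
qed

text \<open>Integrating the linear approximations of \<open>holo_second_order_bound\<close> gives a linear approximation of
  the integral, because the error is quadratic, uniformly in \<open>s\<close>. The derivative in a direction \<open>h\<close> is
  integrable since it is a uniform limit of the continuous difference quotients.\<close>

lemma holo_on_integral:
  fixes K :: "complex ^ 'n \<Rightarrow> real \<Rightarrow> complex"
  assumes hol: "\<And>s. s \<in> {0..1} \<Longrightarrow> holo_on (\<lambda>y. K y s) (ball 0 \<rho>)"
    and cont: "\<And>y. y \<in> ball 0 \<rho> \<Longrightarrow> continuous_on {0..1} (K y)"
    and M: "\<And>y s. y \<in> ball 0 \<rho> \<Longrightarrow> s \<in> {0..1} \<Longrightarrow> norm (K y s) < M"
  shows "holo_on (\<lambda>y. integral {0..1} (K y)) (ball 0 \<rho>)"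
  unfolding holo_on_def
proof
  fix y :: "complex ^ 'n" assume y: "y \<in> ball 0 \<rho>"
  define \<rho>' where "\<rho>' = \<rho> - norm y"
  have \<rho>': "\<rho>' > 0" using y by (simp add: \<rho>'_def)
  have sub: "ball y \<rho>' \<subseteq> ball 0 \<rho>"
  proof
    fix z assume "z \<in> ball y \<rho>'"
    then have "norm z < norm y + \<rho>'"
      by (metis add_strict_left_mono dist_norm mem_ball norm_minus_commute norm_triangle_sub order_le_less_trans)
    then show "z \<in> ball 0 \<rho>" by (simp add: \<rho>'_def)
  qed
  define C where "C = 8 * M / \<rho>'\<^sup>2"
  have "\<forall>s\<in>{0..1}. \<exists>D. ((\<lambda>y. K y s) has_derivative D) (at y) \<and> (\<forall>c v. D (c *s v) = c * D v)"
    using hol y unfolding holo_on_def by blast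
  then obtain D where D: "\<And>s. s \<in> {0..1} \<Longrightarrow> ((\<lambda>y. K y s) has_derivative D s) (at y)"
    "\<And>s c v. s \<in> {0..1} \<Longrightarrow> D s (c *s v) = c * D s v" by metis
  have est: "norm (K (y + h) s - K y s - D s h) \<le> C * (norm h)\<^sup>2"
    if "norm h < \<rho>' / 2" "s \<in> {0..1}" for h s
    unfolding C_def
  proof (rule holo_second_order_bound[where g = "\<lambda>y. K y s"])
    show "holo_on (\<lambda>y. K y s) (ball y \<rho>')" using hol[OF that(2)] sub unfolding holo_on_def by blast
  qed (use that D M sub in auto)
  have lin: "linear (D s)" if "s \<in> {0..1}" for s
    using D(1)[OF that] by (rule has_derivative_linear)
  have contD: "continuous_on {0..1} (\<lambda>s. D s h)" for h
  proof -
    obtain N :: nat where N: "real N > 2 * norm h / \<rho>'" using reals_Archimedean2 by blast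
    let ?q = "\<lambda>n s. complex_of_real (real (Suc (N + n))) * (K (y + h /\<^sub>R real (Suc (N + n))) s - K y s)"
    have small: "norm (h /\<^sub>R real (Suc (N + n))) < \<rho>' / 2" for n
    proof -
      have "2 * norm h / \<rho>' < real (Suc (N + n))" using N by (simp add: order_less_le_trans)
      then have "2 * norm h < real (Suc (N + n)) * \<rho>'" using \<rho>' by (simp only: pos_divide_less_eq)
      then show ?thesis by (simp add: field_simps del: of_nat_Suc)
    qed
    have "uniform_limit {0..1} ?q (\<lambda>s. D s h) sequentially"
    proof (rule uniform_limitI)
      fix e :: real assume e: "e > 0"
      have "(\<lambda>n. C * (norm h)\<^sup>2 * inverse (real (Suc (N + n)))) \<longlonglongrightarrow> C * (norm h)\<^sup>2 * 0"
      proof (intro tendsto_mult tendsto_const)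
        show "(\<lambda>n. inverse (real (Suc (N + n)))) \<longlonglongrightarrow> 0"
          using LIMSEQ_ignore_initial_segment[OF LIMSEQ_inverse_real_of_nat, of N] by (simp add: add.commute)
      qed
      then have "\<forall>\<^sub>F n in sequentially. C * (norm h)\<^sup>2 * inverse (real (Suc (N + n))) < e"
        using order_tendstoD(2)[of _ _ sequentially e] e by simp
      then show "\<forall>\<^sub>F n in sequentially. \<forall>s\<in>{0..1}. dist (?q n s) (D s h) < e"
      proof eventually_elim
        case (elim n)
        let ?m = "real (Suc (N + n))"
        have m: "?m > 0" by simp
        show ?case
        proof
          fix s :: real assume s: "s \<in> {0..1}"
          have "D s (h /\<^sub>R ?m) = D s h /\<^sub>R ?m" using lin[OF s] by (simp add: linear_cmul)
          then have "D s h = of_real ?m * D s (h /\<^sub>R ?m)" using m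
            by (simp add: scaleR_conv_of_real field_simps del: of_nat_Suc)
          then have "dist (?q n s) (D s h) = norm (of_real ?m * (K (y + h /\<^sub>R ?m) s - K y s - D s (h /\<^sub>R ?m)))"
            by (simp only: dist_norm right_diff_distrib)
          also have "\<dots> = ?m * norm (K (y + h /\<^sub>R ?m) s - K y s - D s (h /\<^sub>R ?m))"
            using m by (simp only: norm_mult norm_of_real abs_of_pos)
          also have "\<dots> \<le> ?m * (C * (norm (h /\<^sub>R ?m))\<^sup>2)"
            using est[OF small[of n] s] m by (intro mult_left_mono) auto
          also have "\<dots> = C * (norm h)\<^sup>2 * inverse ?m"
            using m by (simp add: power_mult_distrib power2_eq_square field_simps del: of_nat_Suc)
          finally show "dist (?q n s) (D s h) < e" using elim by linarith
        qed
      qed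
    qed
    moreover have "continuous_on {0..1} (?q n)" for n
    proof -
      have "y + h /\<^sub>R real (Suc (N + n)) \<in> ball y \<rho>'"
        using small[of n] \<rho>' by (simp add: dist_norm del: of_nat_Suc)
      then have "y + h /\<^sub>R real (Suc (N + n)) \<in> ball 0 \<rho>" using sub by blast
      then show ?thesis by (intro continuous_intros cont y)
    qed
    ultimately show ?thesis by (intro uniform_limit_theorem[where F = sequentially]) auto
  qed
  note intD = integrable_continuous_real[OF contD]
  let ?D = "\<lambda>h. integral {0..1} (\<lambda>s. D s h)"
  have "linear ?D"
  proof (rule linearI)
    show "?D (a + b) = ?D a + ?D b" for a b
    proof -
      have "?D (a + b) = integral {0..1} (\<lambda>s. D s a + D s b)"
        by (rule integral_cong) (use lin linear_add in blast)
      then show ?thesis by (simp add: integral_add intD)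
    qed
    show "?D (c *\<^sub>R a) = c *\<^sub>R ?D a" for c a
    proof -
      have "?D (c *\<^sub>R a) = integral {0..1} (\<lambda>s. c *\<^sub>R D s a)"
        by (rule integral_cong) (use lin linear_cmul in blast)
      then show ?thesis by (simp add: integral_cmul)
    qed
  qed
  then have bl: "bounded_linear ?D" by (rule linear_conv_bounded_linear[THEN iffD1])
  have main: "norm (integral {0..1} (K (y + h)) - integral {0..1} (K y) - ?D h) \<le> C * (norm h)\<^sup>2"
    if h: "norm h < \<rho>' / 2" for h
  proof -
    have "y + h \<in> ball y \<rho>'" using h \<rho>' by (simp add: dist_norm)
    then have "y + h \<in> ball 0 \<rho>" using sub by blast
    note i = integrable_continuous_real[OF cont[OF this]] integrable_continuous_real[OF cont[OF y]] intD
    have "integral {0..1} (K (y + h)) - integral {0..1} (K y) - ?D h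
        = integral {0..1} (\<lambda>s. K (y + h) s - K y s - D s h)"
      using i by (simp add: integral_diff integrable_diff)
    also have "norm \<dots> \<le> C * (norm h)\<^sup>2 * (1 - 0)"
      by (rule integral_bound) (use est[OF h] \<open>y + h \<in> ball 0 \<rho>\<close> y in \<open>auto intro!: continuous_intros cont contD\<close>)
    finally show ?thesis by simp
  qed
  have "((\<lambda>y. integral {0..1} (K y)) has_derivative ?D) (at y)"
    unfolding has_derivative_at_alt
  proof (intro conjI bl allI impI)
    fix e :: real assume e: "e > 0"
    define d where "d = min (\<rho>' / 2) (e / (\<bar>C\<bar> + 1))"
    have "d > 0" using \<rho>' e by (simp add: d_def)
    moreover have "norm (integral {0..1} (K z) - integral {0..1} (K y) - ?D (z - y)) \<le> e * norm (z - y)"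
      if z: "norm (z - y) < d" for z
    proof -
      have "norm (integral {0..1} (K (y + (z - y))) - integral {0..1} (K y) - ?D (z - y)) \<le> C * (norm (z - y))\<^sup>2"
        by (rule main) (use z in \<open>simp add: d_def\<close>)
      also have "\<dots> \<le> (\<bar>C\<bar> + 1) * norm (z - y) * norm (z - y)"
        unfolding power2_eq_square mult.assoc[symmetric] by (intro mult_right_mono) auto
      also have "(\<bar>C\<bar> + 1) * norm (z - y) \<le> (\<bar>C\<bar> + 1) * (e / (\<bar>C\<bar> + 1))"
        by (intro mult_left_mono) (use z in \<open>auto simp: d_def\<close>)
      also have "\<dots> = e" by (simp add: field_simps)
      finally show ?thesis by (simp add: mult_right_mono)
    qed
    ultimately show "\<exists>d>0. \<forall>z. norm (z - y) < d \<longrightarrow>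
        norm (integral {0..1} (K z) - integral {0..1} (K y) - ?D (z - y)) \<le> e * norm (z - y)" by blast
  qed
  moreover have "?D (c *s v) = c * ?D v" for c v
  proof -
    have "?D (c *s v) = integral {0..1} (\<lambda>s. c * D s v)"
      by (rule integral_cong) (use D(2) in blast)
    then show ?thesis by simp
  qed
  ultimately show "\<exists>D. ((\<lambda>y. integral {0..1} (K y)) has_derivative D) (at y) \<and> (\<forall>c v. D (c *s v) = c * D v)"
    by blast
qed

section \<open>Division by a polynomial with simple zeros\<close>

lemma holomorphic_divide_zeros:
  assumes "finite Z" "open S" "g holomorphic_on S" "\<And>a. a \<in> Z \<Longrightarrow> a \<in> S \<and> g a = 0"
  shows "\<exists>h. h holomorphic_on S \<and> (\<forall>z\<in>S. g z = (\<Prod>a\<in>Z. z - a) * h z)"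
  using assms(1,4)
proof (induction Z rule: finite_induct)
  case empty
  show ?case using assms(3) by auto
next
  case (insert b Z)
  then obtain h where h: "h holomorphic_on S" "\<And>z. z \<in> S \<Longrightarrow> g z = (\<Prod>a\<in>Z. z - a) * h z" by auto
  have b: "b \<in> S" "g b = 0" using insert.prems by auto
  have "(\<Prod>a\<in>Z. b - a) \<noteq> 0" using insert.hyps by auto
  then have hb: "h b = 0" using h(2)[OF b(1)] b(2) by simp
  let ?k = "\<lambda>z. if z = b then deriv h b else (h z - h b) / (z - b)"
  have "?k holomorphic_on S" by (rule pole_lemma_open[OF h(1) assms(2)])
  moreover have "g z = (\<Prod>a\<in>insert b Z. z - a) * ?k z" if "z \<in> S" for z
    using h(2)[OF that] insert.hyps hb by (cases "z = b") (auto simp: b(2))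
  ultimately show ?case by blast
qed

lemma monic_poly_eq_prod_roots:
  fixes C :: "complex poly"
  assumes "lead_coeff C = 1" "card {z. poly C z = 0} = degree C"
  shows "poly C z = (\<Prod>a\<in>{z. poly C z = 0}. z - a)"
proof -
  let ?Z = "{z. poly C z = 0}"
  have C0: "C \<noteq> 0" using assms(1) by auto
  have fin: "finite ?Z" by (rule poly_roots_finite[OF C0])
  have dec: "C = (\<Prod>z\<in>?Z. [:-z, 1:] ^ order z C)"
    using complex_poly_decompose[of C] unfolding assms(1) by (simp only: smult_1_left)
  have deg: "degree C = (\<Sum>z\<in>?Z. order z C)"
  proof -
    have "degree C = degree (\<Prod>z\<in>?Z. [:-z, 1:] ^ order z C)"
      by (rule arg_cong[OF dec])
    also have "\<dots> = (\<Sum>z\<in>?Z. degree ([:-z, 1:] ^ order z C))"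
      by (rule degree_prod_eq_sum_degree) simp
    also have "\<dots> = (\<Sum>z\<in>?Z. order z C)"
      by (intro sum.cong refl) (rule degree_linear_power)
    finally show ?thesis .
  qed
  have ge: "order z C \<ge> 1" if "z \<in> ?Z" for z
    using that C0 order_root[of C z] by simp
  have one: "order z C = 1" if z: "z \<in> ?Z" for z
  proof (rule ccontr)
    assume "order z C \<noteq> 1"
    then have "1 < order z C" using ge[OF z] by linarith
    then have "(\<Sum>z\<in>?Z. 1) < (\<Sum>z\<in>?Z. order z C)"
      using ge z by (intro sum_strict_mono_ex1 fin) blast+
    then show False using deg assms(2) by simp
  qed
  have "poly C z = poly (\<Prod>z\<in>?Z. [:-z, 1:] ^ order z C) z"
    by (rule arg_cong[OF dec])
  also have "\<dots> = (\<Prod>a\<in>?Z. z - a)"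
    unfolding poly_prod by (intro prod.cong refl) (simp add: one)
  finally show ?thesis .
qed

text \<open>As \<open>C\<close> has only simple zeros and \<open>g\<close> vanishes at all of them, \<open>g / C\<close> extends holomorphically to
  the disc. On the circle it coincides with \<open>g / C\<close>, so that Cauchy's formula expresses its values
  by an integral that still makes sense when zeros of \<open>C\<close> collide.\<close>

lemma Cauchy_division:
  fixes C :: "complex poly"
  assumes C: "lead_coeff C = 1" "card {z. poly C z = 0} = degree C"
    and g: "g holomorphic_on ball 0 R" "\<And>z. poly C z = 0 \<Longrightarrow> g z = 0"
    and roots: "\<And>z. poly C z = 0 \<Longrightarrow> norm z < \<rho>" and "\<rho> < R" and z: "norm z < \<rho>"
  shows "\<exists>v. ((\<lambda>u. g u / (poly C u * (u - z))) has_contour_integral (2 * of_real pi * \<i> * v)) (circlepath 0 \<rho>)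
     \<and> g z = v * poly C z"
proof -
  have "C \<noteq> 0" using C(1) by auto
  then have "finite {z. poly C z = 0}" by (rule poly_roots_finite)
  moreover have "a \<in> ball 0 R \<and> g a = 0" if "a \<in> {z. poly C z = 0}" for a
    using that roots[of a] g(2)[of a] \<open>\<rho> < R\<close> by auto
  ultimately obtain h where h: "h holomorphic_on ball 0 R"
    "\<And>z. z \<in> ball 0 R \<Longrightarrow> g z = (\<Prod>a\<in>{z. poly C z = 0}. z - a) * h z"
    using holomorphic_divide_zeros[of "{z. poly C z = 0}" "ball 0 R" g] g(1) by auto
  have gh: "g u = poly C u * h u" if "norm u < R" for u
    using h(2)[of u] that monic_poly_eq_prod_roots[OF C, of u] by simp
  have "h holomorphic_on cball 0 \<rho>" using h(1) by (rule holomorphic_on_subset) (use \<open>\<rho> < R\<close> in auto)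
  then have "((\<lambda>u. h u / (u - z)) has_contour_integral (2 * of_real pi * \<i> * h z)) (circlepath 0 \<rho>)"
    by (rule Cauchy_integral_circlepath_simple) (use z in auto)
  moreover have "h u / (u - z) = g u / (poly C u * (u - z))" if "u \<in> path_image (circlepath 0 \<rho>)" for u
  proof -
    have u: "norm u = \<rho>" using that z by (auto simp: path_image_circlepath less_imp_le[of 0 \<rho>] norm_ge_zero[THEN le_less_trans])
    then have "poly C u \<noteq> 0" using roots[of u] by auto
    then show ?thesis using gh[of u] u \<open>\<rho> < R\<close> by simp
  qed
  ultimately have "((\<lambda>u. g u / (poly C u * (u - z))) has_contour_integral (2 * of_real pi * \<i> * h z)) (circlepath 0 \<rho>)"
    by (rule has_contour_integral_eq)
  then show ?thesis using gh[of z] z \<open>\<rho> < R\<close> by (auto simp: mult.commute)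
qed

section \<open>The characteristic polynomial of multiplication modulo a polynomial\<close>

text \<open>Column \<open>j\<close> holds the coefficients of \<open>t\<^sup>j q\<close> reduced modulo \<open>p\<close>: for \<open>p\<close> of degree \<open>r\<close>, this is the
  multiplication by \<open>q\<close> on the polynomials modulo \<open>p\<close>, in the basis of powers of \<open>t\<close>.\<close>

definition mult_mod_matrix :: "nat \<Rightarrow> complex poly \<Rightarrow> complex poly \<Rightarrow> complex mat" where
  "mult_mod_matrix r p q = mat r r (\<lambda>(k, j). coeff ((monom 1 j * q) mod p) k)"

lemma mult_mod_matrix_carrier: "mult_mod_matrix r p q \<in> carrier_mat r r"
  by (simp add: mult_mod_matrix_def)

lemma mult_mod_matrix_vec:
  assumes "k < r"
  shows "vec_index (mult_mod_matrix r p q *\<^sub>v Matrix.vec r v) k = coeff (((\<Sum>j<r. monom (v j) j) * q) mod p) k"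
proof -
  have lin: "(\<Sum>j\<in>J. f j) mod p = (\<Sum>j\<in>J. f j mod p)" for J and f :: "nat \<Rightarrow> complex poly"
    by (induction J rule: infinite_finite_induct) (auto simp: poly_mod_add_left)
  have "vec_index (mult_mod_matrix r p q *\<^sub>v Matrix.vec r v) k
      = (\<Sum>j<r. coeff ((monom 1 j * q) mod p) k * v j)"
    using assms by (simp add: mult_mod_matrix_def scalar_prod_def atLeast0LessThan)
  also have "\<dots> = coeff (\<Sum>j<r. (monom (v j) j * q) mod p) k"
  proof -
    have "(monom (v j) j * q) mod p = Polynomial.smult (v j) ((monom 1 j * q) mod p)" for j
    proof -
      have "monom (v j) j * q = Polynomial.smult (v j) (monom 1 j * q)" by (simp add: smult_monom flip: mult_smult_left)
      then show ?thesis by (simp add: mod_smult_left)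
    qed
    then show ?thesis by (simp add: coeff_sum mult.commute)
  qed
  also have "(\<Sum>j<r. (monom (v j) j * q) mod p) = ((\<Sum>j<r. monom (v j) j) * q) mod p"
    by (simp add: sum_distrib_right lin)
  finally show ?thesis .
qed

text \<open>Over the complex numbers coprimality is the absence of common roots; linear factors of \<open>p\<close> are
  cancelled one at a time.\<close>

lemma poly_dvd_mult_cancel_no_common_root:
  fixes p P s :: "complex poly"
  assumes "p \<noteq> 0" "p dvd P * s" "\<And>t. poly p t = 0 \<Longrightarrow> poly s t \<noteq> 0"
  shows "p dvd P"
  using assms
proof (induction "degree p" arbitrary: p P)
  case 0
  then show ?case by (simp add: is_unit_iff_degree unit_imp_dvd)
next
  case (Suc n)
  have "\<not> constant (poly p)" using Suc(2) by (simp add: constant_degree)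
  then obtain t where t: "poly p t = 0" using fundamental_theorem_of_algebra by blast
  then obtain p1 where p1: "p = [:-t, 1:] * p1" by (auto simp: poly_eq_0_iff_dvd)
  have "poly (P * s) t = 0" using Suc.prems(2) t dvd_trans unfolding poly_eq_0_iff_dvd by blast
  then have "poly P t = 0" using Suc.prems(3)[OF t] by (simp only: poly_mult mult_eq_0_iff) simp
  then obtain P1 where P1: "P = [:-t, 1:] * P1" by (auto simp: poly_eq_0_iff_dvd)
  have p10: "p1 \<noteq> 0" using p1 Suc.prems(1) by auto
  have "[:-t, 1:] * p1 dvd [:-t, 1:] * (P1 * s)"
    using Suc.prems(2) unfolding p1 P1 by (simp only: mult.assoc)
  then have "p1 dvd P1 * s" by (subst (asm) dvd_mult_cancel_left) simp
  moreover have "n = degree p1" using degree_mult_eq[of "[:-t, 1:]" p1] p10 Suc(2) unfolding p1[symmetric] by simp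
  moreover have "poly s t' \<noteq> 0" if "poly p1 t' = 0" for t'
    using Suc.prems(3)[of t'] that by (simp add: p1)
  ultimately have "p1 dvd P1" using Suc(1) p10 by blast
  then show ?case unfolding p1 P1 by (rule mult_dvd_mono[OF dvd_refl])
qed

text \<open>An eigenvector for \<open>z\<close> is a nonzero polynomial \<open>P\<close> of degree less than \<open>r\<close> with \<open>p\<close> dividing
  \<open>P (q - z)\<close>. If \<open>p\<close> and \<open>q - z\<close> had no common root, \<open>p\<close> would divide \<open>P\<close>, which its degree
  forbids; for a common root \<open>t\<close>, the polynomial \<open>p / (X - t)\<close> is an eigenvector.\<close>

lemma eigenvalue_mult_mod_matrix:
  assumes p: "degree p = r" "r > 0"
  shows "eigenvalue (mult_mod_matrix r p q) z \<longleftrightarrow> (\<exists>t. poly p t = 0 \<and> poly q t = z)"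
proof -
  let ?M = "mult_mod_matrix r p q"
  have p0: "p \<noteq> 0" using p by auto
  have P_coeff: "coeff (\<Sum>j<r. monom (v j) j) k = (if k < r then v k else 0)" for v :: "nat \<Rightarrow> complex" and k
    by (simp add: coeff_sum coeff_monom)
  have P_deg: "degree (\<Sum>j<r. monom (v j) j) < r" for v :: "nat \<Rightarrow> complex"
    using p(2) by (intro degree_lessI) (auto simp: P_coeff)
  have dims: "X = Y \<longleftrightarrow> (\<forall>k<r. vec_index X k = vec_index Y k)"
    if "dim_vec X = r" "dim_vec Y = r" for X Y :: "complex Matrix.vec"
    using that by (metis eq_vecI)
  have key: "?M *\<^sub>v Matrix.vec r v = z \<cdot>\<^sub>v Matrix.vec r v \<longleftrightarrow> p dvd (\<Sum>j<r. monom (v j) j) * (q - [:z:])" for v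
  proof -
    let ?P = "\<Sum>j<r. monom (v j) j"
    have "?M *\<^sub>v Matrix.vec r v = z \<cdot>\<^sub>v Matrix.vec r v \<longleftrightarrow> (\<forall>k<r. coeff ((?P * q) mod p) k = z * v k)"
    proof -
      have "?M *\<^sub>v Matrix.vec r v = z \<cdot>\<^sub>v Matrix.vec r v \<longleftrightarrow>
          (\<forall>k<r. vec_index (?M *\<^sub>v Matrix.vec r v) k = vec_index (z \<cdot>\<^sub>v Matrix.vec r v) k)"
        using dims[of "?M *\<^sub>v Matrix.vec r v" "z \<cdot>\<^sub>v Matrix.vec r v"] mult_mod_matrix_carrier[of r p q] by simp
      then show ?thesis by (simp add: mult_mod_matrix_vec)
    qed
    also have "\<dots> \<longleftrightarrow> (?P * q) mod p = Polynomial.smult z ?P"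
    proof
      assume *: "\<forall>k<r. coeff ((?P * q) mod p) k = z * v k"
      have "degree ((?P * q) mod p) < r" using degree_mod_less[OF p0, of "?P * q"] p by auto
      then have "coeff ((?P * q) mod p) k = 0" if "k \<ge> r" for k
        using that by (intro coeff_eq_0) simp
      then show "(?P * q) mod p = Polynomial.smult z ?P"
        using * by (intro poly_eqI) (simp add: P_coeff)
    qed (simp add: P_coeff)
    also have "Polynomial.smult z ?P = (Polynomial.smult z ?P) mod p"
      by (rule mod_poly_less[symmetric]) (use P_deg[of v] p degree_smult_le[of z ?P] in simp)
    also have "(?P * q) mod p = \<dots> \<longleftrightarrow> p dvd ?P * q - Polynomial.smult z ?P"
      by (rule mod_eq_dvd_iff)
    also have "?P * q - Polynomial.smult z ?P = ?P * (q - [:z:])" by (simp add: algebra_simps)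
    finally show ?thesis .
  qed
  show ?thesis
  proof
    assume "eigenvalue ?M z"
    then obtain u where u: "u \<in> carrier_vec r" "u \<noteq> 0\<^sub>v r" "?M *\<^sub>v u = z \<cdot>\<^sub>v u"
      unfolding eigenvalue_def eigenvector_def using mult_mod_matrix_carrier[of r p q] by auto
    define v where "v = vec_index u"
    have uv: "u = Matrix.vec r v" using u(1) by (auto simp: v_def)
    let ?P = "\<Sum>j<r. monom (v j) j"
    have dvd: "p dvd ?P * (q - [:z:])" using key[of v] u(3) uv by simp
    have P0: "?P \<noteq> 0"
    proof
      assume "?P = 0"
      then have "v k = 0" if "k < r" for k using P_coeff[of v k] that by simp
      then show False using u(2) uv by (auto simp: Matrix.vec_eq_iff)
    qed
    show "\<exists>t. poly p t = 0 \<and> poly q t = z"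
    proof (rule ccontr)
      assume "\<not> ?thesis"
      then have "p dvd ?P" using p0 dvd by (intro poly_dvd_mult_cancel_no_common_root[of p ?P]) auto
      then have "degree p \<le> degree ?P" using P0 by (rule dvd_imp_degree_le)
      then show False using P_deg[of v] p by simp
    qed
  next
    assume "\<exists>t. poly p t = 0 \<and> poly q t = z"
    then obtain t where t: "poly p t = 0" "poly (q - [:z:]) t = 0" by auto
    obtain p1 where p1: "p = [:-t, 1:] * p1" using t(1) by (auto simp: poly_eq_0_iff_dvd)
    have q1: "[:-t, 1:] dvd q - [:z:]" using t(2) by (simp only: poly_eq_0_iff_dvd)
    have p10: "p1 \<noteq> 0" using p0 p1 by auto
    have deg: "degree p1 < r" using degree_mult_eq[of "[:-t, 1:]" p1] p10 p unfolding p1[symmetric] by simp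
    define v where "v = coeff p1"
    have P: "(\<Sum>j<r. monom (v j) j) = p1"
      by (rule poly_eqI) (use deg in \<open>auto simp: P_coeff v_def coeff_eq_0\<close>)
    have "p dvd p1 * (q - [:z:])" unfolding p1 using q1 by (metis dvd_refl mult.commute mult_dvd_mono)
    then have "?M *\<^sub>v Matrix.vec r v = z \<cdot>\<^sub>v Matrix.vec r v" using key[of v] P by simp
    moreover have "Matrix.vec r v \<noteq> 0\<^sub>v r"
    proof
      assume *: "Matrix.vec r v = 0\<^sub>v r"
      have "v (degree p1) = 0" using arg_cong[OF *, of "\<lambda>x. vec_index x (degree p1)"] deg by simp
      then show False using p10 by (simp add: v_def)
    qed
    ultimately show "eigenvalue ?M z"
      unfolding eigenvalue_def eigenvector_def using mult_mod_matrix_carrier[of r p q]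
      by (intro exI[of _ "Matrix.vec r v"]) auto
  qed
qed

text \<open>Division by a monic polynomial needs no division of coefficients: to pass from \<open>t\<^sup>j\<close> to the next power,
  shift the remainder and subtract a multiple of \<open>p\<close>.\<close>

lemma polynomial_fun_coeff_monom_mod:
  fixes p :: "complex ^ 'n \<Rightarrow> complex poly"
  assumes p: "\<And>y. degree (p y) = r" "\<And>y. lead_coeff (p y) = 1" "r > 0"
    "\<And>k. polynomial_fun (\<lambda>y. coeff (p y) k)"
  shows "polynomial_fun (\<lambda>y. coeff (monom 1 j mod p y) k)"
proof (induction j arbitrary: k)
  case 0
  have "monom 1 0 mod p y = 1" for y using p(1)[of y] p(3) by (simp add: mod_poly_less monom_0 one_pCons)
  then show ?case by (simp add: polynomial_fun_const)
next
  case (Suc j)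
  have p0: "p y \<noteq> 0" for y using p(1)[of y] p(3) by auto
  have "monom 1 (Suc j) mod p y = pCons 0 (monom 1 j mod p y)
      - Polynomial.smult (coeff (pCons 0 (monom 1 j mod p y)) r) (p y)" for y
    using mod_pCons[OF p0, of 0 "monom 1 j" y] p(1,2)[of y] by (simp add: monom_Suc)
  then have "coeff (monom 1 (Suc j) mod p y) k = coeff (pCons 0 (monom 1 j mod p y)) k
      - coeff (pCons 0 (monom 1 j mod p y)) r * coeff (p y) k" for y by simp
  moreover have "polynomial_fun (\<lambda>y. coeff (pCons 0 (monom 1 j mod p y)) k)" for k
    using Suc by (cases k) (auto intro: polynomial_fun_const)
  ultimately show ?case using p(4) by (auto intro!: polynomial_fun_intros)
qed

lemma polynomial_fun_mult_mod_matrix: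
  fixes p q :: "complex ^ 'n \<Rightarrow> complex poly"
  assumes p: "\<And>y. degree (p y) = r" "\<And>y. lead_coeff (p y) = 1" "r > 0"
    "\<And>k. polynomial_fun (\<lambda>y. coeff (p y) k)"
    and q: "\<And>y. degree (q y) \<le> N" "\<And>k. polynomial_fun (\<lambda>y. coeff (q y) k)"
    and kj: "k < r" "j < r"
  shows "polynomial_fun (\<lambda>y. mult_mod_matrix r (p y) (q y) $$ (k, j))"
proof -
  have lin: "(\<Sum>j\<in>J. f j) mod p y = (\<Sum>j\<in>J. f j mod p y)" for J y and f :: "nat \<Rightarrow> complex poly"
    by (induction J rule: infinite_finite_induct) (auto simp: poly_mod_add_left)
  have "(monom 1 j * q y) mod p y = (\<Sum>i\<le>N. Polynomial.smult (coeff (q y) i) (monom 1 (j + i) mod p y))" for y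
  proof -
    have "q y = (\<Sum>i\<le>N. monom (coeff (q y) i) i)" using q(1) by (rule poly_as_sum_of_monoms'[symmetric])
    then have "monom 1 j * q y = monom 1 j * (\<Sum>i\<le>N. monom (coeff (q y) i) i)" by simp
    also have "\<dots> = (\<Sum>i\<le>N. Polynomial.smult (coeff (q y) i) (monom 1 (j + i)))"
      by (simp add: sum_distrib_left mult_monom smult_monom)
    finally show ?thesis by (simp add: lin mod_smult_left)
  qed
  then have "mult_mod_matrix r (p y) (q y) $$ (k, j)
      = (\<Sum>i\<le>N. coeff (q y) i * coeff (monom 1 (j + i) mod p y) k)" for y
    using kj by (simp add: mult_mod_matrix_def coeff_sum)
  then show ?thesis
    by (auto intro!: polynomial_fun_intros q(2) polynomial_fun_coeff_monom_mod[OF p])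
qed

text \<open>The Leibniz expansion of the determinant is polynomial in the entries.\<close>

lemma polynomial_fun_char_poly:
  assumes A: "\<And>y. A y \<in> carrier_mat r r"
    and poly: "\<And>k j. k < r \<Longrightarrow> j < r \<Longrightarrow> polynomial_fun (\<lambda>y. A y $$ (k, j))"
    and z: "polynomial_fun z"
  shows "polynomial_fun (\<lambda>y. poly (char_poly (A y)) (z y))"
proof -
  have car: "- (char_matrix (A y) (z y)) \<in> carrier_mat r r" for y using A[of y] by simp
  have entry: "(- (char_matrix (A y) (z y))) $$ (k, j) = (if k = j then z y else 0) - A y $$ (k, j)"
    if "k < r" "j < r" for k j y
    using A[of y] that by (auto simp: char_matrix_def)
  have "poly (char_poly (A y)) (z y) =
      (\<Sum>\<pi> | \<pi> permutes {0..<r}. signof \<pi> * (\<Prod>k = 0..<r. (if k = \<pi> k then z y else 0) - A y $$ (k, \<pi> k)))" for y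
    unfolding char_poly_matrix[OF A] det_def'[OF car]
    by (intro sum.cong refl arg_cong2[of _ _ _ _ "(*)"] prod.cong entry)
      (auto simp: permutes_in_image)
  moreover have "polynomial_fun (\<lambda>y. (if k = \<pi> k then z y else 0) - A y $$ (k, \<pi> k))"
    if "\<pi> permutes {0..<r}" "k \<in> {0..<r}" for \<pi> k
  proof -
    have "\<pi> k < r" using that permutes_in_image[OF that(1), of k] by simp
    then show ?thesis using that z poly[of k "\<pi> k"] polynomial_fun_diff[OF polynomial_fun_const[of 0]]
      by (cases "k = \<pi> k") (auto intro!: polynomial_fun_intros)
  qed
  ultimately show ?thesis
    by (simp only:) (intro polynomial_fun_sum polynomial_fun_mult polynomial_fun_const polynomial_fun_prod; simp)
qed

section \<open>The multiplicity of a polynomial\<close>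

lemma polynomial_fun_compose:
  assumes "polynomial_fun P" "\<And>i. polynomial_fun (\<lambda>y. g y $ i)"
  shows "polynomial_fun (\<lambda>y. P (g y))"
  using assms(1)
  by (induction rule: polynomial_fun_induct) (auto intro!: polynomial_fun_intros assms(2))

text \<open>Group the monomials by degree. On a line through the origin \<open>F\<close> is a polynomial in one variable whose
  coefficients are the homogeneous parts, and the growth bound kills those of degree less than \<open>r\<close>;
  the part of degree \<open>r\<close> is \<open>1\<close> at \<open>e\<close>.\<close>

lemma has_multiplicity_polynomial:
  fixes F :: "complex ^ 'm \<Rightarrow> complex"
  assumes F: "polynomial_fun F" and K: "\<And>y. norm y \<le> 1 \<Longrightarrow> norm (F y) \<le> K * norm y ^ r"
    and e: "\<And>z. F (z *s e) = z ^ r"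
  shows "has_multiplicity F r"
proof -
  obtain A c where A: "finite A" "F = (\<lambda>x. \<Sum>a\<in>A. c a * (\<Prod>i\<in>UNIV. x $ i ^ a i))"
    using F unfolding polynomial_fun_def by blast
  define deg where "deg = (\<lambda>a::'m \<Rightarrow> nat. \<Sum>i\<in>UNIV. a i)"
  define N where "N = Suc (\<Sum>a\<in>A. deg a)"
  have N: "deg a < N" if "a \<in> A" for a
    unfolding N_def using member_le_sum[of a A deg] that A(1) by simp
  define Fh where "Fh = (\<lambda>k (x :: complex ^ 'm). \<Sum>a | a \<in> A \<and> deg a = k. c a * (\<Prod>i\<in>UNIV. x $ i ^ a i))"
  have hom: "homogeneous_poly k (Fh k)" for k
    unfolding homogeneous_poly_def
  proof (intro conjI allI)
    show "polynomial_fun (Fh k)" unfolding Fh_def by (intro polynomial_fun_intros)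
    fix s and y :: "complex ^ 'm"
    have "(\<Prod>i\<in>UNIV. (s *s y) $ i ^ a i) = s ^ deg a * (\<Prod>i\<in>UNIV. y $ i ^ a i)" for a
      by (simp add: power_mult_distrib prod.distrib power_sum deg_def)
    then show "Fh k (s *s y) = s ^ k * Fh k y"
      unfolding Fh_def sum_distrib_left by (intro sum.cong refl) (simp add: mult_ac)
  qed
  have Fh0: "Fh k y = 0" if "k \<ge> N" for k y
    unfolding Fh_def by (rule sum.neutral) (use N that in force)
  have F_sum: "F y = (\<Sum>k<N. Fh k y)" for y
    unfolding A(2) Fh_def by (rule sum.group[symmetric]) (use A(1) N in auto)
  define line where "line = (\<lambda>y. \<Sum>k<N. monom (Fh k y) k)"
  have line: "poly (line y) s = F (s *s y)" for y s
    using hom unfolding F_sum line_def homogeneous_poly_def by (simp add: poly_sum poly_monom mult.commute)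
  have coeff_line: "coeff (line y) k = Fh k y" for y k
    unfolding line_def using Fh0[of k y] by (auto simp: coeff_sum coeff_monom)
  have low: "Fh k y = 0" if "k < r" for k y
  proof (rule ccontr)
    assume "Fh k y \<noteq> 0"
    define m where "m = (LEAST k. Fh k y \<noteq> 0)"
    have m: "Fh m y \<noteq> 0" "m \<le> k"
      unfolding m_def by (rule LeastI, fact) (rule Least_le, fact)
    have m_least: "Fh j y = 0" if "j < m" for j
      using not_less_Least[OF that[unfolded m_def]] by simp
    have "monom 1 m dvd line y" unfolding monom_1_dvd_iff' using m_least by (simp add: coeff_line)
    then obtain u where u: "line y = monom 1 m * u" by (auto elim: dvdE)
    have "coeff (line y) m = coeff u 0" unfolding u by (simp add: coeff_monom_mult)
    then have u0: "poly u 0 = Fh m y" by (simp add: coeff_line poly_0_coeff_0)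
    define B where "B = K * norm y ^ r"
    have small: "norm (poly u s) \<le> B * norm s ^ (r - m)" if s: "s \<noteq> 0" "norm (s *s y) \<le> 1" for s
    proof -
      have "norm s ^ m * norm (poly u s) = norm (F (s *s y))"
        unfolding line[symmetric] u by (simp add: poly_monom norm_mult norm_power)
      also have "\<dots> \<le> K * norm (s *s y) ^ r" by (rule K[OF s(2)])
      also have "\<dots> = B * norm s ^ r" by (simp add: B_def norm_vector_scalar_mult power_mult_distrib)
      also have "norm s ^ r = norm s ^ m * norm s ^ (r - m)"
        using m(2) \<open>k < r\<close> by (simp flip: power_add)
      finally have "norm s ^ m * norm (poly u s) \<le> norm s ^ m * (B * norm s ^ (r - m))" by (simp add: mult_ac)
      then show ?thesis using s(1) by simp
    qed
    have "((\<lambda>s. norm (s *s y)) \<longlongrightarrow> 0) (at (0::complex))"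
      using tendsto_vector_scalar_mult_0 by (rule tendsto_norm_zero)
    then have "\<forall>\<^sub>F s in at (0::complex). norm (s *s y) < 1" by (rule order_tendstoD) simp
    moreover have "\<forall>\<^sub>F s in at (0::complex). s \<noteq> 0" by (simp add: eventually_at_filter)
    ultimately have "\<forall>\<^sub>F s in at 0. norm (poly u s) \<le> B * norm s ^ (r - m)"
      by eventually_elim (use small in simp)
    moreover have "((\<lambda>s::complex. B * norm s ^ (r - m)) \<longlongrightarrow> 0) (at 0)"
    proof -
      have "B * norm (0::complex) ^ (r - m) = 0" using m(2) that by simp
      moreover have "((\<lambda>s::complex. B * norm s ^ (r - m)) \<longlongrightarrow> B * norm (0::complex) ^ (r - m)) (at 0)"
        by (intro tendsto_intros)
      ultimately show ?thesis by metis
    qed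
    ultimately have "(poly u \<longlongrightarrow> 0) (at 0)" by (rule Lim_null_comparison)
    moreover have "(poly u \<longlongrightarrow> poly u 0) (at 0)" 
      using poly_isCont[of 0 u] by (simp add: isCont_def)
    ultimately have "poly u 0 = 0" using tendsto_unique trivial_limit_at by blast
    then show False using u0 m(1) by simp
  qed
  have "line e = monom 1 r"
    by (intro poly_eq_poly_eq_iff[THEN iffD1] ext) (simp add: line e poly_monom)
  then have "Fh r e = 1" using coeff_line[of e r] by simp
  then have "Fh r \<noteq> (\<lambda>_. 0)" by auto
  moreover have "(\<lambda>k. Fh k y) sums F y" for y
    unfolding F_sum by (rule sums_finite) (use Fh0 in auto)
  ultimately show ?thesis unfolding has_multiplicity_def
    using hom low by (intro exI[of _ Fh]) auto
qed

section \<open>Roots of monic polynomials\<close>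

lemma monic_poly_roots:
  fixes C :: "complex poly"
  assumes "lead_coeff C = 1"
  obtains root where "\<And>w. poly C w = (\<Prod>i<degree C. w - root i)" "\<And>i. i < degree C \<Longrightarrow> poly C (root i) = 0"
proof -
  obtain root where "Polynomial.smult (lead_coeff C) (\<Prod>i<degree C. [:-root i, 1:]) = C"
    using complex_poly_decompose' by blast
  then have "C = (\<Prod>i<degree C. [:-root i, 1:])" using assms by simp
  then have *: "poly C w = (\<Prod>i<degree C. w - root i)" for w
  proof -
    have "poly C w = poly (\<Prod>i<degree C. [:-root i, 1:]) w" by (rule arg_cong) fact
    then show ?thesis by (simp add: poly_prod)
  qed
  then have "poly C (root i) = 0" if "i < degree C" for i
    using that by (auto intro!: prod_zero)
  with * show ?thesis by (rule that)
qed

lemma monic_poly_norm_le: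
  fixes C :: "complex poly"
  assumes "lead_coeff C = 1" "\<And>z. poly C z = 0 \<Longrightarrow> norm z \<le> B"
  shows "norm (poly C w) \<le> (norm w + B) ^ degree C"
proof -
  obtain root where root: "\<And>w. poly C w = (\<Prod>i<degree C. w - root i)"
    "\<And>i. i < degree C \<Longrightarrow> poly C (root i) = 0" by (rule monic_poly_roots[OF assms(1)]) blast
  have "norm (poly C w) = (\<Prod>i<degree C. norm (w - root i))" unfolding root(1) by (simp add: prod_norm)
  also have "\<dots> \<le> (\<Prod>i<degree C. norm w + B)"
    by (intro prod_mono conjI norm_ge_zero order_trans[OF norm_triangle_ineq4] add_left_mono)
      (use root(2) assms(2) in auto)
  finally show ?thesis by simp
qed

text \<open>The value at \<open>w\<close> is the product of the differences of \<open>w\<close> and the roots. This is the form of continuity of roots used below.\<close>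

lemma monic_poly_root_near:
  fixes C :: "complex poly"
  assumes "lead_coeff C = 1" "norm (poly C w) < \<eta> ^ degree C" "\<eta> > 0"
  shows "\<exists>z. poly C z = 0 \<and> norm (z - w) < \<eta>"
proof (rule ccontr)
  assume *: "\<not> ?thesis"
  obtain root where root: "\<And>w. poly C w = (\<Prod>i<degree C. w - root i)"
    "\<And>i. i < degree C \<Longrightarrow> poly C (root i) = 0" by (rule monic_poly_roots[OF assms(1)]) blast
  have "\<eta> ^ degree C = (\<Prod>i<degree C. \<eta>)" by simp
  also have "\<dots> \<le> (\<Prod>i<degree C. norm (w - root i))"
  proof (intro prod_mono conjI)
    fix i assume "i \<in> {..<degree C}"
    then have "\<not> norm (root i - w) < \<eta>" using * root(2) by auto
    then show "\<eta> \<le> norm (w - root i)" by (simp add: norm_minus_commute)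
  qed (use assms(3) in simp)
  also have "\<dots> = norm (poly C w)" unfolding root(1) by (simp add: prod_norm)
  finally show False using assms(2) by simp
qed

lemma finite_set_separated:
  fixes T :: "'a::metric_space set"
  assumes "finite T"
  shows "\<exists>\<eta>>0. \<forall>u\<in>T. \<forall>v\<in>T. u \<noteq> v \<longrightarrow> 2 * \<eta> \<le> dist u v"
proof -
  have "\<forall>u. \<exists>d>0. \<forall>v\<in>T. v \<noteq> u \<longrightarrow> d \<le> dist u v"
    using finite_set_avoid[OF assms] by blast
  then obtain d where d: "\<And>u. d u > 0" "\<And>u v. v \<in> T \<Longrightarrow> v \<noteq> u \<Longrightarrow> d u \<le> dist u v" by metis
  define \<eta> where "\<eta> = Min (insert 1 (d ` T)) / 2"
  have "\<eta> > 0" unfolding \<eta>_def using assms d(1) by (auto simp: Min_gr_iff)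
  moreover have "2 * \<eta> \<le> dist u v" if "u \<in> T" "v \<in> T" "u \<noteq> v" for u v
  proof -
    have "Min (insert 1 (d ` T)) \<le> d u" using assms that by (intro Min_le) auto
    also have "\<dots> \<le> dist u v" using d(2) that by auto
    finally show ?thesis by (simp add: \<eta>_def)
  qed
  ultimately show ?thesis by blast
qed

text \<open>A set whose points have distance at least \<open>2 \<eta>\<close> injects into any set that has a point within \<open>\<eta>\<close>
  of each of them. It serves to count roots that persist under perturbation.\<close>

lemma card_le_if_separated:
  fixes A B :: "'a::metric_space set"
  assumes "finite B" "\<And>u. u \<in> A \<Longrightarrow> \<exists>u'\<in>B. dist u' u < \<eta>"
    "\<And>u v. u \<in> A \<Longrightarrow> v \<in> A \<Longrightarrow> u \<noteq> v \<Longrightarrow> 2 * \<eta> \<le> dist u v"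
  shows "card A \<le> card B"
proof -
  obtain g where g: "\<And>u. u \<in> A \<Longrightarrow> g u \<in> B \<and> dist (g u) u < \<eta>" using assms(2) by metis
  have "inj_on g A"
  proof (rule inj_onI, rule ccontr)
    fix u v assume *: "u \<in> A" "v \<in> A" "g u = g v" "u \<noteq> v"
    have "dist u v \<le> dist (g u) u + dist (g v) v" using *(3) by (metis dist_commute dist_triangle)
    then show False using g[of u] g[of v] assms(3)[of u v] * by fastforce
  qed
  then show ?thesis using g assms(1) by (intro card_inj_on_le[of g]) auto
qed

text \<open>The exceptional shifts are the critical values.\<close>

lemma poly_shift_has_simple_roots:
  fixes p :: "complex poly"
  assumes "degree p > 0"
  shows "finite {s. card {t. poly (p - [:s:]) t = 0} \<noteq> degree p}"
proof -
  let ?D = "{t. poly (pderiv p) t = 0}"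
  have "pderiv p \<noteq> 0" using assms by (simp add: pderiv_eq_0_iff)
  then have fin: "finite (poly p ` ?D)" by (intro finite_imageI poly_roots_finite)
  have "card {t. poly (p - [:s:]) t = 0} = degree p" if s: "s \<notin> poly p ` ?D" for s
  proof -
    let ?q = "p - [:s:]"
    have deg: "degree ?q = degree p" 
    proof -
      have "?q = p + [:-s:]" by simp
      then show ?thesis using assms degree_add_eq_left[of "[:-s:]" p] by (simp only: degree_pCons_0)
    qed
    then have q0: "?q \<noteq> 0" using assms by auto
    have dq: "pderiv ?q = pderiv p" by (simp add: pderiv_diff pderiv_pCons)
    have "rsquarefree ?q" unfolding rsquarefree_roots dq
    proof (intro allI notI)
      fix t assume "poly ?q t = 0 \<and> poly (pderiv p) t = 0"
      then show False using s by (auto simp: image_iff)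
    qed
    then have "?q = Polynomial.smult (lead_coeff ?q) (\<Prod>z | poly ?q z = 0. [:-z, 1:])"
      using complex_poly_decompose_rsquarefree by metis
    then have "degree ?q = degree (\<Prod>z | poly ?q z = 0. [:-z, 1:])"
      using q0 by (metis degree_smult_eq leading_coeff_0_iff)
    also have "\<dots> = (\<Sum>z | poly ?q z = 0. degree [:-z, 1:])" by (rule degree_prod_eq_sum_degree) simp
    finally show ?thesis using deg by simp
  qed
  then show ?thesis by (intro finite_subset[OF _ fin]) blast
qed

section \<open>Operations on holomorphic functions and change of one coordinate\<close>

lemma holo_on_mult:
  assumes "holo_on F U" "holo_on G U"
  shows "holo_on (\<lambda>y. F y * G y) U"
  unfolding holo_on_def
proof
  fix x assume "x \<in> U"
  then obtain D E where "(F has_derivative D) (at x)" "\<forall>c v. D (c *s v) = c * D v"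
    "(G has_derivative E) (at x)" "\<forall>c v. E (c *s v) = c * E v"
    using assms unfolding holo_on_def by metis
  then show "\<exists>D. ((\<lambda>y. F y * G y) has_derivative D) (at x) \<and> (\<forall>c v. D (c *s v) = c * D v)"
    by (intro exI[of _ "\<lambda>v. F x * E v + D v * G x"])
      (auto intro!: derivative_eq_intros simp: algebra_simps)
qed

lemma holo_on_inverse:
  assumes "holo_on F U" "\<And>x. x \<in> U \<Longrightarrow> F x \<noteq> 0"
  shows "holo_on (\<lambda>y. inverse (F y)) U"
  unfolding holo_on_def
proof
  fix x assume x: "x \<in> U"
  then obtain D where "(F has_derivative D) (at x)" "\<forall>c v. D (c *s v) = c * D v"
    using assms(1) unfolding holo_on_def by metis
  then show "\<exists>D. ((\<lambda>y. inverse (F y)) has_derivative D) (at x) \<and> (\<forall>c v. D (c *s v) = c * D v)"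
    using assms(2)[OF x]
    by (intro exI[of _ "\<lambda>v. - (inverse (F x) * D v * inverse (F x))"])
      (auto intro!: derivative_eq_intros simp: algebra_simps)
qed

lemma holo_on_continuous_on: "holo_on F U \<Longrightarrow> continuous_on U F"
  unfolding holo_on_def
  by (meson continuous_at_imp_continuous_on has_derivative_continuous)

lemma bounded_linear_axis: "bounded_linear (axis k :: complex \<Rightarrow> complex ^ 'n)"
proof -
  have "linear (axis k :: complex \<Rightarrow> complex ^ 'n)"
    by (rule linearI) (auto simp: Finite_Cartesian_Product.vec_eq_iff axis_def)
  then show ?thesis by (rule linear_conv_bounded_linear[THEN iffD1])
qed

definition upd :: "'m \<Rightarrow> complex ^ 'm \<Rightarrow> complex \<Rightarrow> complex ^ 'm" where
  "upd k y z = (\<chi> j. if j = k then z else y $ j)"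

lemma upd_nth: "upd k y z $ j = (if j = k then z else y $ j)"
  by (simp add: upd_def)

lemma upd_eq: "upd k y z = y + axis k (z - y $ k)"
  by (auto simp: Finite_Cartesian_Product.vec_eq_iff upd_nth axis_def)

lemma upd_self: "upd k y (y $ k) = y"
  by (simp add: Finite_Cartesian_Product.vec_eq_iff upd_nth)

lemma norm_axis_complex: "norm (axis k (z::complex)) = norm z"
proof -
  have "axis k z = z *s axis k 1" by (auto simp: Finite_Cartesian_Product.vec_eq_iff axis_def)
  then show ?thesis by (simp add: norm_vector_scalar_mult norm_axis_1)
qed

lemma norm_upd_le: "norm (upd k y z) \<le> 2 * norm y + norm z"
proof -
  have "norm (upd k y z) \<le> norm y + norm (z - y $ k)"
    unfolding upd_eq using norm_triangle_ineq[of y "axis k (z - y $ k)"] by (simp add: norm_axis_complex)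
  also have "norm (z - y $ k) \<le> norm z + norm y"
    by (rule order_trans[OF norm_triangle_ineq4]) (simp add: Finite_Cartesian_Product.norm_nth_le)
  finally show ?thesis by simp
qed

lemma continuous_on_upd [continuous_intros]:
  assumes "continuous_on S g" "continuous_on S h"
  shows "continuous_on S (\<lambda>x. upd k (g x) (h x))"
  unfolding upd_eq
  by (intro continuous_intros assms bounded_linear.continuous_on[OF bounded_linear_axis])

lemma holo_on_compose_upd:
  assumes "holo_on G V" "\<And>y. y \<in> U \<Longrightarrow> upd k y z \<in> V"
  shows "holo_on (\<lambda>y. G (upd k y z)) U"
  unfolding holo_on_def
proof
  fix x assume x: "x \<in> U"
  obtain D where D: "(G has_derivative D) (at (upd k x z))" "\<And>c v. D (c *s v) = c * D v"
    using assms(1) assms(2)[OF x] unfolding holo_on_def by blast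
  have "((\<lambda>y. upd k y z) has_derivative (\<lambda>v. v + axis k (0 - v $ k))) (at x)"
    unfolding upd_eq
    by (intro derivative_intros bounded_linear.has_derivative[OF bounded_linear_axis]
        bounded_linear_imp_has_derivative[OF bounded_linear_vec_nth])
  then have "((\<lambda>y. G (upd k y z)) has_derivative (\<lambda>v. D (v + axis k (0 - v $ k)))) (at x)"
    using diff_chain_at[of "\<lambda>y. upd k y z" _ x G D] D(1) by (simp add: o_def)
  moreover have "D (c *s v + axis k (0 - (c *s v) $ k)) = c * D (v + axis k (0 - v $ k))" for c v
  proof -
    have "c *s v + axis k (0 - (c *s v) $ k) = c *s (v + axis k (0 - v $ k))"
      by (auto simp: Finite_Cartesian_Product.vec_eq_iff axis_def algebra_simps)
    then show ?thesis by (simp only: D(2))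
  qed
  ultimately show "\<exists>D. ((\<lambda>y. G (upd k y z)) has_derivative D) (at x) \<and> (\<forall>c v. D (c *s v) = c * D v)"
    by blast
qed

section \<open>The equation of the image\<close>

text \<open>The component with index \<open>jp\<close> is \<open>c\<close> times a Weierstrass polynomial of degree \<open>r\<close> in the last
  coordinate \<open>x\<^sub>l\<close>, and the restriction of the component with index \<open>jq\<close> to the axis has order at least
  \<open>r\<close>. Leaving open which of the two indices \<open>Some l\<close> and \<open>None\<close> plays which role treats both
  cases of the theorem at once.\<close>

locale weierstrass_map =
  fixes f :: "complex ^ 'n \<Rightarrow> complex ^ 'n option"
    and l :: 'n and jp jq :: "'n option"
    and r N :: nat and c :: complex
    and a b :: "nat \<Rightarrow> complex ^ 'n \<Rightarrow> complex"
  assumes jpq: "{jp, jq} = {Some l, None}" "jp \<noteq> jq"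
    and f_Some: "\<And>i x. i \<noteq> l \<Longrightarrow> f x $ Some i = x $ i"
    and f_jp: "\<And>x. f x $ jp = (\<Sum>j<r. a j x * x $ l ^ j) + c * x $ l ^ r"
    and f_jq: "\<And>x. f x $ jq = (\<Sum>j\<le>N. b j x * x $ l ^ j)"
    and c: "c \<noteq> 0" and r: "r > 0"
    and a_poly: "\<And>j. polynomial_fun (a j)" and b_poly: "\<And>j. polynomial_fun (b j)"
    and a_indep: "\<And>j x x'. (\<And>i. i \<noteq> l \<Longrightarrow> x $ i = x' $ i) \<Longrightarrow> a j x = a j x'"
    and b_indep: "\<And>j x x'. (\<And>i. i \<noteq> l \<Longrightarrow> x $ i = x' $ i) \<Longrightarrow> b j x = b j x'"
    and a0: "\<And>j. j < r \<Longrightarrow> a j 0 = 0" and b0: "\<And>j. j < r \<Longrightarrow> b j 0 = 0"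
begin

definition base :: "complex ^ 'n option \<Rightarrow> complex ^ 'n" where
  "base y = (\<chi> i. y $ Some i)"

text \<open>The point of the source over the coordinates \<open>x\<^sub>i\<close>, \<open>i \<noteq> l\<close>, of \<open>y\<close> whose last coordinate is \<open>t\<close>.\<close>

definition pt :: "complex ^ 'n option \<Rightarrow> complex \<Rightarrow> complex ^ 'n" where
  "pt y t = upd l (base y) t"

text \<open>As a polynomial in \<open>t\<close>, the equation \<open>f (x', t)\<^sub>j = y\<^sub>j\<close> for \<open>j = jp\<close>, divided by \<open>c\<close> to make it monic.\<close>

definition p :: "complex ^ 'n option \<Rightarrow> complex poly" where
  "p y = monom 1 r + (\<Sum>j<r. monom (a j (base y) / c) j) - [:y $ jp / c:]"

definition q :: "complex ^ 'n option \<Rightarrow> complex poly" where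
  "q y = (\<Sum>j\<le>N. monom (b j (base y)) j)"

text \<open>Its roots are the values of the component \<open>jq\<close> on the fibre cut out by \<open>p y\<close>. It does not depend on
  the coordinate \<open>jq\<close> of \<open>y\<close>.\<close>

definition Ch :: "complex ^ 'n option \<Rightarrow> complex poly" where
  "Ch y = char_poly (mult_mod_matrix r (p y) (q y))"

definition F :: "complex ^ 'n option \<Rightarrow> complex" where
  "F y = poly (Ch y) (y $ jq)"

lemma all_index: "(\<forall>j. R j) \<longleftrightarrow> R jp \<and> R jq \<and> (\<forall>i. i \<noteq> l \<longrightarrow> R (Some i))"
  using jpq by (metis doubleton_eq_iff not_Some_eq)

lemma Some_ne: "i \<noteq> l \<Longrightarrow> Some i \<noteq> jp \<and> Some i \<noteq> jq"
  using jpq by (metis doubleton_eq_iff option.distinct(1) option.inject)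

lemma pt_nth: "pt y t $ i = (if i = l then t else y $ Some i)"
  by (simp add: pt_def base_def upd_nth)

lemma a_pt: "a j (pt y t) = a j (base y)" and b_pt: "b j (pt y t) = b j (base y)"
  by (auto intro!: a_indep b_indep simp: pt_nth base_def)

lemma poly_p: "poly (p y) t = (f (pt y t) $ jp - y $ jp) / c"
  using c unfolding p_def f_jp
  by (simp add: poly_sum poly_monom a_pt pt_nth diff_divide_distrib add_divide_distrib sum_divide_distrib)

lemma poly_q: "poly (q y) t = f (pt y t) $ jq"
  unfolding q_def f_jq by (simp add: poly_sum poly_monom b_pt pt_nth)

lemma coeff_p: "coeff (p y) k = (if k = r then 1 else if k < r then a k (base y) / c else 0)
    - (if k = 0 then y $ jp / c else 0)"
  using r unfolding p_def by (auto simp: coeff_sum coeff_monom coeff_pCons split: nat.split)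

lemma degree_p: "degree (p y) = r" and lead_p: "lead_coeff (p y) = 1"
proof -
  show "degree (p y) = r"
    by (rule antisym[OF degree_le le_degree]) (use r in \<open>auto simp: coeff_p\<close>)
  then show "lead_coeff (p y) = 1" using r by (simp add: coeff_p)
qed

lemma base_poly: "polynomial_fun (\<lambda>y. base y $ i)"
  by (simp add: base_def polynomial_fun_coord)

lemma a_base_poly: "polynomial_fun (\<lambda>y. a j (base y))" and b_base_poly: "polynomial_fun (\<lambda>y. b j (base y))"
  by (auto intro!: polynomial_fun_compose a_poly b_poly base_poly)

lemma coeff_p_poly: "polynomial_fun (\<lambda>y. coeff (p y) k)"
proof -
  have div: "polynomial_fun (\<lambda>y. P y / c)" if "polynomial_fun P" for P :: "complex ^ 'n option \<Rightarrow> complex"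
    using polynomial_fun_mult[OF that polynomial_fun_const[of "inverse c"]] by (simp add: divide_inverse)
  show ?thesis unfolding coeff_p
    by (cases "k = r"; cases "k < r"; cases "k = 0")
      (auto intro!: polynomial_fun_intros div a_base_poly intro: polynomial_fun_diff)
qed

lemma degree_q: "degree (q y) \<le> N"
  unfolding q_def by (intro degree_sum_le order_trans[OF degree_monom_le]) auto

lemma coeff_q_poly: "polynomial_fun (\<lambda>y. coeff (q y) k)"
proof -
  have "polynomial_fun (\<lambda>y. if j = k then b j (base y) else 0)" for j
    by (cases "j = k") (auto intro: b_base_poly polynomial_fun_const)
  then show ?thesis unfolding q_def coeff_sum coeff_monom by (intro polynomial_fun_sum)
qed

lemma F_poly: "polynomial_fun F"
  unfolding F_def[abs_def] Ch_def
  by (intro polynomial_fun_char_poly[where r = r] mult_mod_matrix_carrier polynomial_fun_coord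
      polynomial_fun_mult_mod_matrix[OF degree_p lead_p r coeff_p_poly degree_q coeff_q_poly])

lemma Ch_root: "poly (Ch y) z = 0 \<longleftrightarrow> (\<exists>t. poly (p y) t = 0 \<and> poly (q y) t = z)"
  unfolding Ch_def eigenvalue_root_char_poly[OF mult_mod_matrix_carrier, symmetric]
  by (rule eigenvalue_mult_mod_matrix[OF degree_p r])

lemma degree_Ch: "degree (Ch y) = r" and lead_Ch: "lead_coeff (Ch y) = 1"
  using degree_monic_char_poly[OF mult_mod_matrix_carrier, of r "p y" "q y"] by (auto simp: Ch_def)

lemma f_pt_eq: "f (pt y t) = y \<longleftrightarrow> poly (p y) t = 0 \<and> poly (q y) t = y $ jq"
  unfolding Finite_Cartesian_Product.vec_eq_iff all_index poly_p poly_q using c by (auto simp: f_Some pt_nth)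

lemma pt_f: "pt (f x) (x $ l) = x"
  by (simp add: Finite_Cartesian_Product.vec_eq_iff pt_nth f_Some)

lemma F_eq_0: "F y = 0 \<longleftrightarrow> y \<in> range f"
proof -
  have "F y = 0 \<longleftrightarrow> (\<exists>t. f (pt y t) = y)" unfolding F_def Ch_root f_pt_eq ..
  also have "\<dots> \<longleftrightarrow> y \<in> range f" by (metis pt_f rangeE rangeI)
  finally show ?thesis .
qed

lemma Ch_upd: "Ch (upd jq y z) = Ch y"
proof -
  have "a j (base (upd jq y z)) = a j (base y)" "b j (base (upd jq y z)) = b j (base y)" for j
    using Some_ne by (auto intro!: a_indep b_indep simp: base_def upd_nth)
  then have "p (upd jq y z) = p y" "q (upd jq y z) = q y"
    unfolding p_def q_def using jpq(2) by (simp_all add: upd_nth)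
  then show ?thesis by (simp add: Ch_def)
qed

lemma F_upd: "F (upd jq y z) = poly (Ch y) z"
  by (simp add: F_def Ch_upd upd_nth)

lemma norm_base_le: "norm (base y) \<le> CARD('n) * norm y"
proof -
  have "norm (base y) \<le> (\<Sum>i\<in>UNIV. norm (base y $ i))"
    unfolding norm_vec_def by (rule L2_set_le_sum) auto
  also have "\<dots> \<le> (\<Sum>i\<in>(UNIV::'n set). norm y)"
    by (intro sum_mono) (simp add: base_def Finite_Cartesian_Product.norm_nth_le)
  finally show ?thesis by simp
qed

lemma norm_pt_le: "norm (pt y t) \<le> 2 * CARD('n) * norm y + norm t"
  unfolding pt_def using norm_upd_le[of l "base y" t] norm_base_le[of y] by simp

text \<open>The equation \<open>p y\<close> bounds \<open>|t|\<^sup>r\<close> by \<open>O(|y|) (1 + \<dots> + |t|\<^sup>r\<^sup>-\<^sup>1)\<close>, because the lower coefficients vanish at the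
  origin. This bounds \<open>t\<close> first, and then \<open>t\<^sup>r\<close> by a multiple of \<open>|y|\<close>. In the component \<open>jq\<close>, terms
  with exponent less than \<open>r\<close> have small coefficients and the others contain \<open>t\<^sup>r\<close>, so it is \<open>O(|y|)\<close>
  as well.\<close>

lemma root_bounds:
  obtains K where "K \<ge> 0" "\<And>y t. norm y \<le> 1 \<Longrightarrow> poly (p y) t = 0 \<Longrightarrow> norm t ^ r \<le> K * norm y"
    "\<And>y t. norm y \<le> 1 \<Longrightarrow> poly (p y) t = 0 \<Longrightarrow> norm (poly (q y) t) \<le> K * norm y"
proof -
  have base0: "base 0 = 0" by (simp add: base_def Finite_Cartesian_Product.vec_eq_iff)
  have "\<forall>j. \<exists>A\<ge>0. \<forall>y. norm y \<le> 1 \<longrightarrow> norm (a j (base y) - a j (base 0)) \<le> A * norm y"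
    using polynomial_fun_lipschitz_at_0[OF a_base_poly] by blast
  then obtain A where A: "\<And>j. A j \<ge> 0"
    "\<And>j y. norm y \<le> 1 \<Longrightarrow> norm (a j (base y) - a j 0) \<le> A j * norm y" by (metis base0)
  have "\<forall>j. \<exists>A\<ge>0. \<forall>y. norm y \<le> 1 \<longrightarrow> norm (b j (base y) - b j (base 0)) \<le> A * norm y"
    using polynomial_fun_lipschitz_at_0[OF b_base_poly] by blast
  then obtain B where B: "\<And>j. B j \<ge> 0"
    "\<And>j y. norm y \<le> 1 \<Longrightarrow> norm (b j (base y) - b j 0) \<le> B j * norm y" by (metis base0)
  have A': "norm (a j (base y)) \<le> A j * norm y" if "norm y \<le> 1" "j < r" for j y
    using A(2)[OF that(1), of j] a0[OF that(2)] by simp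
  \<comment> \<open>\<open>S\<close> bounds the coefficients of the equation for \<open>t\<^sup>r\<close>, relative to \<open>|y|\<close>.\<close>
  define S where "S = (1 + (\<Sum>j<r. A j)) / norm c"
  define T where "T = max 1 S"
  have S0: "S \<ge> 0" using A(1) by (simp add: S_def sum_nonneg)
  have T1: "T \<ge> 1" by (simp add: T_def)
  define K1 where "K1 = S * T ^ r"
  have K10: "K1 \<ge> 0" using S0 T1 by (simp add: K1_def)
  have eq: "norm t ^ r \<le> S * norm y * M ^ (r - 1)"
    if y: "norm y \<le> 1" and t: "poly (p y) t = 0" and M: "norm t \<le> M" "1 \<le> M" for y t M
  proof -
    have pow: "norm t ^ j \<le> M ^ (r - 1)" if "j < r" for j
    proof -
      have "norm t ^ j \<le> M ^ j" using M by (intro power_mono) auto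
      also have "\<dots> \<le> M ^ (r - 1)" using M that by (intro power_increasing) auto
      finally show ?thesis .
    qed
    have "(f (pt y t) $ jp - y $ jp) / c = 0" using t poly_p by simp
    then have "(\<Sum>j<r. a j (base y) * t ^ j) + c * t ^ r = y $ jp"
      using c by (simp add: f_jp a_pt pt_nth)
    then have "c * t ^ r = y $ jp - (\<Sum>j<r. a j (base y) * t ^ j)" by (simp add: algebra_simps)
    then have "norm (c * t ^ r) \<le> norm (y $ jp) + norm (\<Sum>j<r. a j (base y) * t ^ j)"
      by (simp add: norm_triangle_ineq4)
    also have "norm (\<Sum>j<r. a j (base y) * t ^ j) \<le> (\<Sum>j<r. A j * norm y * M ^ (r - 1))"
      by (rule order_trans[OF norm_sum], intro sum_mono, unfold norm_mult norm_power,
          intro mult_mono A' y pow) (use A(1) in auto)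
    also have "norm (y $ jp) \<le> norm y * M ^ (r - 1)"
      using M by (intro order_trans[OF Finite_Cartesian_Product.norm_nth_le]) (simp add: mult_left_le one_le_power mult_le_cancel_left1)
    finally have "norm c * norm t ^ r \<le> norm y * M ^ (r - 1) + (\<Sum>j<r. A j * norm y * M ^ (r - 1))"
      by (simp add: norm_mult norm_power)
    also have "\<dots> = norm c * (S * norm y * M ^ (r - 1))"
      using c by (simp add: S_def sum_distrib_right sum_distrib_left field_simps)
    finally show ?thesis using c by (simp del: mult.assoc)
  qed
  \<comment> \<open>For \<open>|t| > 1\<close>, take \<open>M = |t|\<close> and cancel its power.\<close>
  have tT: "norm t \<le> T" if y: "norm y \<le> 1" and t: "poly (p y) t = 0" for y t
  proof (cases "norm t \<le> 1")
    case False
    then have "norm t ^ r \<le> S * norm y * norm t ^ (r - 1)" using eq[OF y t, of "norm t"] by simp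
    moreover have "norm t ^ r = norm t * norm t ^ (r - 1)" using r by (simp add: power_eq_if)
    moreover have "norm t ^ (r - 1) > 0" using False by (intro zero_less_power) linarith
    ultimately have "norm t \<le> S * norm y" by simp
    also have "\<dots> \<le> S" using S0 y by (simp add: mult_left_le)
    finally show ?thesis by (simp add: T_def)
  qed (use T1 in linarith)
  have t_r: "norm t ^ r \<le> K1 * norm y" if y: "norm y \<le> 1" and t: "poly (p y) t = 0" for y t
  proof -
    have "norm t ^ r \<le> S * norm y * T ^ (r - 1)" by (rule eq[OF y t tT[OF y t] T1])
    also have "\<dots> \<le> S * norm y * T ^ r" using S0 T1 by (intro mult_left_mono power_increasing) auto
    finally show ?thesis by (simp add: K1_def mult_ac)
  qed
  define L where "L = (\<lambda>j. B j * T ^ N + norm (b j 0) * (K1 * T ^ N))"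
  have L0: "L j \<ge> 0" for j using B(1) T1 K10 by (simp add: L_def)
  define K where "K = K1 + (\<Sum>j\<le>N. L j)"
  have q_le: "norm (poly (q y) t) \<le> K * norm y" if y: "norm y \<le> 1" and t: "poly (p y) t = 0" for y t
  proof -
    have "norm (b j (base y) * t ^ j) \<le> L j * norm y" if j: "j \<le> N" for j
    proof -
      have tj: "norm t ^ k \<le> T ^ N" if "k \<le> N" for k
        using power_mono[OF tT[OF y t] norm_ge_zero] power_increasing[OF that T1] by (rule order_trans)
      have "norm (b j 0) * norm t ^ j \<le> norm (b j 0) * (K1 * T ^ N) * norm y"
      proof (cases "j < r")
        case False
        then have "norm t ^ j = norm t ^ r * norm t ^ (j - r)" by (simp flip: power_add)
        also have "\<dots> \<le> (K1 * norm y) * T ^ N"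
          using K10 j by (intro mult_mono t_r[OF y t] tj) auto
        finally have "norm t ^ j \<le> (K1 * norm y) * T ^ N" .
        then have "norm (b j 0) * norm t ^ j \<le> norm (b j 0) * ((K1 * norm y) * T ^ N)"
          by (rule mult_left_mono) simp
        then show ?thesis by (simp add: mult_ac)
      qed (simp add: b0)
      moreover have "norm (b j (base y) - b j 0) * norm t ^ j \<le> (B j * norm y) * T ^ N"
        by (intro mult_mono B(2)[OF y] tj j) (use B(1) in auto)
      moreover have "norm (b j (base y) * t ^ j) \<le> norm (b j (base y) - b j 0) * norm t ^ j + norm (b j 0) * norm t ^ j"
      proof -
        have "norm (b j (base y)) \<le> norm (b j (base y) - b j 0) + norm (b j 0)"
          using norm_triangle_ineq[of "b j (base y) - b j 0" "b j 0"] by simp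
        then have "norm (b j (base y)) * norm t ^ j \<le> (norm (b j (base y) - b j 0) + norm (b j 0)) * norm t ^ j"
          by (rule mult_right_mono) simp
        then show ?thesis by (simp add: norm_mult norm_power distrib_right)
      qed
      ultimately show ?thesis by (simp add: L_def algebra_simps)
    qed
    then have "norm (poly (q y) t) \<le> (\<Sum>j\<le>N. L j * norm y)"
      unfolding poly_q f_jq b_pt pt_nth by (intro order_trans[OF norm_sum] sum_mono) auto
    also have "\<dots> \<le> K * norm y" using K10 by (simp add: K_def distrib_right sum_distrib_right)
    finally show ?thesis .
  qed
  have K0: "K \<ge> 0" using K10 L0 by (simp add: K_def sum_nonneg)
  have "K1 \<le> K" using L0 by (simp add: K_def sum_nonneg)
  then have "norm t ^ r \<le> K * norm y" if "norm y \<le> 1" "poly (p y) t = 0" for y t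
    using order_trans[OF t_r[OF that] mult_right_mono] by auto
  then show ?thesis using K0 q_le by (intro that[of K]) auto
qed

text \<open>\<open>F\<close> is a product of \<open>r\<close> factors, each the difference of two numbers of size \<open>O(|y|)\<close>.\<close>

lemma norm_F_le: "\<exists>K. \<forall>y. norm y \<le> 1 \<longrightarrow> norm (F y) \<le> K * norm y ^ r"
proof -
  obtain K where K: "K \<ge> 0"
    "\<And>y t. norm y \<le> 1 \<Longrightarrow> poly (p y) t = 0 \<Longrightarrow> norm (poly (q y) t) \<le> K * norm y"
    by (rule root_bounds) blast
  have "norm (F y) \<le> (1 + K) ^ r * norm y ^ r" if y: "norm y \<le> 1" for y
  proof -
    have "norm (F y) \<le> (norm (y $ jq) + K * norm y) ^ r"
      unfolding F_def using monic_poly_norm_le[OF lead_Ch, of y "K * norm y"] K(2)[OF y]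
      by (auto simp: degree_Ch Ch_root)
    also have "\<dots> \<le> (norm y + K * norm y) ^ r"
      using K(1) by (intro power_mono add_right_mono Finite_Cartesian_Product.norm_nth_le) auto
    also have "\<dots> = (1 + K) ^ r * norm y ^ r" by (simp add: distrib_right flip: power_mult_distrib)
    finally show ?thesis .
  qed
  then show ?thesis by blast
qed

lemma F_axis: "F (z *s axis jq 1) = z ^ r"
proof -
  let ?y = "z *s axis jq (1::complex)"
  obtain K where K: "\<And>y t. norm y \<le> 1 \<Longrightarrow> poly (p y) t = 0 \<Longrightarrow> norm (poly (q y) t) \<le> K * norm y"
    by (rule root_bounds) blast
  have "?y = upd jq 0 z" by (auto simp: Finite_Cartesian_Product.vec_eq_iff upd_nth axis_def)
  then have Ch: "Ch ?y = Ch 0" by (simp add: Ch_upd)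
  have "w = 0" if "poly (Ch 0) w = 0" for w
    using that K[of 0] by (auto simp: Ch_root)
  moreover obtain root where "\<And>w. poly (Ch 0) w = (\<Prod>i<degree (Ch 0). w - root i)"
    "\<And>i. i < degree (Ch 0) \<Longrightarrow> poly (Ch 0) (root i) = 0" by (rule monic_poly_roots[OF lead_Ch]) blast
  ultimately have "poly (Ch 0) w = (\<Prod>i<r. w)" for w
    unfolding degree_Ch by (metis (no_types, lifting) diff_zero lessThan_iff prod.cong)
  then have "poly (Ch 0) w = w ^ r" for w by simp
  then show ?thesis by (simp add: F_def Ch)
qed

lemma F_multiplicity: "has_multiplicity F r"
proof -
  obtain K where "\<And>y. norm y \<le> 1 \<Longrightarrow> norm (F y) \<le> K * norm y ^ r" using norm_F_le by blast
  then show ?thesis by (rule has_multiplicity_polynomial[OF F_poly _ F_axis])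
qed

text \<open>The map is proper near the origin: points with a small image are small. Hence the global image represents the germ.\<close>

lemma preimage_small:
  assumes "\<epsilon> > 0"
  shows "\<exists>\<delta>>0. \<delta> \<le> 1 \<and> (\<forall>y t. norm y < \<delta> \<longrightarrow> poly (p y) t = 0 \<longrightarrow> norm (pt y t) < \<epsilon>)"
proof -
  obtain K where K: "K \<ge> 0"
    "\<And>y t. norm y \<le> 1 \<Longrightarrow> poly (p y) t = 0 \<Longrightarrow> norm t ^ r \<le> K * norm y"
    by (rule root_bounds) blast
  define \<delta> where "\<delta> = min 1 (min (\<epsilon> / (4 * CARD('n))) ((\<epsilon> / 2) ^ r / (K + 1)))"
  have "\<delta> > 0" using assms K(1) by (simp add: \<delta>_def)
  moreover have "norm (pt y t) < \<epsilon>" if y: "norm y < \<delta>" and t: "poly (p y) t = 0" for y t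
  proof -
    have "norm t ^ r \<le> K * norm y" using K(2)[OF _ t] y by (simp add: \<delta>_def)
    also have "\<dots> \<le> (K + 1) * norm y" by (intro mult_right_mono) auto
    also have "\<dots> < (\<epsilon> / 2) ^ r"
    proof -
      have "norm y < (\<epsilon> / 2) ^ r / (K + 1)" using y by (simp only: \<delta>_def min_less_iff_conj)
      moreover have "K + 1 > 0" using K(1) by simp
      ultimately show ?thesis by (simp only: pos_less_divide_eq mult.commute)
    qed
    finally have "norm t < \<epsilon> / 2"
      by (rule power_less_imp_less_base) (use assms in simp)
    moreover have "2 * CARD('n) * norm y < \<epsilon> / 2"
    proof -
      have "norm y < \<epsilon> / (4 * CARD('n))" using y by (simp add: \<delta>_def)
      then show ?thesis by (simp add: pos_less_divide_eq mult_ac)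
    qed
    ultimately show ?thesis using norm_pt_le[of y t] by linarith
  qed
  ultimately show ?thesis by (intro exI[of _ \<delta>]) (auto simp: \<delta>_def)
qed

lemma represents_range: "represents_image f (range f)"
  unfolding represents_image_def
proof (intro exI[of _ UNIV] conjI allI impI open_UNIV UNIV_I)
  fix U :: "(complex ^ 'n) set" assume U: "open U \<and> 0 \<in> U \<and> U \<subseteq> UNIV"
  then obtain \<epsilon> where \<epsilon>: "\<epsilon> > 0" "ball 0 \<epsilon> \<subseteq> U" by (meson open_contains_ball)
  obtain \<delta> where \<delta>: "\<delta> > 0" "\<And>y t. norm y < \<delta> \<Longrightarrow> poly (p y) t = 0 \<Longrightarrow> norm (pt y t) < \<epsilon>"
    using preimage_small[OF \<epsilon>(1)] by blast
  have "y \<in> range f \<longleftrightarrow> y \<in> f ` U" if y: "norm y < \<delta>" for y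
  proof
    assume "y \<in> range f"
    then obtain x where x: "y = f x" by auto
    then have "f (pt y (x $ l)) = y" by (simp add: pt_f)
    then have "norm (pt y (x $ l)) < \<epsilon>" using \<delta>(2)[OF y] f_pt_eq by blast
    then have "x \<in> U" using \<epsilon>(2) x by (auto simp: pt_f)
    then show "y \<in> f ` U" using x by blast
  qed auto
  then show "\<forall>\<^sub>F y in nhds 0. y \<in> range f \<longleftrightarrow> y \<in> f ` U"
    unfolding eventually_nhds_metric using \<delta>(1) by (intro exI[of _ \<delta>]) auto
qed

section \<open>The equation is reduced\<close>

lemma f_continuous: "continuous_on S f"
proof -
  have "continuous_on S (\<lambda>x. f x $ j)" for j
  proof -
    have "\<forall>j. continuous_on S (\<lambda>x. f x $ j)"
      unfolding all_index f_jp f_jq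
      by (auto simp: f_Some intro!: polynomial_fun_continuous_on polynomial_fun_intros a_poly b_poly)
    then show ?thesis by blast
  qed
  then have "continuous_on S (\<lambda>x. \<chi> j. f x $ j)" by (rule continuous_on_vec_lambda)
  then show ?thesis by simp
qed

lemma dist_pt_le: "dist (pt y t) (pt y' t') \<le> 2 * CARD('n) * dist y y' + dist t t'"
proof -
  have "pt y t - pt y' t' = pt (y - y') (t - t')"
    by (auto simp: Finite_Cartesian_Product.vec_eq_iff pt_nth)
  then show ?thesis using norm_pt_le[of "y - y'" "t - t'"] by (simp add: dist_norm)
qed

lemma poly_p_continuous: "continuous_on S (\<lambda>y. poly (p y) t)"
proof -
  have "poly (p y) t = (\<Sum>k\<le>r. coeff (p y) k * t ^ k)" for y
    unfolding poly_altdef degree_p ..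
  then show ?thesis
    by (auto intro!: polynomial_fun_continuous_on polynomial_fun_intros coeff_p_poly)
qed

text \<open>The value of \<open>p y\<close> at a root of \<open>p y0\<close> is small for \<open>y\<close> near \<open>y0\<close>, so there is a root of \<open>p y\<close>
  nearby, and its point still lies in the open set \<open>W\<close>.\<close>

lemma roots_persist:
  assumes W: "open W" and T: "finite T" "\<And>t. t \<in> T \<Longrightarrow> poly (p y0) t = 0 \<and> pt y0 t \<in> W"
    and \<eta>: "\<eta> > 0"
  shows "\<forall>\<^sub>F y in nhds y0. \<forall>t\<in>T. \<exists>t'\<in>{t. poly (p y) t = 0 \<and> pt y t \<in> W}. dist t' t < \<eta>"
proof -
  have "\<forall>\<^sub>F y in nhds y0. \<exists>t'\<in>{t. poly (p y) t = 0 \<and> pt y t \<in> W}. dist t' t < \<eta>" if t: "t \<in> T" for t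
  proof -
    obtain \<mu> where \<mu>: "\<mu> > 0" "ball (pt y0 t) \<mu> \<subseteq> W"
      using W T(2)[OF t] by (meson open_contains_ball)
    define \<eta>' where "\<eta>' = min \<eta> (\<mu> / 2)"
    have \<eta>': "\<eta>' > 0" using \<eta> \<mu> by (simp add: \<eta>'_def)
    have "isCont (\<lambda>y. poly (p y) t) y0"
      using poly_p_continuous[of UNIV t] by (simp add: continuous_on_eq_continuous_at)
    then have "((\<lambda>y. norm (poly (p y) t)) \<longlongrightarrow> norm (poly (p y0) t)) (nhds y0)"
      by (intro tendsto_norm) (simp add: isCont_def tendsto_nhds_iff)
    then have "\<forall>\<^sub>F y in nhds y0. norm (poly (p y) t) < \<eta>' ^ r"
      by (rule order_tendstoD) (use T(2)[OF t] \<eta>' in simp)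
    moreover have "\<forall>\<^sub>F y in nhds y0. dist y y0 < \<mu> / (4 * CARD('n))"
      unfolding eventually_nhds_metric using \<mu>(1) by (intro exI[of _ "\<mu> / (4 * CARD('n))"]) auto
    ultimately show ?thesis
    proof eventually_elim
      case (elim y)
      obtain t' where t': "poly (p y) t' = 0" "norm (t' - t) < \<eta>'"
        using monic_poly_root_near[OF lead_p, of y t \<eta>'] elim(1) \<eta>' by (auto simp: degree_p)
      have "2 * CARD('n) * dist y y0 < \<mu> / 2" using elim(2) by (simp add: pos_less_divide_eq mult_ac)
      moreover have "dist t' t < \<mu> / 2" using t'(2) by (simp add: dist_norm \<eta>'_def)
      ultimately have "dist (pt y t') (pt y0 t) < \<mu>" using dist_pt_le[of y t' y0 t] by linarith
      then have "pt y t' \<in> W" using \<mu>(2) by (auto simp: dist_commute)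
      then show ?case using t' by (intro bexI[of _ t']) (auto simp: dist_norm \<eta>'_def)
    qed
  qed
  then show ?thesis using T(1) by (simp add: eventually_ball_finite_distrib)
qed

lemma finite_roots: "finite {t. poly (p y) t = 0 \<and> R t}" and card_roots_le: "card {t. poly (p y) t = 0 \<and> R t} \<le> r"
proof -
  have p0: "p y \<noteq> 0" using degree_p[of y] r by auto
  have fin: "finite {t. poly (p y) t = 0}" by (rule poly_roots_finite[OF p0])
  then show "finite {t. poly (p y) t = 0 \<and> R t}" by (rule finite_subset[rotated]) auto
  have "card {t. poly (p y) t = 0 \<and> R t} \<le> card {t. poly (p y) t = 0}"
    by (rule card_mono[OF fin]) auto
  also have "\<dots> \<le> r" using card_poly_roots_bound[OF p0] by (simp add: degree_p)
  finally show "card {t. poly (p y) t = 0 \<and> R t} \<le> r" .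
qed

text \<open>Let \<open>W\<close> be a dense open set of points that are alone in their fibres. In a given open set choose a parameter for
  which the number of roots with points in \<open>W\<close> is maximal. If it were less than \<open>r\<close>, move the parameter
  so that there are \<open>r\<close> distinct roots; one of them does not lie in \<open>W\<close>, and by density a further small
  move takes it into \<open>W\<close> while the others stay there, which contradicts maximality. So all \<open>r\<close> roots
  are distinct with points in \<open>W\<close>, and injectivity separates the values of the component \<open>jq\<close>.\<close>

lemma generic_simple_roots:
  assumes "generically_one_to_one f"
  shows "\<exists>\<delta>>0. \<forall>V. open V \<longrightarrow> V \<noteq> {} \<longrightarrow> V \<subseteq> ball 0 \<delta> \<longrightarrow> (\<exists>y\<in>V. card {z. poly (Ch y) z = 0} = r)"
proof -
  obtain U W where UW: "open U" "0 \<in> U" "open W" "W \<subseteq> U" "U \<subseteq> closure W"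
    "\<And>x y. x \<in> W \<Longrightarrow> y \<in> U \<Longrightarrow> f x = f y \<Longrightarrow> x = y"
    using assms unfolding generically_one_to_one_def by blast
  obtain \<epsilon> where \<epsilon>: "\<epsilon> > 0" "ball 0 \<epsilon> \<subseteq> U" using UW(1,2) by (meson open_contains_ball)
  obtain \<delta> where \<delta>: "\<delta> > 0" "\<And>y t. norm y < \<delta> \<Longrightarrow> poly (p y) t = 0 \<Longrightarrow> norm (pt y t) < \<epsilon>"
    using preimage_small[OF \<epsilon>(1)] by blast
  have inU: "pt y s \<in> U" if "norm y < \<delta>" "poly (p y) s = 0" for y s
    using \<delta>(2)[OF that] \<epsilon>(2) by auto
  define S where "S = (\<lambda>y. {t. poly (p y) t = 0 \<and> pt y t \<in> W})"
  have finS: "finite (S y)" and cardS: "card (S y) \<le> r" for y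
    unfolding S_def by (rule finite_roots, rule card_roots_le)
  have persist: "\<forall>\<^sub>F y in nhds y0. \<forall>t\<in>S y0. \<exists>t'\<in>S y. dist t' t < \<eta>" if "\<eta> > 0" for y0 \<eta>
    unfolding S_def by (rule roots_persist[OF UW(3) _ _ that]) (use finS[of y0] in \<open>auto simp: S_def\<close>)
  have "\<exists>y\<in>V. card {z. poly (Ch y) z = 0} = r" if V: "open V" "V \<noteq> {}" "V \<subseteq> ball 0 \<delta>" for V
  proof -
    obtain v where "v \<in> V" using V(2) by blast
    moreover have "\<forall>y. y \<in> V \<longrightarrow> card (S y) \<le> r" using cardS by blast
    ultimately have "\<exists>ym. ym \<in> V \<and> (\<forall>y. y \<in> V \<longrightarrow> card (S y) \<le> card (S ym))"
      using ex_has_greatest_nat[of "\<lambda>y. y \<in> V" v "\<lambda>y. card (S y)" "Suc r"] by (simp add: less_Suc_eq_le)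
    then obtain ym where ym: "ym \<in> V" "\<And>y. y \<in> V \<Longrightarrow> card (S y) \<le> card (S ym)" by blast
    have nearV: "\<forall>\<^sub>F y in nhds y0. y \<in> V" if "y0 \<in> V" for y0
      using V(1) that by (rule eventually_nhds_in_open)
    have "card (S ym) = r"
    proof (rule ccontr)
      assume "card (S ym) \<noteq> r"
      then have less: "card (S ym) < r" using cardS[of ym] by linarith
      obtain \<eta> where \<eta>: "\<eta> > 0" "\<And>u v. u \<in> S ym \<Longrightarrow> v \<in> S ym \<Longrightarrow> u \<noteq> v \<Longrightarrow> 2 * \<eta> \<le> dist u v"
        using finite_set_separated[OF finS] by blast
      have tends: "((\<lambda>\<tau>. ym + axis jp \<tau>) \<longlongrightarrow> ym) (at 0)"
        by (rule tendsto_eq_intros refl bounded_linear.tendsto[OF bounded_linear_axis] tendsto_ident_at)+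
          (simp add: axis_eq_0_iff)
      \<comment> \<open>Shifting the coordinate \<open>jp\<close> shifts the constant term of \<open>p\<close>, which makes its roots simple.\<close>
      have "\<forall>\<^sub>F \<tau> in at 0. ym + axis jp \<tau> \<in> V"
        by (rule eventually_compose_filterlim[OF nearV[OF ym(1)] tends])
      moreover have "\<forall>\<^sub>F \<tau> in at 0. \<forall>t\<in>S ym. \<exists>t'\<in>S (ym + axis jp \<tau>). dist t' t < \<eta>"
        by (rule eventually_compose_filterlim[OF persist[OF \<eta>(1)] tends])
      moreover have "\<forall>\<^sub>F \<tau> in at 0. card {t. poly (p (ym + axis jp \<tau>)) t = 0} = r"
      proof -
        have p_shift: "p (ym + axis jp \<tau>) = p ym - [:\<tau> / c:]" for \<tau>
        proof -
          have "base (ym + axis jp \<tau>) $ i = base ym $ i" if "i \<noteq> l" for i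
            using Some_ne[OF that] by (simp add: base_def axis_def)
          then have "a j (base (ym + axis jp \<tau>)) = a j (base ym)" for j by (intro a_indep) auto
          then show ?thesis by (simp add: p_def add_divide_distrib)
        qed
        have fin: "finite {s. card {t. poly (p ym - [:s:]) t = 0} \<noteq> r}"
          using poly_shift_has_simple_roots[of "p ym"] r by (simp add: degree_p)
        define B where "B = (\<lambda>s. s * c) ` {s. card {t. poly (p ym - [:s:]) t = 0} \<noteq> r}"
        have "finite (B - {0})" unfolding B_def using fin by (intro finite_Diff finite_imageI)
        then have "open (- (B - {0}))" by (intro open_Compl finite_imp_closed)
        then have "\<forall>\<^sub>F \<tau> in at 0. \<tau> \<notin> B"
          unfolding eventually_at_topological by (intro exI[of _ "- (B - {0})"]) auto
        then show ?thesis
        proof eventually_elim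
          case (elim \<tau>)
          have "\<tau> = \<tau> / c * c" using c by simp
          then have "\<tau> / c \<notin> {s. card {t. poly (p ym - [:s:]) t = 0} \<noteq> r}" using elim unfolding B_def by blast
          then show ?case by (simp add: p_shift)
        qed
      qed
      ultimately have "\<forall>\<^sub>F \<tau> in at 0. ym + axis jp \<tau> \<in> V \<and>
          (\<forall>t\<in>S ym. \<exists>t'\<in>S (ym + axis jp \<tau>). dist t' t < \<eta>) \<and>
          card {t. poly (p (ym + axis jp \<tau>)) t = 0} = r" by eventually_elim blast
      then obtain \<tau> where "ym + axis jp \<tau> \<in> V \<and>
          (\<forall>t\<in>S ym. \<exists>t'\<in>S (ym + axis jp \<tau>). dist t' t < \<eta>) \<and>
          card {t. poly (p (ym + axis jp \<tau>)) t = 0} = r"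
        using eventually_happens[of _ "at (0::complex)"] trivial_limit_at by blast
      then obtain y1 where y1: "y1 \<in> V" "\<And>t. t \<in> S ym \<Longrightarrow> \<exists>t'\<in>S y1. dist t' t < \<eta>"
        "card {t. poly (p y1) t = 0} = r" by blast
      have "card (S ym) \<le> card (S y1)" by (rule card_le_if_separated[OF finS y1(2) \<eta>(2)])
      then have card1: "card (S y1) = card (S ym)" using ym(2)[OF y1(1)] by simp
      have "{t. poly (p y1) t = 0} \<noteq> S y1" using card1 less y1(3) by auto
      then obtain s where s: "poly (p y1) s = 0" "s \<notin> S y1" by (auto simp: S_def)
      obtain \<mu> where \<mu>: "\<mu> > 0"
        "\<And>u v. u \<in> insert s (S y1) \<Longrightarrow> v \<in> insert s (S y1) \<Longrightarrow> u \<noteq> v \<Longrightarrow> 2 * \<mu> \<le> dist u v"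
        using finite_set_separated[of "insert s (S y1)"] finS by blast
      define x1 where "x1 = pt y1 s"
      \<comment> \<open>The parameter for which \<open>x\<close> lies over a root: the image of \<open>x\<close>, except that the coordinate \<open>jq\<close>,
        which does not enter \<open>p\<close>, is kept.\<close>
      define Y where "Y = (\<lambda>x. upd jq (f x) (y1 $ jq))"
      have fx1: "f x1 $ jp = y1 $ jp" using s(1) c by (simp add: poly_p x1_def)
      have Yx1: "Y x1 = y1"
        unfolding Finite_Cartesian_Product.vec_eq_iff all_index Y_def upd_nth
        using jpq(2) fx1 Some_ne by (auto simp: f_Some x1_def pt_nth)
      have "continuous_on UNIV Y" unfolding Y_def by (intro continuous_intros f_continuous)
      then have "isCont Y x1" by (simp add: continuous_on_eq_continuous_at)
      then have "(Y \<longlongrightarrow> Y x1) (nhds x1)" by (simp only: isCont_def tendsto_at_iff_tendsto_nhds)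
      then have "(Y \<longlongrightarrow> y1) (nhds x1)" by (simp only: Yx1)
      note comp = eventually_compose_filterlim[OF _ this]
      have "\<forall>\<^sub>F x in nhds x1. Y x \<in> V" by (rule comp[OF nearV[OF y1(1)]])
      moreover have "\<forall>\<^sub>F x in nhds x1. \<forall>t\<in>S y1. \<exists>t'\<in>S (Y x). dist t' t < \<mu>"
        by (rule comp[OF persist[OF \<mu>(1)]])
      moreover have "\<forall>\<^sub>F x in nhds x1. dist (x $ l) s < \<mu>"
        unfolding eventually_nhds_metric
      proof (intro exI[of _ \<mu>] conjI \<mu>(1) allI impI)
        fix x assume "dist x x1 < \<mu>"
        moreover have "dist (x $ l) (x1 $ l) \<le> dist x x1" by (rule dist_vec_nth_le)
        moreover have "x1 $ l = s" by (simp add: x1_def pt_nth)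
        ultimately show "dist (x $ l) s < \<mu>" by simp
      qed
      ultimately have "\<forall>\<^sub>F x in nhds x1. Y x \<in> V \<and>
          (\<forall>t\<in>S y1. \<exists>t'\<in>S (Y x). dist t' t < \<mu>) \<and> dist (x $ l) s < \<mu>" by eventually_elim blast
      then obtain A where A: "open A" "x1 \<in> A"
        "\<And>x. x \<in> A \<Longrightarrow> Y x \<in> V \<and> (\<forall>t\<in>S y1. \<exists>t'\<in>S (Y x). dist t' t < \<mu>) \<and> dist (x $ l) s < \<mu>"
        unfolding eventually_nhds by blast
      have "x1 \<in> U" unfolding x1_def using V(3) y1(1) s(1) by (intro inU) auto
      then have "x1 \<in> closure W" using UW(5) by blast
      then obtain x where x: "x \<in> W" "x \<in> A" using A(1,2) by (meson disjoint_iff open_Int_closure_eq_empty)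
      note Ax = A(3)[OF x(2)]
      have ptY: "pt (Y x) (x $ l) = x"
        using Some_ne by (auto simp: Finite_Cartesian_Product.vec_eq_iff pt_nth Y_def upd_nth f_Some)
      have "poly (p (Y x)) (x $ l) = 0"
        unfolding poly_p ptY using jpq(2) by (simp add: Y_def upd_nth)
      then have xl: "x $ l \<in> S (Y x)" using ptY x(1) by (simp add: S_def)
      have "card (insert s (S y1)) \<le> card (S (Y x))"
        by (rule card_le_if_separated[OF finS _ \<mu>(2)]) (use Ax xl in auto)
      also have "\<dots> \<le> card (S ym)" using ym(2) Ax by blast
      finally show False using s(2) finS card1 by simp
    qed
    moreover have p0: "p ym \<noteq> 0" using degree_p[of ym] r by auto
    have ym_small: "norm ym < \<delta>" using ym(1) V(3) by auto
    have inj: "inj_on (poly (q ym)) (S ym)"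
    proof (rule inj_onI)
      fix s t assume st: "s \<in> S ym" "t \<in> S ym" "poly (q ym) s = poly (q ym) t"
      have "f (pt ym s) = f (pt ym t)"
        unfolding Finite_Cartesian_Product.vec_eq_iff all_index
        using st c by (auto simp: S_def poly_p poly_q f_Some pt_nth)
      then have "pt ym s = pt ym t" using UW(4,6) st by (auto simp: S_def)
      then show "s = t" by (metis pt_nth)
    qed
    have sub: "poly (q ym) ` S ym \<subseteq> {z. poly (Ch ym) z = 0}" by (auto simp: Ch_root S_def)
    have C0: "Ch ym \<noteq> 0" using degree_Ch[of ym] r by auto
    have "card (poly (q ym) ` S ym) \<le> card {z. poly (Ch ym) z = 0}"
      by (rule card_mono[OF poly_roots_finite[OF C0] sub])
    moreover have "card {z. poly (Ch ym) z = 0} \<le> r"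
      using card_poly_roots_bound[OF C0] by (simp add: degree_Ch)
    ultimately have "card {z. poly (Ch ym) z = 0} = r" using card_image[OF inj] by linarith
    then show ?thesis using ym(1) by blast
  qed
  then show ?thesis using \<delta>(1) by blast
qed

text \<open>For \<open>G\<close> vanishing on the image, define \<open>H\<close> as the Cauchy integral of \<open>G / F\<close> in the coordinate \<open>jq\<close> over
  a circle enclosing all roots of \<open>Ch y\<close>, for all small \<open>y\<close> simultaneously. It is holomorphic by
  \<open>holo_on_integral\<close>, equals \<open>G / F\<close> where the roots are simple by \<open>Cauchy_division\<close>, and the identity
  \<open>G = H F\<close> extends from this dense set by continuity.\<close>

lemma F_reduced:
  assumes "generically_one_to_one f"
  shows "reduced_equation (range f) F"
  unfolding reduced_equation_def
proof (intro conjI allI impI)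
  show "holo_germ F" by (rule polynomial_fun_holo_germ[OF F_poly])
  show "\<forall>\<^sub>F y in nhds 0. y \<in> range f \<longleftrightarrow> F y = 0" using F_eq_0 by simp
next
  fix G :: "complex ^ 'n option \<Rightarrow> complex"
  assume "holo_germ G \<and> (\<forall>\<^sub>F y in nhds 0. y \<in> range f \<longrightarrow> G y = 0)"
  then obtain V1 where V1: "open V1" "0 \<in> V1" "holo_on G V1" and "\<forall>\<^sub>F y in nhds 0. y \<in> range f \<longrightarrow> G y = 0"
    unfolding holo_germ_def by blast
  then obtain V2 where V2: "open V2" "0 \<in> V2" "\<And>y. y \<in> V2 \<Longrightarrow> y \<in> range f \<Longrightarrow> G y = 0"
    unfolding eventually_nhds by blast
  have "open (V1 \<inter> V2)" "0 \<in> V1 \<inter> V2" using V1 V2 by auto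
  then obtain R where R: "R > 0" "ball 0 R \<subseteq> V1 \<inter> V2" by (meson open_contains_ball)
  have holG: "holo_on G (ball 0 R)" using V1(3) R(2) unfolding holo_on_def by blast
  have G0: "G y = 0" if "norm y < R" "F y = 0" for y
    using V2(3)[of y] that R(2) by (auto simp: F_eq_0)
  obtain \<delta>1 where \<delta>1: "\<delta>1 > 0"
    "\<And>V. open V \<Longrightarrow> V \<noteq> {} \<Longrightarrow> V \<subseteq> ball 0 \<delta>1 \<Longrightarrow> \<exists>y\<in>V. card {z. poly (Ch y) z = 0} = r"
    using generic_simple_roots[OF assms] by blast
  obtain K where K: "K \<ge> 0"
    "\<And>y t. norm y \<le> 1 \<Longrightarrow> poly (p y) t = 0 \<Longrightarrow> norm (poly (q y) t) \<le> K * norm y"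
    by (rule root_bounds) blast
  define \<rho> where "\<rho> = R / 2"
  have \<rho>: "\<rho> > 0" using R(1) by (simp add: \<rho>_def)
  \<comment> \<open>For \<open>|y| \<le> \<delta>\<close> all roots of \<open>Ch y\<close> lie inside the circle of radius \<open>\<rho>\<close>, and \<open>G\<close> is defined where the
    coordinate \<open>jq\<close> of \<open>y\<close> is replaced by a point of a disc larger than that circle.\<close>
  define \<delta> where "\<delta> = min \<delta>1 (min 1 (min (R / 8) (\<rho> / (2 * (K + 1)))))"
  have \<delta>0: "\<delta> > 0" using \<delta>1(1) R(1) \<rho> K(1) by (simp add: \<delta>_def)
  have \<delta>: "\<delta> > 0" "\<delta> \<le> \<delta>1" "\<delta> \<le> 1" "\<delta> \<le> R / 8" "\<delta> \<le> \<rho> / (2 * (K + 1))"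
    by (rule \<delta>0) (simp_all only: \<delta>_def min_le_iff_disj order_refl simp_thms)
  have root_small: "norm z < \<rho>" if y: "norm y \<le> \<delta>" and z: "poly (Ch y) z = 0" for y z
  proof -
    have "norm z \<le> K * norm y" using K(2)[of y] y z \<delta>(3) by (auto simp: Ch_root)
    also have "\<dots> \<le> (K + 1) * \<delta>" using y K(1) by (intro mult_mono) auto
    also have "\<dots> \<le> (K + 1) * (\<rho> / (2 * (K + 1)))" using \<delta>(5) K(1) by (intro mult_left_mono) auto
    also have "\<dots> = \<rho> / 2" using K(1) by (simp add: field_simps add_nonneg_eq_0_iff)
    finally show ?thesis using \<rho> by linarith
  qed
  have upd_small: "norm (upd jq y z) < R" if "norm y \<le> \<delta>" "norm z < R - 2 * \<delta>" for y z
    using norm_upd_le[of jq y z] that by linarith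
  have \<rho>R: "\<rho> < R - 2 * \<delta>" using \<delta>(4) R(1) by (simp add: \<rho>_def)
  have y_small: "norm (y $ jq) < \<rho>" if "norm y \<le> \<delta>" for y
    using Finite_Cartesian_Product.norm_nth_le[of y jq] that \<delta>(4) R(1) by (simp add: \<rho>_def)
  define \<gamma> where "\<gamma> = circlepath 0 \<rho>"
  have \<gamma>: "norm (\<gamma> s) = \<rho>" for s using \<rho> by (simp add: \<gamma>_def circlepath norm_mult)
  have \<gamma>_cont: "continuous_on S \<gamma>" for S by (auto simp: \<gamma>_def circlepath intro!: continuous_intros)
  \<comment> \<open>The speed of the circle, divided by \<open>2 \<pi> \<i>\<close>.\<close>
  define w where "w = (\<lambda>s. \<rho> * exp (2 * of_real pi * \<i> * of_real s))"
  have w_cont: "continuous_on S w" for S unfolding w_def by (intro continuous_intros)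
  define k where "k = (\<lambda>y s. (G (upd jq y (\<gamma> s)) * inverse (F (upd jq y (\<gamma> s)) * (\<gamma> s - y $ jq))) * w s)"
  define H where "H = (\<lambda>y. integral {0..1} (k y))"
  have nz: "F (upd jq y (\<gamma> s)) * (\<gamma> s - y $ jq) \<noteq> 0" if y: "norm y \<le> \<delta>" for y s
  proof -
    have "F (upd jq y (\<gamma> s)) \<noteq> 0" using root_small[OF y, of "\<gamma> s"] \<gamma>[of s] by (auto simp: F_upd)
    moreover have "\<gamma> s \<noteq> y $ jq" using y_small[OF y] \<gamma>[of s] by auto
    ultimately show ?thesis by simp
  qed
  have holk: "holo_on (\<lambda>y. k y s) (ball 0 \<delta>)" for s
    unfolding k_def
  proof (intro holo_on_mult holo_on_inverse)
    show "holo_on (\<lambda>y. G (upd jq y (\<gamma> s))) (ball 0 \<delta>)"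
      by (rule holo_on_compose_upd[OF holG]) (use upd_small \<gamma> \<rho>R in auto)
    show "holo_on (\<lambda>y. F (upd jq y (\<gamma> s))) (ball 0 \<delta>)"
      by (rule holo_on_compose_upd[OF polynomial_fun_holo_on[OF F_poly, of UNIV]]) auto
  qed (use nz in \<open>auto intro!: polynomial_fun_holo_on polynomial_fun_intros\<close>)
  have joint: "continuous_on (cball 0 \<delta> \<times> {0..1}) (\<lambda>(y, s). k y s)"
    unfolding k_def case_prod_beta
  proof (intro continuous_intros \<gamma>_cont w_cont continuous_on_compose2[OF \<gamma>_cont[of UNIV]]
      continuous_on_compose2[OF w_cont[of UNIV]]
      continuous_on_compose2[OF polynomial_fun_continuous_on[OF F_poly, of UNIV]]
      continuous_on_compose2[OF holo_on_continuous_on[OF holG]])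
  qed (use upd_small \<gamma> \<rho>R nz in auto)
  have "compact ((\<lambda>(y, s). k y s) ` (cball 0 \<delta> \<times> {0..1::real}))"
    by (rule compact_continuous_image[OF joint]) (intro compact_Times compact_cball compact_Icc)
  then have "bounded ((\<lambda>(y, s). k y s) ` (cball 0 \<delta> \<times> {0..1::real}))" by (rule compact_imp_bounded)
  then obtain M0 where M0': "\<forall>v\<in>(\<lambda>(y, s). k y s) ` (cball 0 \<delta> \<times> {0..1::real}). norm v \<le> M0"
    unfolding bounded_iff by (rule exE)
  have M0: "norm (k y s) < M0 + 1" if "y \<in> ball 0 \<delta>" "s \<in> {0..1}" for y s
  proof -
    have "(y, s) \<in> cball 0 \<delta> \<times> {0..1}" using that by auto
    then have "(\<lambda>(y, s). k y s) (y, s) \<in> (\<lambda>(y, s). k y s) ` (cball 0 \<delta> \<times> {0..1})" by (rule imageI)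
    then have "norm ((\<lambda>(y, s). k y s) (y, s)) \<le> M0" by (rule bspec[OF M0'])
    then show ?thesis by simp
  qed
  have contk: "continuous_on {0..1} (k y)" if "y \<in> ball 0 \<delta>" for y
  proof -
    have "continuous_on {0..1} (\<lambda>s. (\<lambda>(y, s). k y s) (y, s))"
      by (rule continuous_on_compose2[OF joint]) (use that in \<open>auto intro: continuous_intros\<close>)
    then show ?thesis by simp
  qed
  have holH: "holo_on H (ball 0 \<delta>)"
    unfolding H_def by (rule holo_on_integral[OF holk contk M0])
  have simple_case: "G y = H y * F y" if y: "y \<in> ball 0 \<delta>" and card: "card {z. poly (Ch y) z = 0} = r" for y
  proof -
    have yd: "norm y \<le> \<delta>" using y by simp
    define g where "g = (\<lambda>z. G (upd jq y z))"
    have "g holomorphic_on ball 0 (R - 2 * \<delta>)"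
      unfolding holomorphic_on_def field_differentiable_def
    proof
      fix z :: complex assume z: "z \<in> ball 0 (R - 2 * \<delta>)"
      define y0 where "y0 = upd jq y 0"
      have line: "upd jq y z = y0 + z *s axis jq 1" for z
        by (auto simp: y0_def Finite_Cartesian_Product.vec_eq_iff upd_nth axis_def)
      have "upd jq y z \<in> ball 0 R" using upd_small[OF yd, of z] z by simp
      then obtain D where D: "(G has_derivative D) (at (upd jq y z))" "\<And>c v. D (c *s v) = c * D v"
        using holG unfolding holo_on_def by blast
      have g_line: "g = (\<lambda>z. G (y0 + z *s axis jq 1))" by (simp only: g_def line)
      have "(g has_field_derivative D (axis jq 1)) (at z)"
        unfolding g_line by (rule clinear_derivative_along_line) (use D line[of z] in auto)
      then show "\<exists>f'. (g has_field_derivative f') (at z within ball 0 (R - 2 * \<delta>))"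
        using has_field_derivative_at_within by blast
    qed
    moreover have "g z = 0" if "poly (Ch y) z = 0" for z
      unfolding g_def using that upd_small[OF yd, of z] root_small[OF yd that] \<rho>R
      by (intro G0) (auto simp: F_upd)
    ultimately obtain v where v: "((\<lambda>u. g u / (poly (Ch y) u * (u - y $ jq))) has_contour_integral (2 * of_real pi * \<i> * v)) (circlepath 0 \<rho>)"
      "g (y $ jq) = v * poly (Ch y) (y $ jq)"
      using Cauchy_division[OF lead_Ch, of y g "R - 2 * \<delta>" \<rho> "y $ jq"] card root_small[OF yd] y_small[OF yd] \<rho>R
      by (auto simp: degree_Ch)
    have int: "((\<lambda>s. 2 * of_real pi * \<i> * k y s) has_integral 2 * of_real pi * \<i> * v) {0..1}"
      using v(1) unfolding has_contour_integral
      by (rule has_integral_eq[rotated])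
        (simp add: k_def g_def F_upd \<gamma>_def w_def vector_derivative_circlepath divide_inverse mult_ac)
    define c\<pi> :: complex where "c\<pi> = 2 * of_real pi * \<i>"
    have "c\<pi> \<noteq> 0" by (simp add: c\<pi>_def)
    then have cancel: "inverse c\<pi> * (c\<pi> * x) = x" for x by simp
    have "((\<lambda>s. inverse c\<pi> * (c\<pi> * k y s)) has_integral inverse c\<pi> * (c\<pi> * v)) {0..1}"
      using int unfolding c\<pi>_def[symmetric] by (rule has_integral_mult_right)
    then have "(k y has_integral v) {0..1}" by (simp only: cancel)
    then have "H y = v" unfolding H_def by (rule integral_unique)
    then show ?thesis using v(2) by (simp add: g_def upd_self F_def)
  qed
  have "G y = H y * F y" if y: "y \<in> ball 0 \<delta>" for y
  proof (rule ccontr)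
    assume ne: "G y \<noteq> H y * F y"
    have "ball 0 \<delta> \<subseteq> ball (0 :: complex ^ 'n option) R" using \<delta>(4) R(1) by auto
    then have "continuous_on (ball 0 \<delta>) (\<lambda>y. G y - H y * F y)"
      by (intro continuous_intros holo_on_continuous_on[OF holH] polynomial_fun_continuous_on F_poly
          continuous_on_subset[OF holo_on_continuous_on[OF holG]])
    then have "open ((\<lambda>y. G y - H y * F y) -` (- {0}) \<inter> ball 0 \<delta>)"
      by (subst (asm) continuous_on_open_vimage) auto
    moreover have "y \<in> (\<lambda>y. G y - H y * F y) -` (- {0}) \<inter> ball 0 \<delta>" using ne y by auto
    moreover have "(\<lambda>y. G y - H y * F y) -` (- {0}) \<inter> ball 0 \<delta> \<subseteq> ball 0 \<delta>1" using \<delta>(2) by auto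
    ultimately obtain y' where "y' \<in> (\<lambda>y. G y - H y * F y) -` (- {0}) \<inter> ball 0 \<delta>"
      "card {z. poly (Ch y') z = 0} = r" using \<delta>1(2) by blast
    then show False using simple_case by auto
  qed
  then have "\<forall>\<^sub>F y in nhds 0. G y = H y * F y"
    unfolding eventually_nhds_metric using \<delta>(1) by (intro exI[of _ \<delta>]) auto
  moreover have "holo_germ H" unfolding holo_germ_def using holH \<delta>(1) by (intro exI[of _ "ball 0 \<delta>"]) auto
  ultimately show "\<exists>H. holo_germ H \<and> (\<forall>\<^sub>F y in nhds 0. G y = H y * F y)" by blast
qed

lemma image_multiplicity_eq:
  "generically_one_to_one f \<Longrightarrow> image_multiplicity f = r"
  by (rule image_multiplicity_eqI[OF represents_range F_reduced F_multiplicity])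

end

section \<open>An obstruction to finite determinacy\<close>

lemma has_derivative_components:
  fixes g :: "'a::real_normed_vector \<Rightarrow> complex ^ 'm"
  assumes "\<And>j. ((\<lambda>x. g x $ j) has_derivative (\<lambda>v. D v $ j)) (at x)"
  shows "(g has_derivative D) (at x)"
proof -
  have exp: "y = (\<Sum>j\<in>UNIV. axis j (y $ j))" for y :: "complex ^ 'm"
    by (simp add: Finite_Cartesian_Product.vec_eq_iff axis_def)
  have "((\<lambda>x. \<Sum>j\<in>UNIV. axis j (g x $ j)) has_derivative (\<lambda>v. \<Sum>j\<in>UNIV. axis j (D v $ j))) (at x)"
    by (intro has_derivative_sum bounded_linear.has_derivative[OF bounded_linear_axis] assms)
  then show ?thesis using exp by simp
qed

lemma holo_map_germ_differentiable:
  assumes "holo_map_germ \<Phi>"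
  shows "\<forall>\<^sub>F x in nhds 0. \<exists>D. (\<Phi> has_derivative D) (at x)"
proof -
  have "\<forall>\<^sub>F x in nhds 0. \<exists>D. ((\<lambda>x. \<Phi> x $ j) has_derivative D) (at x)" for j
  proof -
    obtain U where U: "open U" "0 \<in> U" "holo_on (\<lambda>x. \<Phi> x $ j) U"
      using assms unfolding holo_map_germ_def holo_germ_def by blast
    have "\<exists>D. ((\<lambda>x. \<Phi> x $ j) has_derivative D) (at x)" if "x \<in> U" for x
      using U(3) that unfolding holo_on_def by blast
    then show ?thesis by (rule eventually_mono[OF eventually_nhds_in_open[OF U(1,2)]])
  qed
  then have "\<forall>\<^sub>F x in nhds 0. \<forall>j. \<exists>D. ((\<lambda>x. \<Phi> x $ j) has_derivative D) (at x)"
    by (simp add: eventually_all_finite)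
  then show ?thesis
  proof eventually_elim
    case (elim x)
    then obtain D where "\<And>j. ((\<lambda>x. \<Phi> x $ j) has_derivative D j) (at x)" by metis
    then have "(\<Phi> has_derivative (\<lambda>v. \<chi> j. D j v)) (at x)"
      by (intro has_derivative_components) simp
    then show ?case by blast
  qed
qed

lemma holo_map_germ_tendsto:
  assumes "holo_map_germ \<Phi>"
  shows "filterlim \<Phi> (nhds 0) (nhds 0)"
proof -
  obtain D where "(\<Phi> has_derivative D) (at 0)"
    using eventually_nhds_x_imp_x[OF holo_map_germ_differentiable[OF assms]] by blast
  then have "isCont \<Phi> 0" by (rule has_derivative_continuous)
  then have "(\<Phi> \<longlongrightarrow> \<Phi> 0) (nhds 0)" by (simp only: isCont_def tendsto_at_iff_tendsto_nhds)
  moreover have "\<Phi> 0 = 0" using assms unfolding holo_map_germ_def by blast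
  ultimately show ?thesis by simp
qed

lemma derivative_left_inverse:
  assumes "(h has_derivative H) (at x)" "(k has_derivative K) (at (h x))" "\<forall>\<^sub>F z in nhds x. k (h z) = z"
  shows "K (H v) = v"
proof -
  have "((\<lambda>z. k (h z)) has_derivative (\<lambda>v. K (H v))) (at x)"
    using diff_chain_at[OF assms(1,2)] by (simp add: o_def)
  moreover have "((\<lambda>z. k (h z)) has_derivative (\<lambda>v. v)) (at x)"
  proof (rule has_derivative_transform_eventually[OF has_derivative_ident])
    show "\<forall>\<^sub>F z in at x. z = k (h z)"
      using assms(3) by (auto simp: eventually_at_filter elim: eventually_mono)
    show "x = k (h x)" using eventually_nhds_x_imp_x[OF assms(3)] by simp
  qed simp
  ultimately have "(\<lambda>v. K (H v)) = (\<lambda>v. v)" by (rule has_derivative_unique)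
  then show ?thesis by (rule fun_cong)
qed

lemma diffeo_germE:
  assumes "diffeo_germ \<Phi>"
  obtains \<Theta> where "holo_map_germ \<Phi>" "holo_map_germ \<Theta>"
    "\<forall>\<^sub>F x in nhds 0. \<Theta> (\<Phi> x) = x" "\<forall>\<^sub>F x in nhds 0. \<Phi> (\<Theta> x) = x"
  using assms unfolding diffeo_germ_def by (elim conjE exE) (rule that)

text \<open>A coordinate change \<open>\<Phi>\<close> of the source carries points with a common image to such points, and the
  derivative of \<open>\<Psi>\<close> at that image carries the tangent spaces of all sheets through it isomorphically to
  those of the other map, hence also a common subspace. Only points near the origin are controlled,
  so the configurations for \<open>f\<close> have to exist in every ball.\<close>

lemma A_equivalent_common_tangent_space:
  fixes f g :: "complex ^ 'n \<Rightarrow> complex ^ 'm"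
  assumes eq: "A_equivalent f g"
    and Df: "\<And>x. (f has_derivative Df x) (at x)" and Dg: "\<And>x. (g has_derivative Dg x) (at x)"
    and f0: "f 0 = 0" and m: "m > 0"
    and f: "\<And>\<epsilon>. \<epsilon> > 0 \<Longrightarrow> \<exists>T y S. card T = m \<and> T \<subseteq> ball 0 \<epsilon> \<and> (\<forall>x\<in>T. f x = y) \<and>
        subspace S \<and> dim S = k \<and> (\<forall>x\<in>T. S \<subseteq> range (Df x))"
  shows "\<exists>T y S. card T = m \<and> (\<forall>x\<in>T. g x = y) \<and> subspace S \<and> dim S = k \<and> (\<forall>x\<in>T. S \<subseteq> range (Dg x))"
proof -
  obtain \<Phi> \<Psi> where diff: "diffeo_germ \<Phi>" "diffeo_germ \<Psi>" and g_eq: "\<forall>\<^sub>F x in nhds 0. g x = \<Psi> (f (\<Phi> x))"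
    using eq unfolding A_equivalent_def by blast
  obtain \<Theta> where \<Phi>: "holo_map_germ \<Phi>" "holo_map_germ \<Theta>" "\<forall>\<^sub>F x in nhds 0. \<Phi> (\<Theta> x) = x"
    using diff(1) by (rule diffeo_germE)
  obtain \<Xi> where \<Psi>: "holo_map_germ \<Psi>" "holo_map_germ \<Xi>" "\<forall>\<^sub>F x in nhds 0. \<Xi> (\<Psi> x) = x"
    using diff(2) by (rule diffeo_germE)
  have "isCont f 0" using Df by (rule has_derivative_continuous)
  then have "(f \<longlongrightarrow> f 0) (nhds 0)" by (simp only: isCont_def tendsto_at_iff_tendsto_nhds)
  then have f_lim: "filterlim f (nhds 0) (nhds 0)" using f0 by simp
  note \<Theta>_lim = holo_map_germ_tendsto[OF \<Phi>(2)]
  note \<Psi>_lim = holo_map_germ_tendsto[OF \<Psi>(1)]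
  have "\<forall>\<^sub>F x in nhds 0. \<forall>\<^sub>F z in nhds (\<Theta> x). g z = \<Psi> (f (\<Phi> z))"
    using g_eq by (intro eventually_compose_filterlim[OF _ \<Theta>_lim]) (simp add: eventually_eventually)
  moreover have "\<forall>\<^sub>F x in nhds 0. \<exists>D. (\<Phi> has_derivative D) (at (\<Theta> x))"
    by (rule eventually_compose_filterlim[OF holo_map_germ_differentiable[OF \<Phi>(1)] \<Theta>_lim])
  moreover have "\<forall>\<^sub>F x in nhds 0. \<exists>D. (\<Theta> has_derivative D) (at x)"
    by (rule holo_map_germ_differentiable[OF \<Phi>(2)])
  moreover have "\<forall>\<^sub>F x in nhds 0. \<forall>\<^sub>F z in nhds x. \<Phi> (\<Theta> z) = z"
    using \<Phi>(3) by (simp add: eventually_eventually)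
  moreover have "\<forall>\<^sub>F x in nhds 0. \<exists>D. (\<Psi> has_derivative D) (at (f x))"
    by (rule eventually_compose_filterlim[OF holo_map_germ_differentiable[OF \<Psi>(1)] f_lim])
  moreover have "\<forall>\<^sub>F x in nhds 0. \<forall>\<^sub>F z in nhds (f x). \<Xi> (\<Psi> z) = z"
    using \<Psi>(3) by (intro eventually_compose_filterlim[OF _ f_lim]) (simp add: eventually_eventually)
  moreover have "\<forall>\<^sub>F x in nhds 0. \<exists>D. (\<Xi> has_derivative D) (at (\<Psi> (f x)))"
    by (rule eventually_compose_filterlim[OF holo_map_germ_differentiable[OF \<Psi>(2)]
          filterlim_compose[OF \<Psi>_lim f_lim]])
  ultimately have "\<forall>\<^sub>F x in nhds 0. (\<forall>\<^sub>F z in nhds (\<Theta> x). g z = \<Psi> (f (\<Phi> z))) \<and>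
      (\<exists>D. (\<Phi> has_derivative D) (at (\<Theta> x))) \<and> (\<exists>D. (\<Theta> has_derivative D) (at x)) \<and>
      (\<forall>\<^sub>F z in nhds x. \<Phi> (\<Theta> z) = z) \<and> (\<exists>D. (\<Psi> has_derivative D) (at (f x))) \<and>
      (\<forall>\<^sub>F z in nhds (f x). \<Xi> (\<Psi> z) = z) \<and> (\<exists>D. (\<Xi> has_derivative D) (at (\<Psi> (f x))))"
    by eventually_elim blast
  then obtain \<epsilon> where \<epsilon>: "\<epsilon> > 0" and good: "\<And>x. x \<in> ball 0 \<epsilon> \<Longrightarrow>
      (\<forall>\<^sub>F z in nhds (\<Theta> x). g z = \<Psi> (f (\<Phi> z))) \<and>
      (\<exists>D. (\<Phi> has_derivative D) (at (\<Theta> x))) \<and> (\<exists>D. (\<Theta> has_derivative D) (at x)) \<and>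
      (\<forall>\<^sub>F z in nhds x. \<Phi> (\<Theta> z) = z) \<and> (\<exists>D. (\<Psi> has_derivative D) (at (f x))) \<and>
      (\<forall>\<^sub>F z in nhds (f x). \<Xi> (\<Psi> z) = z) \<and> (\<exists>D. (\<Xi> has_derivative D) (at (\<Psi> (f x))))"
    unfolding eventually_nhds_metric by (auto simp: dist_commute)
  obtain T y S where T: "card T = m" "T \<subseteq> ball 0 \<epsilon>" "\<And>x. x \<in> T \<Longrightarrow> f x = y"
    and S: "subspace S" "dim S = k" "\<And>x. x \<in> T \<Longrightarrow> S \<subseteq> range (Df x)"
    using f[OF \<epsilon>] by blast
  have "T \<noteq> {}" using T(1) m by auto
  then obtain x0 where x0: "x0 \<in> T" by blast
  then obtain P X where P: "(\<Psi> has_derivative P) (at y)" and X: "(\<Xi> has_derivative X) (at (\<Psi> y))"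
    and XP: "\<forall>\<^sub>F z in nhds y. \<Xi> (\<Psi> z) = z"
    using good[of x0] T(2) T(3)[OF x0] by blast
  have XP': "X (P v) = v" for v by (rule derivative_left_inverse[OF P X XP])
  have linP: "linear P" using P by (rule has_derivative_linear)
  have inv: "\<Phi> (\<Theta> x) = x" if "x \<in> T" for x
    using good[of x] that T(2) by (blast dest: eventually_nhds_x_imp_x)
  have g\<Theta>: "g (\<Theta> x) = \<Psi> y" if "x \<in> T" for x
  proof -
    have "g (\<Theta> x) = \<Psi> (f (\<Phi> (\<Theta> x)))"
      using good[of x] that T(2) by (blast dest: eventually_nhds_x_imp_x)
    then show ?thesis by (simp add: inv that T(3))
  qed
  have range: "P ` S \<subseteq> range (Dg (\<Theta> x))" if x: "x \<in> T" for x
  proof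
    fix v assume "v \<in> P ` S"
    then obtain s where s: "s \<in> S" "v = P s" by blast
    obtain u where u: "s = Df x u" using S(3)[OF x] s(1) by blast
    obtain A where A: "(\<Phi> has_derivative A) (at (\<Theta> x))" using good[of x] x T(2) by blast
    obtain B where B: "(\<Theta> has_derivative B) (at x)" using good[of x] x T(2) by blast
    have "\<forall>\<^sub>F z in nhds x. \<Phi> (\<Theta> z) = z" using good[of x] x T(2) by blast
    then have AB: "A (B u) = u" by (rule derivative_left_inverse[OF B A])
    have "((\<lambda>z. f (\<Phi> z)) has_derivative (\<lambda>v. Df x (A v))) (at (\<Theta> x))"
      using diff_chain_at[OF A] Df[of x] by (simp add: o_def inv x)
    then have "((\<lambda>z. \<Psi> (f (\<Phi> z))) has_derivative (\<lambda>v. P (Df x (A v)))) (at (\<Theta> x))"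
      using diff_chain_at[of "\<lambda>z. f (\<Phi> z)" _ "\<Theta> x" \<Psi> P] P by (simp add: o_def inv x T(3))
    moreover have ev: "\<forall>\<^sub>F z in nhds (\<Theta> x). g z = \<Psi> (f (\<Phi> z))" using good[of x] x T(2) by blast
    ultimately have "(g has_derivative (\<lambda>v. P (Df x (A v)))) (at (\<Theta> x))"
    proof (elim has_derivative_transform_eventually)
      show "\<forall>\<^sub>F z in at (\<Theta> x). \<Psi> (f (\<Phi> z)) = g z"
        using ev by (auto simp: eventually_at_filter elim: eventually_mono)
      show "\<Psi> (f (\<Phi> (\<Theta> x))) = g (\<Theta> x)" using eventually_nhds_x_imp_x[OF ev] by simp
    qed simp
    then have "Dg (\<Theta> x) = (\<lambda>v. P (Df x (A v)))" by (rule has_derivative_unique[OF Dg])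
    then have "Dg (\<Theta> x) (B u) = v" using AB u s(2) by simp
    then show "v \<in> range (Dg (\<Theta> x))" by blast
  qed
  have "inj_on \<Theta> T" by (rule inj_on_inverseI[of _ \<Phi>]) (rule inv)
  then have "card (\<Theta> ` T) = m" using T(1) by (simp add: card_image)
  moreover have "subspace (P ` S)" by (rule linear_subspace_image[OF linP S(1)])
  moreover have "dim (P ` S) = k"
  proof -
    have "inj_on P (span S)" by (rule inj_on_inverseI[of _ X]) (rule XP')
    then show ?thesis using dim_image_eq[OF linP] S(2) by simp
  qed
  ultimately show ?thesis using g\<Theta> range
    by (intro exI[of _ "\<Theta> ` T"] exI[of _ "\<Psi> y"] exI[of _ "P ` S"]) auto
qed

lemma frechet_derivative_eqI: "(h has_derivative D) (at x) \<Longrightarrow> frechet_derivative h (at x) = D"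
  by (rule frechet_derivative_at[symmetric])

lemma derivative_zero_if_independent:
  assumes h: "polynomial_fun h" and C: "\<And>x x'. (\<forall>i\<in>C. x $ i = x' $ i) \<Longrightarrow> h x = h x'"
    and v: "\<forall>i\<in>C. v $ i = 0"
  shows "frechet_derivative h (at x) v = 0"
proof -
  obtain D where D: "(h has_derivative D) (at x)" "\<And>c v. D (c *s v) = c * D v"
    using polynomial_fun_has_clinear_derivative[OF h, of x] by blast
  have "((\<lambda>s. h (x + s *s v)) has_field_derivative D v) (at 0)"
    by (rule clinear_derivative_along_line) (use D in auto)
  moreover have "(\<lambda>s. h (x + s *s v)) = (\<lambda>_. h x)" using v by (intro ext C) simp
  ultimately have "D v = 0" by (metis DERIV_const DERIV_unique)
  then show ?thesis by (simp add: frechet_derivative_eqI[OF D(1)])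
qed

lemma derivative_eq_if_independent:
  assumes h: "polynomial_fun h" and C: "\<And>x x'. (\<forall>i\<in>C. x $ i = x' $ i) \<Longrightarrow> h x = h x'"
    and x: "\<forall>i\<in>C. x $ i = x' $ i"
  shows "frechet_derivative h (at x) = frechet_derivative h (at x')"
proof -
  have "((\<lambda>z. h (z + (x' - x))) has_derivative frechet_derivative h (at x')) (at x)"
  proof -
    have "((\<lambda>z. z + (x' - x)) has_derivative (\<lambda>v. v)) (at x)"
      by (auto intro!: derivative_eq_intros)
    moreover have "(h has_derivative frechet_derivative h (at x')) (at (x + (x' - x)))"
      using polynomial_fun_has_derivative[OF h, of x'] by simp
    ultimately show ?thesis
      using diff_chain_at[of "\<lambda>z. z + (x' - x)" "\<lambda>v. v" x h "frechet_derivative h (at x')"]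
      by (simp add: o_def)
  qed
  moreover have "(\<lambda>z. h (z + (x' - x))) = h" using x by (intro ext C) simp
  ultimately show ?thesis by (simp add: frechet_derivative_eqI)
qed

lemma poly_zero_if_many_roots:
  fixes P :: "complex poly"
  assumes "degree P \<le> m" "m < card T" "\<And>t. t \<in> T \<Longrightarrow> poly P t = 0"
  shows "P = 0"
proof (rule ccontr)
  assume P: "P \<noteq> 0"
  have "card T \<le> card {t. poly P t = 0}"
    by (rule card_mono[OF poly_roots_finite[OF P]]) (use assms(3) in auto)
  also have "\<dots> \<le> degree P" by (rule card_poly_roots_bound[OF P])
  finally show False using assms(1,2) by simp
qed

lemma coeffs_zero_if_many_roots:
  fixes \<alpha> :: "nat \<Rightarrow> complex"
  assumes "m < card T" "\<And>t. t \<in> T \<Longrightarrow> (\<Sum>j\<le>m. \<alpha> j * t ^ j) = \<beta>" "j \<le> m"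
  shows "\<alpha> j = (if j = 0 then \<beta> else 0)"
proof -
  let ?P = "(\<Sum>j\<le>m. monom (\<alpha> j) j) - [:\<beta>:]"
  have "?P = 0"
  proof (rule poly_zero_if_many_roots[OF _ assms(1)])
    show "degree ?P \<le> m"
      by (intro degree_diff_le degree_sum_le order_trans[OF degree_monom_le]) auto
    show "poly ?P t = 0" if "t \<in> T" for t using assms(2)[OF that] by (simp add: poly_sum poly_monom)
  qed
  then have "coeff ?P j = 0" by simp
  then show ?thesis using assms(3) by (auto simp: coeff_sum coeff_monom coeff_pCons split: nat.splits)
qed

text \<open>Used to perturb a germ without changing its jets of order less than \<open>N\<close>.\<close>

lemma iter_cpartial_perturbation:
  assumes "finite I" "polynomial_fun A" "polynomial_fun s" "\<And>i. i \<in> I \<Longrightarrow> polynomial_fun (h i) \<and> h i 0 = 0"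
    and "length is < N"
  shows "iter_cpartial is (\<lambda>x. A x + (\<Sum>i\<in>I. h i x ^ N * s x)) 0 = iter_cpartial is A 0"
  using assms(1,4)
proof (induction I rule: finite_induct)
  case (insert k I)
  have pk: "polynomial_fun (\<lambda>x. h k x ^ N * s x)"
    using insert.prems assms(3) by (intro polynomial_fun_intros) auto
  have pI: "polynomial_fun (\<lambda>x. A x + (\<Sum>i\<in>I. h i x ^ N * s x))"
    using insert.prems assms(2,3) by (intro polynomial_fun_intros) auto
  have "(\<lambda>x. A x + (\<Sum>i\<in>insert k I. h i x ^ N * s x)) =
      (\<lambda>x. (A x + (\<Sum>i\<in>I. h i x ^ N * s x)) + h k x ^ N * s x)"
    using insert.hyps by (auto simp: algebra_simps)
  then show ?case
    using insert iter_cpartial_add[OF pI pk] iter_cpartial_power_mult_eq_0[of "h k" s "is" N] assms(3,5) by simp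
qed simp

lemma has_derivative_power':
  fixes h :: "'a::real_normed_vector \<Rightarrow> complex"
  assumes "(h has_derivative h') (at x)"
  shows "((\<lambda>x. h x ^ j) has_derivative (\<lambda>v. of_nat j * (h' v * h x ^ (j - 1)))) (at x)"
  by (rule has_derivative_eq_rhs[OF has_derivative_power[OF assms]]) (simp add: mult_ac)

section \<open>Perturbing a map with too many sheets\<close>

text \<open>The setting of the contradiction: \<open>A = \<Sum>\<^sub>j a\<^sub>j t\<^sup>j\<close> has degree less than \<open>m1\<close> in \<open>t = x\<^sub>l\<close>, while \<open>m2 > m1\<close>
  points of the axis lie over \<open>(0, 0, Z)\<close> for \<open>Z \<noteq> 0\<close>. The coefficients are split as in
  \<open>quasihomogeneous_expansion\<close>. The proof compares, for \<open>f\<close> and for a perturbation \<open>g\<close>, the directions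
  that are tangent to all sheets at \<open>m2\<close> points with a common image.

  For each \<open>j\<close> for which \<open>a\<^sub>j\<close> has a nonzero linear part at the origin, a variable occurring in it is
  chosen as a \<^emph>\<open>pivot\<close>. Different \<open>j\<close> have pivots of different weight, and \<open>a\<^sub>j\<close> involves no pivot
  heavier than its own. So the equations \<open>da\<^sub>j = 0\<close> are triangular in the pivots, with constant
  diagonal, at every point and not just near the origin.\<close>

locale excess_sheets =
  fixes f :: "complex ^ 'n \<Rightarrow> complex ^ 'n option" and l :: 'n
    and d :: nat and w :: "'n \<Rightarrow> nat" and m1 m2 :: nat and b :: complex
    and a :: "nat \<Rightarrow> complex ^ 'n \<Rightarrow> complex" and \<kappa> :: "nat \<Rightarrow> 'n \<Rightarrow> complex"
    and r :: "nat \<Rightarrow> complex ^ 'n \<Rightarrow> complex"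
  assumes f_Some: "\<And>i x. i \<noteq> l \<Longrightarrow> f x $ Some i = x $ i"
    and wl: "w l > 0" and m1: "m1 > 0" and m12: "m1 < m2"
    and A_sum: "\<And>x. f x $ Some l = (\<Sum>j<m1. a j x * x $ l ^ j)"
    and a_poly: "\<And>j. polynomial_fun (a j)"
    and a_indep: "\<And>j x x'. (\<And>i. i \<noteq> l \<Longrightarrow> x $ i = x' $ i) \<Longrightarrow> a j x = a j x'"
    and a_zero: "\<And>x. a 0 x = 0" and a_0: "\<And>j. j < m1 \<Longrightarrow> a j 0 = 0"
    and a_split: "\<And>j x. j < m1 \<Longrightarrow>
      a j x = (\<Sum>i | i \<noteq> l \<and> w i + j * w l = d. \<kappa> j i * x $ i) + r j x"
    and r_poly: "\<And>j. polynomial_fun (r j)"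
    and r_indep: "\<And>j x x'. (\<And>i. i \<noteq> l \<Longrightarrow> w i + j * w l < d \<Longrightarrow> x $ i = x' $ i) \<Longrightarrow> r j x = r j x'"
    and r_0: "\<And>j. j < m1 \<Longrightarrow> r j 0 = 0"
    and r_deriv: "\<And>j. j < m1 \<Longrightarrow> (r j has_derivative (\<lambda>_. 0)) (at 0)"
    and B_poly: "polynomial_fun (\<lambda>x. f x $ None)"
    and B_axis: "\<And>t. f (axis l t) $ None = b * t ^ m2" and b: "b \<noteq> 0"
begin

definition E :: "nat \<Rightarrow> 'n set" where
  "E j = {i. i \<noteq> l \<and> w i + j * w l = d}"

definition lin :: "nat \<Rightarrow> complex ^ 'n \<Rightarrow> complex" where
  "lin j v = (\<Sum>i\<in>E j. \<kappa> j i * v $ i)"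

definition J :: "nat set" where
  "J = {j. j < m1 \<and> (\<exists>i\<in>E j. \<kappa> j i \<noteq> 0)}"

definition pv :: "nat \<Rightarrow> 'n" where
  "pv j = (SOME i. i \<in> E j \<and> \<kappa> j i \<noteq> 0)"

definition piv :: "'n set" where
  "piv = pv ` J"

lemma a_eq: "j < m1 \<Longrightarrow> a j x = lin j x + r j x"
  by (simp add: a_split lin_def E_def)

lemma E_inj: "j = j'" if "i \<in> E j" "i \<in> E j'" for i j j'
  using that wl by (simp add: E_def) (metis add_left_cancel mult_cancel2 neq0_conv)

lemma finJ: "finite J" by (simp add: J_def)

lemma pv:
  assumes "j \<in> J"
  shows "pv j \<in> E j" "\<kappa> j (pv j) \<noteq> 0"
proof -
  have "\<exists>i. i \<in> E j \<and> \<kappa> j i \<noteq> 0" using assms by (auto simp: J_def)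
  then have "pv j \<in> E j \<and> \<kappa> j (pv j) \<noteq> 0" unfolding pv_def by (rule someI_ex)
  then show "pv j \<in> E j" "\<kappa> j (pv j) \<noteq> 0" by auto
qed

lemma piv_E: "i = pv j" if "i \<in> piv" "i \<in> E j" "j \<in> J" for i j
  using that pv(1) E_inj unfolding piv_def by blast

lemma linear_lin: "linear (lin j)"
  by (rule linearI) (simp_all add: lin_def distrib_left sum.distrib scaleR_sum_right)

lemma lin_axis: "lin j (axis i c) = (if i \<in> E j then \<kappa> j i * c else 0)" for j i c
  by (simp add: lin_def axis_def if_distrib sum.delta cong: if_cong)

text \<open>The triangular system is solved by induction on the weights. The remainder \<open>\<rho>\<close> will be the derivative of
  \<open>r j\<close> when this is applied to a tangent vector, and the value of \<open>r j\<close> when it is applied to a point.\<close>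

lemma eliminate_pivots:
  fixes z :: "complex ^ 'n" and \<rho> :: "nat \<Rightarrow> complex"
  assumes free: "\<And>i. i \<notin> piv \<Longrightarrow> z $ i = 0"
    and eqs: "\<And>j. j \<in> J \<Longrightarrow> lin j z + \<rho> j = 0"
    and low: "\<And>j. j \<in> J \<Longrightarrow> (\<And>i. i \<noteq> l \<Longrightarrow> w i + j * w l < d \<Longrightarrow> z $ i = 0) \<Longrightarrow> \<rho> j = 0"
  shows "z = 0"
proof -
  have "z $ i = 0" for i
  proof (induction "w i" arbitrary: i rule: less_induct)
    case less
    show ?case
    proof (cases "i \<in> piv")
      case True
      then obtain j where j: "j \<in> J" "i = pv j" by (auto simp: piv_def)
      have iE: "i \<in> E j" using pv(1)[OF j(1)] j(2) by simp
      have "z $ i' = 0" if "i' \<noteq> l" "w i' + j * w l < d" for i'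
        using less[of i'] that iE by (simp add: E_def)
      then have "\<rho> j = 0" by (rule low[OF j(1)])
      then have "lin j z = 0" using eqs[OF j(1)] by simp
      moreover have "lin j z = (\<Sum>i'\<in>{i}. \<kappa> j i' * z $ i')"
        unfolding lin_def
      proof (rule sum.mono_neutral_right)
        show "\<forall>i'\<in>E j - {i}. \<kappa> j i' * z $ i' = 0"
          using piv_E[OF _ _ j(1)] free j(2) by auto
      qed (use iE in auto)
      ultimately show ?thesis using pv(2)[OF j(1)] j(2) by simp
    qed (rule free)
  qed
  then show ?thesis by (simp add: Finite_Cartesian_Product.vec_eq_iff)
qed

definition a' :: "nat \<Rightarrow> complex ^ 'n \<Rightarrow> complex ^ 'n \<Rightarrow> complex" where
  "a' j x = frechet_derivative (a j) (at x)"

definition r' :: "nat \<Rightarrow> complex ^ 'n \<Rightarrow> complex ^ 'n \<Rightarrow> complex" where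
  "r' j x = frechet_derivative (r j) (at x)"

lemma lin_der: "(lin j has_derivative lin j) (at x)"
  by (rule bounded_linear_imp_has_derivative, rule linear_conv_bounded_linear[THEN iffD1], rule linear_lin)

lemma a'_eq: "a' j x v = lin j v + r' j x v" if j: "j < m1" for j x v
proof -
  have aj: "a j = (\<lambda>x. lin j x + r j x)" using a_eq[OF j] by (rule ext)
  have "(a j has_derivative (\<lambda>v. lin j v + r' j x v)) (at x)"
    unfolding r'_def aj by (rule has_derivative_add[OF lin_der polynomial_fun_has_derivative[OF r_poly]])
  then show ?thesis unfolding a'_def by (simp add: frechet_derivative_eqI)
qed

lemma a'_base: "a' j x = a' j x'" if "\<And>i. i \<noteq> l \<Longrightarrow> x $ i = x' $ i" for j x x'
  unfolding a'_def
  by (rule derivative_eq_if_independent[OF a_poly, of "- {l}"]) (use that in \<open>auto intro: a_indep\<close>)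

lemma a'_vec: "a' j x v = a' j x v'" if "\<And>i. i \<noteq> l \<Longrightarrow> v $ i = v' $ i" for j x v v'
proof -
  have lin': "linear (a' j x)"
    unfolding a'_def by (rule has_derivative_linear[OF polynomial_fun_has_derivative[OF a_poly]])
  have "a' j x (v - v') = 0" unfolding a'_def
    by (rule derivative_zero_if_independent[OF a_poly, of "- {l}"]) (use that in \<open>auto intro: a_indep\<close>)
  then show ?thesis using linear_diff[OF lin'] by simp
qed

lemma r'_low: "r' j x v = 0" if "\<And>i. i \<noteq> l \<Longrightarrow> w i + j * w l < d \<Longrightarrow> v $ i = 0" for j x v
  unfolding r'_def
  by (rule derivative_zero_if_independent[OF r_poly, of "{i. i \<noteq> l \<and> w i + j * w l < d}"])
    (use that in \<open>auto intro: r_indep\<close>)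

lemma a'_0: "a' j 0 v = lin j v" if "j < m1" for j v
  using a'_eq[OF that] r_deriv[of j] that unfolding r'_def by (simp add: frechet_derivative_eqI)

lemma a_der: "(a j has_derivative a' j x) (at x)" for j x
  unfolding a'_def by (rule polynomial_fun_has_derivative[OF a_poly])

definition A :: "complex ^ 'n \<Rightarrow> complex" where
  "A x = f x $ Some l"

definition B :: "complex ^ 'n \<Rightarrow> complex" where
  "B x = f x $ None"

lemma A_poly: "polynomial_fun A"
  unfolding A_def[abs_def] A_sum by (intro polynomial_fun_intros a_poly)

lemma B_poly': "polynomial_fun B"
  using B_poly by (simp add: B_def[abs_def])

definition B' :: "complex ^ 'n \<Rightarrow> complex ^ 'n \<Rightarrow> complex" where
  "B' x = frechet_derivative B (at x)"

lemma B_der: "(B has_derivative B' x) (at x)"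
  unfolding B'_def by (rule polynomial_fun_has_derivative[OF B_poly'])

lemma A_der:
  "(A has_derivative (\<lambda>v. \<Sum>j<m1. a j x * (of_nat j * (v $ l * x $ l ^ (j - 1))) + a' j x v * x $ l ^ j)) (at x)"
  unfolding A_def[abs_def] A_sum
  by (intro has_derivative_sum has_derivative_mult a_der has_derivative_power'
      bounded_linear_imp_has_derivative[OF bounded_linear_vec_nth])

lemma coord_der: "frechet_derivative (\<lambda>x. x $ i) (at x) v = v $ i"
  for i and x v :: "complex ^ 'n"
  by (simp add: frechet_derivative_eqI[OF bounded_linear_imp_has_derivative[OF bounded_linear_vec_nth]])

lemma all_index: "(\<forall>j. R j) \<longleftrightarrow> R (Some l) \<and> R None \<and> (\<forall>i. i \<noteq> l \<longrightarrow> R (Some i))"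
  for R :: "'n option \<Rightarrow> bool"
  by (metis not_Some_eq)

lemma f_poly: "polynomial_fun (\<lambda>x. f x $ j)"
proof -
  have "\<forall>j. polynomial_fun (\<lambda>x. f x $ j)" unfolding all_index
    using A_poly B_poly by (auto simp: A_def[abs_def] f_Some polynomial_fun_coord)
  then show ?thesis ..
qed

definition Df :: "complex ^ 'n \<Rightarrow> complex ^ 'n \<Rightarrow> complex ^ 'n option" where
  "Df x v = (\<chi> j. frechet_derivative (\<lambda>x. f x $ j) (at x) v)"

lemma Df: "(f has_derivative Df x) (at x)"
  by (rule has_derivative_components) (simp add: Df_def polynomial_fun_has_derivative f_poly)

lemma Df_nth:
  "Df x v $ Some l = (\<Sum>j<m1. a j x * (of_nat j * (v $ l * x $ l ^ (j - 1))) + a' j x v * x $ l ^ j)"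
  "Df x v $ None = B' x v" "i \<noteq> l \<Longrightarrow> Df x v $ Some i = v $ i"
  by (simp_all add: Df_def frechet_derivative_eqI[OF A_der] A_def[abs_def, symmetric] B_def[abs_def, symmetric] B'_def f_Some coord_der)

lemma a_axis: "a j (axis l t) = a j 0"
  by (rule a_indep) (simp add: axis_def)

lemma A_axis: "f (axis l t) $ Some l = 0"
  by (simp add: A_sum a_axis a_0)

lemma A00: "A 0 = 0" and B00: "B 0 = 0"
proof -
  have ax0: "axis l 0 = (0 :: complex ^ 'n)" by (simp add: axis_eq_0_iff)
  show "A 0 = 0" "B 0 = 0"
    using A_axis[of 0, unfolded ax0] B_axis[of 0, unfolded ax0] m12 by (simp_all add: A_def B_def)
qed

lemma f0: "f 0 = 0"
  unfolding Finite_Cartesian_Product.vec_eq_iff all_index using A00 B00 by (simp add: A_def B_def f_Some)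

text \<open>The coordinates that are not pivots, with \<open>x\<^sub>l\<close> standing for the component \<open>B\<close>, parametrize common
  tangent directions of the sheets of \<open>f\<close> along the axis.\<close>

definition Fr :: "(complex ^ 'n) set" where
  "Fr = {v. \<forall>i\<in>piv. v $ i = 0}"

lemma subspace_Fr: "subspace Fr"
  by (auto simp: subspace_def Fr_def)

text \<open>Adjusts the pivots so that the linear parts of all coefficients vanish.\<close>

definition corr :: "complex ^ 'n \<Rightarrow> complex ^ 'n" where
  "corr v = v - (\<Sum>j\<in>J. axis (pv j) (lin j v / \<kappa> j (pv j)))"

lemma corr_free: "corr v $ i = v $ i" if "i \<notin> piv" for v i
proof -
  have "(\<Sum>j\<in>J. axis (pv j) (lin j v / \<kappa> j (pv j)) $ i) = 0"
    by (rule sum.neutral) (use that in \<open>auto simp: axis_def piv_def\<close>)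
  then show ?thesis by (simp add: corr_def)
qed

lemma lin_corr: "lin j (corr v) = 0" if j: "j < m1" for j v
proof -
  have "lin j (corr v) = lin j v - (\<Sum>i\<in>J. lin j (axis (pv i) (lin i v / \<kappa> i (pv i))))"
    unfolding corr_def by (simp add: linear_diff[OF linear_lin] linear_sum[OF linear_lin])
  also have "(\<Sum>i\<in>J. lin j (axis (pv i) (lin i v / \<kappa> i (pv i)))) = (\<Sum>i\<in>J. if i = j then lin j v else 0)"
  proof (rule sum.cong[OF refl])
    fix i assume i: "i \<in> J"
    show "lin j (axis (pv i) (lin i v / \<kappa> i (pv i))) = (if i = j then lin j v else 0)"
      using pv[OF i] E_inj[of "pv i" i j] by (auto simp: lin_axis)
  qed
  also have "\<dots> = (if j \<in> J then lin j v else 0)" using finJ by (simp add: sum.delta)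
  also have "\<dots> = lin j v"
  proof (cases "j \<in> J")
    case False
    then have "\<And>i. i \<in> E j \<Longrightarrow> \<kappa> j i = 0" using j by (auto simp: J_def)
    then show ?thesis using False by (simp add: lin_def)
  qed simp
  finally show ?thesis by simp
qed

definition L :: "complex ^ 'n \<Rightarrow> complex ^ 'n option" where
  "L v = (\<chi> j. case j of None \<Rightarrow> v $ l | Some i \<Rightarrow> if i = l then 0 else corr v $ i)"

lemma L_nth: "L v $ None = v $ l" "L v $ Some l = 0" "i \<noteq> l \<Longrightarrow> L v $ Some i = corr v $ i"
  by (simp_all add: L_def)

lemma corr_add: "corr (u + v) = corr u + corr v" for u v
proof -
  have "axis i (x + y) = axis i x + axis i y" for i :: 'n and x y :: complex
    by (auto simp: Finite_Cartesian_Product.vec_eq_iff axis_def)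
  then show ?thesis by (simp add: corr_def linear_add[OF linear_lin] add_divide_distrib sum.distrib)
qed

lemma corr_scale: "corr (c *\<^sub>R v) = c *\<^sub>R corr v" for c v
proof -
  have "axis i (c *\<^sub>R x) = c *\<^sub>R axis i x" for i :: 'n and x :: complex
    by (auto simp: Finite_Cartesian_Product.vec_eq_iff axis_def)
  then have "axis (pv j) (c *\<^sub>R lin j v / \<kappa> j (pv j)) = c *\<^sub>R axis (pv j) (lin j v / \<kappa> j (pv j))" for j
    by (metis scaleR_conv_of_real times_divide_eq_right)
  then show ?thesis by (simp add: corr_def linear_cmul[OF linear_lin] scaleR_sum_right scaleR_diff_right)
qed

lemma linL: "linear L"
  by (rule linearI; unfold Finite_Cartesian_Product.vec_eq_iff all_index)
    (auto simp: L_nth corr_add corr_scale)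

lemma injL: "inj_on L (span Fr)"
proof -
  have "u = v" if "u \<in> Fr" "v \<in> Fr" "L u = L v" for u v
    unfolding Finite_Cartesian_Product.vec_eq_iff
  proof
    fix i
    show "u $ i = v $ i"
    proof (cases "i \<in> piv")
      case False
      show ?thesis
      proof (cases "i = l")
        case True
        then show ?thesis using L_nth(1)[of u] L_nth(1)[of v] that(3) by simp
      next
        case nl: False
        then show ?thesis using L_nth(3)[OF nl, of u] L_nth(3)[OF nl, of v] that(3) corr_free[OF False] by simp
      qed
    qed (use that in \<open>auto simp: Fr_def\<close>)
  qed
  then show ?thesis using subspace_Fr by (auto simp: inj_on_def span_eq_iff[THEN iffD2])
qed

text \<open>Along the axis the derivative of \<open>A\<close> is \<open>\<Sum>\<^sub>j da\<^sub>j (0) t\<^sup>j\<close>, which vanishes on the adjusted vectors for every \<open>t\<close>;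
  as \<open>B\<close> is submersive in \<open>t\<close>, its derivative can be prescribed.\<close>

lemma common_tangent_space_on_axis:
  assumes t: "t \<noteq> 0"
  shows "L ` Fr \<subseteq> range (Df (axis l t))"
proof
  fix y assume "y \<in> L ` Fr"
  then obtain v where v: "y = L v" by blast
  let ?x = "axis l t :: complex ^ 'n"
  obtain D where D: "(B has_derivative D) (at ?x)" "\<And>c v. D (c *s v) = c * D v"
    using polynomial_fun_has_clinear_derivative[OF B_poly', of ?x] by blast
  have BD: "B' ?x = D" unfolding B'_def by (rule frechet_derivative_eqI[OF D(1)])
  have "((\<lambda>s. B (?x + s *s axis l 1)) has_field_derivative D (axis l 1)) (at 0)"
    by (rule clinear_derivative_along_line) (use D in auto)
  moreover have "?x + s *s axis l 1 = axis l (t + s)" for s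
    by (auto simp: Finite_Cartesian_Product.vec_eq_iff axis_def)
  ultimately have "((\<lambda>s. b * (t + s) ^ m2) has_field_derivative D (axis l 1)) (at 0)"
    by (simp add: B_def B_axis)
  moreover have "((\<lambda>s. b * (t + s) ^ m2) has_field_derivative b * (of_nat m2 * t ^ (m2 - 1))) (at 0)"
    by (auto intro!: derivative_eq_intros)
  ultimately have "D (axis l 1) = b * (of_nat m2 * t ^ (m2 - 1))" by (rule DERIV_unique)
  then have Dl: "D (axis l 1) \<noteq> 0" using b m12 t by simp
  \<comment> \<open>The last coordinate of a preimage of \<open>L v\<close> is chosen to give the right derivative of \<open>B\<close>.\<close>
  define u0 where "u0 = upd l (corr v) 0"
  define s where "s = (v $ l - D u0) / D (axis l 1)"
  define u where "u = u0 + s *s axis l 1"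
  have u_nth: "u $ i = corr v $ i" if "i \<noteq> l" for i using that by (simp add: u_def u0_def upd_nth axis_def)
  have "D u = D u0 + s * D (axis l 1)"
    unfolding u_def using linear_add[OF has_derivative_linear[OF D(1)]] D(2) by simp
  also have "\<dots> = v $ l" using Dl by (simp add: s_def)
  finally have Du: "D u = v $ l" .
  have "Df ?x u $ Some l = 0"
    unfolding Df_nth
  proof (rule sum.neutral, rule ballI)
    fix j assume "j \<in> {..<m1}"
    then have j: "j < m1" by simp
    have "a' j ?x u = a' j 0 (corr v)"
      using a'_base[of ?x 0 j] a'_vec[of u "corr v" j ?x] u_nth by (simp add: axis_def)
    then have "a' j ?x u = 0" using a'_0[OF j] lin_corr[OF j] by simp
    moreover have "a j ?x = 0" using a_axis a_0[OF j] by simp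
    ultimately show "a j ?x * (of_nat j * (u $ l * ?x $ l ^ (j - 1))) + a' j ?x u * ?x $ l ^ j = 0" by simp
  qed
  then have "Df ?x u = L v"
    unfolding Finite_Cartesian_Product.vec_eq_iff all_index
    by (simp add: L_nth Df_nth(2,3) BD Du u_nth)
  then show "y \<in> range (Df ?x)" using v by (metis rangeI)
qed


lemma f_configurations:
  assumes \<epsilon>: "\<epsilon> > 0"
  shows "\<exists>T y S. card T = m2 \<and> T \<subseteq> ball 0 \<epsilon> \<and> (\<forall>x\<in>T. f x = y) \<and>
    subspace S \<and> dim S = dim Fr \<and> (\<forall>x\<in>T. S \<subseteq> range (Df x))"
proof -
  define s where "s = complex_of_real (\<epsilon> / 2)"
  define T where "T = axis l ` {t. t ^ m2 = s ^ m2}"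
  have s: "s \<noteq> 0" "norm s < \<epsilon>" using \<epsilon> by (auto simp: s_def)
  have "inj (axis l :: complex \<Rightarrow> complex ^ 'n)" by (rule injI) (auto simp: axis_eq_axis)
  then have "card T = card {t. t ^ m2 = s ^ m2}"
    unfolding T_def by (intro card_image) (auto intro: inj_on_subset)
  also have "\<dots> = m2" by (rule card_nth_roots) (use s m12 in auto)
  finally have "card T = m2" .
  moreover have "T \<subseteq> ball 0 \<epsilon>"
  proof
    fix x assume "x \<in> T"
    then obtain t where t: "x = axis l t" "t ^ m2 = s ^ m2" by (auto simp: T_def)
    have "norm t ^ m2 = norm s ^ m2" using t(2) by (metis norm_power)
    then have "norm t = norm s" by (rule power_eq_imp_eq_base) (use m12 in auto)
    then show "x \<in> ball 0 \<epsilon>" using s t(1) by (simp add: norm_axis_complex)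
  qed
  moreover have "f x = (\<chi> o'. if o' = None then b * s ^ m2 else 0)" if xT: "x \<in> T" for x
  proof -
    obtain t where t: "x = axis l t" "t ^ m2 = s ^ m2" using xT by (auto simp: T_def)
    show ?thesis unfolding Finite_Cartesian_Product.vec_eq_iff all_index
      using t A_axis[of t] B_axis[of t] by (simp add: f_Some axis_def)
  qed
  moreover have "L ` Fr \<subseteq> range (Df x)" if xT: "x \<in> T" for x
  proof -
    obtain t where t: "x = axis l t" "t ^ m2 = s ^ m2" using xT by (auto simp: T_def)
    have "t \<noteq> 0" using t(2) s(1) m12 by (auto simp: power_0_left)
    then show ?thesis using common_tangent_space_on_axis t(1) by blast
  qed
  moreover have "subspace (L ` Fr)" by (rule linear_subspace_image[OF linL subspace_Fr])
  moreover have "dim (L ` Fr) = dim Fr" by (rule dim_image_eq[OF linL injL])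
  ultimately show ?thesis by blast
qed

text \<open>The coordinates \<open>(x', B)\<close>, with \<open>B\<close> in the place of \<open>x\<^sub>l\<close>; they depend on the image of \<open>x\<close> only.\<close>

definition \<eta> :: "complex ^ 'n \<Rightarrow> complex ^ 'n" where
  "\<eta> x = upd l x (B x)"

text \<open>A function of \<open>\<eta>\<close> whose differential vanishes only where all coordinates that are not pivots are zero.
  Multiplied by \<open>t\<close> to the \<open>m1\<close>, a power that does not occur in \<open>A\<close>, it gives the perturbation.\<close>

definition \<epsilon> :: "nat \<Rightarrow> complex ^ 'n \<Rightarrow> complex" where
  "\<epsilon> N x = (\<Sum>i\<in>-piv. \<eta> x $ i ^ N)"

definition gA :: "nat \<Rightarrow> complex ^ 'n \<Rightarrow> complex" where
  "gA N x = A x + \<epsilon> N x * x $ l ^ m1"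

definition g :: "nat \<Rightarrow> complex ^ 'n \<Rightarrow> complex ^ 'n option" where
  "g N x = upd (Some l) (f x) (gA N x)"

lemma \<eta>_poly: "polynomial_fun (\<lambda>x. \<eta> x $ i)" for i
  by (cases "i = l") (simp_all add: \<eta>_def upd_nth B_poly' polynomial_fun_coord)

lemma \<eta>0: "\<eta> 0 $ i = 0" for i by (simp add: \<eta>_def upd_nth B00)

lemma \<epsilon>_poly: "polynomial_fun (\<epsilon> N)" unfolding \<epsilon>_def[abs_def] by (intro polynomial_fun_intros \<eta>_poly)

lemma gA_poly: "polynomial_fun (gA N)"
  unfolding gA_def[abs_def] by (intro polynomial_fun_intros \<epsilon>_poly A_poly)

lemma g_nth: "g N x $ Some l = gA N x" "g N x $ None = B x" "i \<noteq> l \<Longrightarrow> g N x $ Some i = x $ i" for x i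
  by (simp_all add: g_def upd_nth B_def f_Some)

lemma g_poly: "polynomial_fun (\<lambda>x. g N x $ j)" for j
proof -
  have "\<forall>j. polynomial_fun (\<lambda>x. g N x $ j)" unfolding all_index
    using gA_poly B_poly' by (auto simp: g_nth polynomial_fun_coord)
  then show ?thesis ..
qed

definition Dg :: "nat \<Rightarrow> complex ^ 'n \<Rightarrow> complex ^ 'n \<Rightarrow> complex ^ 'n option" where
  "Dg N x v = (\<chi> j. frechet_derivative (\<lambda>x. g N x $ j) (at x) v)"

lemma Dg: "(g N has_derivative Dg N x) (at x)"
  by (rule has_derivative_components) (simp add: Dg_def polynomial_fun_has_derivative g_poly)

lemma g_holo_map_germ: "holo_map_germ (g N)"
proof -
  have "gA N 0 = 0" using A00 m1 by (simp add: gA_def)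
  then have "g N 0 = 0" unfolding Finite_Cartesian_Product.vec_eq_iff all_index
    by (simp add: g_nth B00)
  then show ?thesis unfolding holo_map_germ_def using g_poly polynomial_fun_holo_germ by blast
qed

lemma g_same_jet:
  assumes "k < N"
  shows "same_jet k f (g N)"
proof -
  have "iter_cpartial is A 0 = iter_cpartial is (gA N) 0" if "length is \<le> k" for "is"
  proof -
    have "gA N = (\<lambda>x. A x + (\<Sum>i\<in>-piv. \<eta> x $ i ^ N * x $ l ^ m1))"
      by (simp add: fun_eq_iff gA_def \<epsilon>_def sum_distrib_right)
    then show ?thesis
      using iter_cpartial_perturbation[of "-piv" A "\<lambda>x. x $ l ^ m1" "\<lambda>i x. \<eta> x $ i" "is" N] that assms
      by (simp add: A_poly \<eta>_poly \<eta>0 polynomial_fun_intros)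
  qed
  then show ?thesis unfolding same_jet_def all_index
    by (simp add: g_nth f_Some A_def[abs_def, symmetric] B_def[abs_def, symmetric])
qed

text \<open>The target vector without its component \<open>A\<close>, in the coordinates of \<open>\<eta>\<close>.\<close>

definition tilde :: "complex ^ 'n option \<Rightarrow> complex ^ 'n" where
  "tilde v = (\<chi> i. if i = l then v $ None else v $ Some i)"

lemma tilde_nth: "tilde v $ i = (if i = l then v $ None else v $ Some i)"
  by (simp add: tilde_def)

text \<open>At \<open>m2\<close> points with a common image the perturbed component is a polynomial of degree at most \<open>m1 < m2\<close> in
  \<open>t\<close>, with the same coefficients at all of them, and so is its derivative in a common tangent direction.
  Both are therefore constant: \<open>a\<^sub>j = \<epsilon> = 0\<close> at these points, and \<open>da\<^sub>j = d\<epsilon> = 0\<close> in these directions. If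
  the common directions had the same dimension as for \<open>f\<close>, their coordinates that are not pivots would
  be arbitrary, which forces \<open>d\<epsilon> = 0\<close>; so these coordinates of the points are zero, and by
  \<open>a\<^sub>j = 0\<close> the pivots are zero too. But only one point of the axis lies over the origin.\<close>

lemma g_no_configuration:
  assumes N: "N > 0"
    and T: "card T = m2" "\<And>x. x \<in> T \<Longrightarrow> g N x = y"
    and S: "subspace S" "dim S = dim Fr" "\<And>x. x \<in> T \<Longrightarrow> S \<subseteq> range (Dg N x)"
  shows False
proof -
  define z where "z = tilde y"
  have T_nth: "x $ i = y $ Some i" if "x \<in> T" "i \<noteq> l" for x i using T(2)[OF that(1)] g_nth(3)[OF that(2)] by metis
  have \<eta>_T: "\<eta> x = z" if "x \<in> T" for x
    using T_nth[OF that] T(2)[OF that] g_nth(2)[where N = N and x = x]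
    by (auto simp: Finite_Cartesian_Product.vec_eq_iff \<eta>_def upd_nth z_def tilde_nth)
  have a_T: "a j x = a j z" if "x \<in> T" for x j
    by (rule a_indep) (simp add: T_nth[OF that] z_def tilde_nth)
  define \<epsilon>z where "\<epsilon>z = (\<Sum>i\<in>-piv. z $ i ^ N)"
  have \<epsilon>_T: "\<epsilon> N x = \<epsilon>z" if "x \<in> T" for x by (simp add: \<epsilon>_def \<epsilon>z_def \<eta>_T[OF that])
  define T' where "T' = (\<lambda>x. x $ l) ` T"
  have "inj_on (\<lambda>x. x $ l) T"
  proof (rule inj_onI)
    fix x x' assume *: "x \<in> T" "x' \<in> T" "x $ l = x' $ l"
    show "x = x'" unfolding Finite_Cartesian_Product.vec_eq_iff using * T_nth by metis
  qed
  then have T': "m1 < card T'" using T(1) m12 by (simp add: T'_def card_image)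

  \<comment> \<open>The perturbed component is constant on the \<open>m2 > m1\<close> points, hence a constant polynomial in \<open>t\<close>.\<close>
  let ?\<alpha> = "\<lambda>j. if j = m1 then \<epsilon>z else a j z"
  have "(\<Sum>j\<le>m1. ?\<alpha> j * t ^ j) = y $ Some l" if t: "t \<in> T'" for t
  proof -
    obtain x where x: "x \<in> T" "t = x $ l" using t by (auto simp: T'_def)
    have "gA N x = y $ Some l" using T(2)[OF x(1)] g_nth(1)[where N = N and x = x] by simp
    then show ?thesis
      by (simp add: gA_def A_def A_sum a_T[OF x(1)] \<epsilon>_T[OF x(1)] x(2) lessThan_Suc_atMost[symmetric])
  qed
  note zero = coeffs_zero_if_many_roots[OF T' this]
  have az: "a j z = 0" if "j < m1" for j using zero[of j] a_zero that by (cases "j = 0") auto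
  have \<epsilon>z0: "\<epsilon>z = 0" using zero[of m1] m1 by simp

  \<comment> \<open>The same for its derivative; the terms with the derivative of \<open>t\<close> drop out because \<open>a j\<close> and \<open>\<epsilon>\<close> vanish.\<close>
  have S_eq: "v $ Some l = 0 \<and> (\<forall>j<m1. a' j z (tilde v) = 0) \<and>
      (\<Sum>i\<in>-piv. of_nat N * (tilde v $ i * z $ i ^ (N - 1))) = 0" if v: "v \<in> S" for v
  proof -
    let ?\<delta> = "\<Sum>i\<in>-piv. of_nat N * (tilde v $ i * z $ i ^ (N - 1))"
    let ?\<beta> = "\<lambda>j. if j = m1 then ?\<delta> else a' j z (tilde v)"
    have "(\<Sum>j\<le>m1. ?\<beta> j * t ^ j) = v $ Some l" if t: "t \<in> T'" for t
    proof -
      obtain x where x: "x \<in> T" "t = x $ l" using t by (auto simp: T'_def)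
      obtain u where u: "Dg N x u = v" using S(3)[OF x(1)] v by blast
      have u_nth: "u $ i = v $ Some i" if "i \<noteq> l" for i
      proof -
        have "Dg N x u $ Some i = u $ i" using that by (simp add: Dg_def g_nth coord_der)
        then show ?thesis using u by simp
      qed
      have B'u: "B' x u = v $ None"
      proof -
        have "Dg N x u $ None = B' x u" by (simp add: Dg_def g_nth B'_def)
        then show ?thesis using u by simp
      qed
      have \<eta>_der: "((\<lambda>x. \<eta> x $ i) has_derivative (\<lambda>u. if i = l then B' x u else u $ i)) (at x)" for i
        using B_der[of x] bounded_linear_imp_has_derivative[OF bounded_linear_vec_nth[of i]]
        by (cases "i = l") (simp_all add: \<eta>_def upd_nth)
      have "(\<epsilon> N has_derivative (\<lambda>u. \<Sum>i\<in>-piv. of_nat N * ((if i = l then B' x u else u $ i) * \<eta> x $ i ^ (N - 1)))) (at x)"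
        unfolding \<epsilon>_def[abs_def] by (intro has_derivative_sum has_derivative_power' \<eta>_der)
      then have "(gA N has_derivative (\<lambda>u. (\<Sum>j<m1. a j x * (of_nat j * (u $ l * x $ l ^ (j - 1))) + a' j x u * x $ l ^ j)
          + (\<epsilon> N x * (of_nat m1 * (u $ l * x $ l ^ (m1 - 1)))
          + (\<Sum>i\<in>-piv. of_nat N * ((if i = l then B' x u else u $ i) * \<eta> x $ i ^ (N - 1))) * x $ l ^ m1))) (at x)"
        unfolding gA_def[abs_def]
        by (intro has_derivative_add A_der has_derivative_mult has_derivative_power'
            bounded_linear_imp_has_derivative[OF bounded_linear_vec_nth])
      then have "frechet_derivative (gA N) (at x) u = (\<Sum>j<m1. a j x * (of_nat j * (u $ l * x $ l ^ (j - 1))) + a' j x u * x $ l ^ j)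
          + (\<epsilon> N x * (of_nat m1 * (u $ l * x $ l ^ (m1 - 1)))
          + (\<Sum>i\<in>-piv. of_nat N * ((if i = l then B' x u else u $ i) * \<eta> x $ i ^ (N - 1))) * x $ l ^ m1)"
        by (simp add: frechet_derivative_eqI)
      also have "(\<Sum>i\<in>-piv. of_nat N * ((if i = l then B' x u else u $ i) * \<eta> x $ i ^ (N - 1))) = ?\<delta>"
        by (intro sum.cong refl) (simp add: \<eta>_T[OF x(1)] tilde_nth B'u u_nth)
      also have "(\<Sum>j<m1. a j x * (of_nat j * (u $ l * x $ l ^ (j - 1))) + a' j x u * x $ l ^ j)
          = (\<Sum>j<m1. a' j z (tilde v) * t ^ j)"
      proof (rule sum.cong[OF refl])
        fix j assume "j \<in> {..<m1}"
        then have "a j x = 0" using az a_T[OF x(1)] by simp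
        moreover have "a' j x u = a' j z (tilde v)"
        proof -
          have "a' j x = a' j z" by (rule a'_base) (simp add: T_nth[OF x(1)] z_def tilde_nth)
          moreover have "a' j z u = a' j z (tilde v)" by (rule a'_vec) (simp add: u_nth tilde_nth)
          ultimately show ?thesis by simp
        qed
        ultimately show "a j x * (of_nat j * (u $ l * x $ l ^ (j - 1))) + a' j x u * x $ l ^ j = a' j z (tilde v) * t ^ j"
          by (simp add: x(2))
      qed
      also have "\<epsilon> N x = 0" using \<epsilon>_T[OF x(1)] \<epsilon>z0 by simp
      finally have "frechet_derivative (gA N) (at x) u = (\<Sum>j\<le>m1. ?\<beta> j * t ^ j)"
        by (simp add: x(2) lessThan_Suc_atMost[symmetric])
      moreover have "frechet_derivative (gA N) (at x) u = v $ Some l"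
      proof -
        have "Dg N x u $ Some l = frechet_derivative (gA N) (at x) u" by (simp add: Dg_def g_nth)
        then show ?thesis using u by simp
      qed
      ultimately show ?thesis by simp
    qed
    note zero' = coeffs_zero_if_many_roots[OF T' this]
    have "a' 0 z (tilde v) = 0"
    proof -
      have "a 0 = (\<lambda>_. 0)" using a_zero by (rule ext)
      then show ?thesis unfolding a'_def by simp
    qed
    then have vl: "v $ Some l = 0" using zero'[of 0] m1 by simp
    have "a' j z (tilde v) = 0" if "j < m1" for j
      using zero'[of j] that vl by (auto split: if_splits)
    moreover have "?\<delta> = 0" using zero'[of m1] m1 by simp
    ultimately show ?thesis using vl by blast
  qed

  define Pr where "Pr = (\<lambda>v. \<chi> i. if i \<in> piv then 0 else tilde v $ i)"
  have linPr: "linear Pr"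
    by (rule linearI) (auto simp: Pr_def Finite_Cartesian_Product.vec_eq_iff tilde_nth)
  have Pr_inj: "v = 0" if v: "v \<in> S" "Pr v = 0" for v
  proof -
    have "tilde v = 0"
    proof (rule eliminate_pivots[where \<rho> = "\<lambda>j. r' j z (tilde v)"])
      show "tilde v $ i = 0" if "i \<notin> piv" for i
        using arg_cong[OF v(2), of "\<lambda>x. x $ i"] that by (simp add: Pr_def)
      show "lin j (tilde v) + r' j z (tilde v) = 0" if "j \<in> J" for j
        using S_eq[OF v(1)] a'_eq[of j z "tilde v"] that by (simp add: J_def)
    qed (rule r'_low)
    then have "tilde v $ i = 0" for i by simp
    then have "v $ None = 0" "i \<noteq> l \<Longrightarrow> v $ Some i = 0" for i by (metis tilde_nth)+
    then show "v = 0" unfolding Finite_Cartesian_Product.vec_eq_iff all_index using S_eq[OF v(1)] by simp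
  qed
  have "inj_on Pr (span S)"
    unfolding linear_inj_on_span_iff_independent_image linear_injective_on_subspace_0[OF linPr subspace_span]
    using Pr_inj S(1) by (simp add: span_eq_iff[THEN iffD2])
  then have "dim (Pr ` S) = dim Fr" using dim_image_eq[OF linPr] S(2) by simp
  moreover have "subspace (Pr ` S)" by (rule linear_subspace_image[OF linPr S(1)])
  moreover have "Pr ` S \<subseteq> Fr" by (auto simp: Pr_def Fr_def)
  ultimately have onto: "Pr ` S = Fr" using subspace_Fr by (intro subspace_dim_equal) auto

  \<comment> \<open>The direction along which \<open>d\<epsilon>\<close> is a sum of squares of absolute values.\<close>
  define e :: "complex ^ 'n" where "e = (\<chi> i. if i \<in> piv then 0 else cnj (z $ i ^ (N - 1)))"
  have "e \<in> Fr" by (simp add: e_def Fr_def)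
  then have "e \<in> Pr ` S" by (simp only: onto)
  then obtain v where v: "v \<in> S" "Pr v = e" by (elim imageE) (rule that, simp_all)
  have "tilde v $ i = cnj (z $ i ^ (N - 1))" if "i \<notin> piv" for i
    using arg_cong[OF v(2), of "\<lambda>x. x $ i"] that by (simp add: Pr_def e_def)
  then have "(\<Sum>i\<in>-piv. of_nat N * (cnj (z $ i ^ (N - 1)) * z $ i ^ (N - 1))) = 0"
    using S_eq[OF v(1)] by simp
  then have "of_real (\<Sum>i\<in>-piv. of_nat N * (norm (z $ i ^ (N - 1)))\<^sup>2) = (0 :: complex)"
    by (simp add: complex_norm_square[symmetric] mult.commute[of "cnj _"] del: complex_cnj_power)
  then have "(\<Sum>i\<in>-piv. of_nat N * (norm (z $ i ^ (N - 1)))\<^sup>2) = 0"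
    by (simp only: of_real_eq_0_iff)
  then have "\<forall>i\<in>-piv. of_nat N * (norm (z $ i ^ (N - 1)))\<^sup>2 = 0"
    by (subst (asm) sum_nonneg_eq_0_iff) auto
  then have z_free: "z $ i = 0" if "i \<notin> piv" for i using that N by auto
  have "z = 0"
  proof (rule eliminate_pivots[where \<rho> = "\<lambda>j. r j z"])
    show "lin j z + r j z = 0" if "j \<in> J" for j using az[of j] a_eq[of j z] that by (simp add: J_def)
    show "r j z = 0" if "j \<in> J" "\<And>i. i \<noteq> l \<Longrightarrow> w i + j * w l < d \<Longrightarrow> z $ i = 0" for j
    proof -
      have "r j z = r j 0" by (rule r_indep) (simp add: that(2))
      then show ?thesis using r_0[of j] that(1) by (simp add: J_def)
    qed
  qed (rule z_free)
  have "T' \<subseteq> {0}"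
  proof
    fix t assume "t \<in> T'"
    then obtain x where x: "x \<in> T" "t = x $ l" by (auto simp: T'_def)
    have \<eta>x: "\<eta> x = 0" using \<eta>_T[OF x(1)] \<open>z = 0\<close> by simp
    have "x $ i = 0" if "i \<noteq> l" for i using arg_cong[OF \<eta>x, of "\<lambda>x. x $ i"] that by (simp add: \<eta>_def upd_nth)
    then have "x = axis l t" using x(2) by (auto simp: Finite_Cartesian_Product.vec_eq_iff axis_def)
    moreover have "B x = 0" using arg_cong[OF \<eta>x, of "\<lambda>x. x $ l"] by (simp add: \<eta>_def upd_nth)
    ultimately have "b * t ^ m2 = 0" using B_axis[of t] by (simp add: B_def)
    then show "t \<in> {0}" using b by simp
  qed
  then have "card T' \<le> 1" using card_mono[of "{0::complex}" T'] by simp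
  then show False using T' m1 by simp
qed

lemma not_finitely_determined: "\<not> finitely_determined f"
proof
  assume "finitely_determined f"
  then obtain k where k: "\<And>g. holo_map_germ g \<Longrightarrow> same_jet k f g \<Longrightarrow> A_equivalent f g"
    unfolding finitely_determined_def by blast
  have "A_equivalent f (g (Suc k))" by (rule k[OF g_holo_map_germ g_same_jet]) simp
  then have "\<exists>T y S. card T = m2 \<and> (\<forall>x\<in>T. g (Suc k) x = y) \<and> subspace S \<and> dim S = dim Fr \<and>
      (\<forall>x\<in>T. S \<subseteq> range (Dg (Suc k) x))"
    by (rule A_equivalent_common_tangent_space[OF _ Df Dg f0 _ f_configurations]) (use m12 in simp)
  then obtain T y S where "card T = m2" "\<forall>x\<in>T. g (Suc k) x = y" "subspace S" "dim S = dim Fr"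
    "\<forall>x\<in>T. S \<subseteq> range (Dg (Suc k) x)"
    by (elim exE conjE) (rule that)
  then show False using g_no_configuration[of "Suc k" T y S] by auto
qed

end

text \<open>The top coefficient of \<open>A\<close> is constant by its weighted degree, and it vanishes together with \<open>A\<close> on the
  axis; all exponents of \<open>t\<close> in \<open>A\<close> are therefore less than \<open>m1\<close>.\<close>

lemma not_finitely_determined_if_leading_term_vanishes:
  fixes f :: "complex ^ 'n \<Rightarrow> complex ^ 'n option" and l :: 'n
  assumes f_Some: "\<And>i x. i \<noteq> l \<Longrightarrow> f x $ Some i = x $ i"
    and qh: "quasihomogeneous d w (\<lambda>x. f x $ Some l)" and d: "d = m1 * w l" and m1: "m1 > 0"
    and A_0: "\<And>x. x $ l = 0 \<Longrightarrow> f x $ Some l = 0"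
    and A_axis: "\<And>t. f (axis l t) $ Some l = 0"
    and B_poly: "polynomial_fun (\<lambda>x. f x $ None)"
    and B_axis: "\<And>t. f (axis l t) $ None = b * t ^ m2" and b: "b \<noteq> 0" and m12: "m1 < m2"
  shows "\<not> finitely_determined f"
proof -
  define A where "A = (\<lambda>x. f x $ Some l)"
  have wl: "w l > 0" using qh unfolding quasihomogeneous_def by blast
  obtain a \<kappa> r where
        a_poly: "\<And>j. polynomial_fun (a j)"
    and a_indep: "\<And>j x x'. (\<And>i. i \<noteq> l \<Longrightarrow> x $ i = x' $ i) \<Longrightarrow> a j x = a j x'"
    and A_exp: "\<And>x. A x = (\<Sum>j\<le>d. a j x * x $ l ^ j)"
    and a_high: "\<And>j x. d < j * w l \<Longrightarrow> a j x = 0"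
    and a_const: "\<And>j x. j * w l = d \<Longrightarrow> a j x = a j 0"
    and a_0: "\<And>j. j * w l \<noteq> d \<Longrightarrow> a j 0 = 0"
    and a_low: "\<And>j x. j * w l < d \<Longrightarrow> a j x = (\<Sum>i | i \<noteq> l \<and> w i + j * w l = d. \<kappa> j i * x $ i) + r j x"
    and r_poly: "\<And>j. polynomial_fun (r j)"
    and r_indep: "\<And>j x x'. (\<And>i. i \<noteq> l \<Longrightarrow> w i + j * w l < d \<Longrightarrow> x $ i = x' $ i) \<Longrightarrow> r j x = r j x'"
    and r_0: "\<And>j. j * w l < d \<Longrightarrow> r j 0 = 0"
    and r_deriv: "\<And>j. j * w l < d \<Longrightarrow> (r j has_derivative (\<lambda>_. 0)) (at 0)"
    using quasihomogeneous_expansion[OF qh, of l] unfolding A_def by blast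
  have lt_iff: "j * w l < d \<longleftrightarrow> j < m1" for j using wl d by simp
  have a_axis: "a j (axis l t) = a j 0" for j t by (rule a_indep) (simp add: axis_def)
  have a_top: "a m1 x = 0" for x
  proof -
    have "0 = (\<Sum>j\<le>d. a j 0 * 1 ^ j)" using A_exp[of "axis l 1"] A_axis[of 1] by (simp add: A_def a_axis)
    also have "\<dots> = (\<Sum>j\<in>{m1}. a j 0 * 1 ^ j)"
    proof (rule sum.mono_neutral_right)
      show "{m1} \<subseteq> {..d}" using d wl by (cases "w l") auto
      show "\<forall>j\<in>{..d} - {m1}. a j 0 * 1 ^ j = 0" using a_0 wl by (auto simp: d)
    qed simp
    finally show ?thesis using a_const[of m1 x] d by simp
  qed
  have A_sum: "A x = (\<Sum>j<m1. a j x * x $ l ^ j)" for x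
    unfolding A_exp
  proof (rule sum.mono_neutral_right)
    show "{..<m1} \<subseteq> {..d}" using d wl by (cases "w l") auto
    show "\<forall>j\<in>{..d} - {..<m1}. a j x * x $ l ^ j = 0"
    proof
      fix j assume "j \<in> {..d} - {..<m1}"
      then have "j = m1 \<or> d < j * w l" using wl d by auto
      then show "a j x * x $ l ^ j = 0" using a_top a_high by auto
    qed
  qed simp
  have a_zero: "a 0 x = 0" for x
  proof -
    have "A (upd l x 0) = 0" unfolding A_def by (rule A_0) (simp add: upd_nth)
    moreover have "A (upd l x 0) = a 0 (upd l x 0)"
      unfolding A_sum using m1 by (simp add: upd_nth power_0_left if_distrib sum.delta cong: if_cong)
    moreover have "a 0 (upd l x 0) = a 0 x" by (rule a_indep) (simp add: upd_nth)
    ultimately show ?thesis by simp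
  qed
  interpret excess_sheets f l d w m1 m2 b a \<kappa> r
  proof unfold_locales
    show "f x $ Some l = (\<Sum>j<m1. a j x * x $ l ^ j)" for x using A_sum[of x] by (simp add: A_def)
    show "a j 0 = 0" if "j < m1" for j using a_0[of j] that wl d by simp
    show "a j x = (\<Sum>i | i \<noteq> l \<and> w i + j * w l = d. \<kappa> j i * x $ i) + r j x" if "j < m1" for j x
      using a_low[of j x] that by (simp only: lt_iff)
    show "r j 0 = 0" "(r j has_derivative (\<lambda>_. 0)) (at 0)" if "j < m1" for j
      using r_0[of j] r_deriv[of j] that by (simp_all only: lt_iff)
  qed (fact f_Some wl m1 m12 a_poly a_indep a_zero r_poly r_indep B_poly B_axis b)+
  show ?thesis by (rule not_finitely_determined)
qed

section \<open>The multiplicity of the image\<close>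

lemma quasihomogeneous_coefficients:
  fixes P :: "complex ^ 'n \<Rightarrow> complex" and l :: 'n
  assumes "quasihomogeneous d w P"
  shows "\<exists>a. (\<forall>j. polynomial_fun (a j)) \<and>
    (\<forall>j x x'. (\<forall>i. i \<noteq> l \<longrightarrow> x $ i = x' $ i) \<longrightarrow> a j x = a j x') \<and>
    (\<forall>x. P x = (\<Sum>j\<le>d. a j x * x $ l ^ j)) \<and>
    (\<forall>j x. d < j * w l \<longrightarrow> a j x = 0) \<and> (\<forall>j x. j * w l = d \<longrightarrow> a j x = a j 0) \<and>
    (\<forall>j. j * w l \<noteq> d \<longrightarrow> a j 0 = 0)"
proof (rule quasihomogeneous_expansion[OF assms, of l])
  fix a :: "nat \<Rightarrow> complex ^ 'n \<Rightarrow> complex"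
  assume "\<And>j. polynomial_fun (a j)"
    and "\<And>j x x'. (\<And>i. i \<noteq> l \<Longrightarrow> x $ i = x' $ i) \<Longrightarrow> a j x = a j x'"
    and "\<And>x. P x = (\<Sum>j\<le>d. a j x * x $ l ^ j)" and "\<And>j x. d < j * w l \<Longrightarrow> a j x = 0"
    and "\<And>j x. j * w l = d \<Longrightarrow> a j x = a j 0" and "\<And>j. j * w l \<noteq> d \<Longrightarrow> a j 0 = 0"
  then show ?thesis by (intro exI[of _ a] conjI allI impI) metis+
qed

lemma quasihomogeneous_on_axis:
  fixes P :: "complex ^ 'n \<Rightarrow> complex"
  assumes "quasihomogeneous d w P"
  shows "P (axis l t) = (if w l dvd d then P (axis l 1) * t ^ (d div w l) else 0)"
proof -
  have wl: "w l > 0" using assms unfolding quasihomogeneous_def by blast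
  obtain a where a: "\<forall>j x x'. (\<forall>i. i \<noteq> l \<longrightarrow> x $ i = x' $ i) \<longrightarrow> a j x = (a j x' :: complex)"
    "\<forall>x. P x = (\<Sum>j\<le>d. a j x * x $ l ^ j)" "\<forall>j. j * w l \<noteq> d \<longrightarrow> a j 0 = 0"
    using quasihomogeneous_coefficients[OF assms, of l] by blast
  have a_indep: "a j x = a j x'" if "\<And>i. i \<noteq> l \<Longrightarrow> x $ i = x' $ i" for j x x' using a(1) that by blast
  have P: "P x = (\<Sum>j\<le>d. a j x * x $ l ^ j)" for x using a(2) ..
  have a_0: "j * w l \<noteq> d \<Longrightarrow> a j 0 = 0" for j using a(3) by blast
  have a_axis: "a j (axis l t) = a j 0" for j t by (rule a_indep) (simp add: axis_def)
  have axis: "P (axis l t) = (\<Sum>j\<le>d. a j 0 * t ^ j)" for t by (simp add: P a_axis)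
  show ?thesis
  proof (cases "w l dvd d")
    case True
    define m where "m = d div w l"
    have d: "d = m * w l" using True by (simp add: m_def)
    have "P (axis l t) = (\<Sum>j\<in>{m}. a j 0 * t ^ j)" for t
      unfolding axis
    proof (rule sum.mono_neutral_right)
      show "{m} \<subseteq> {..d}" by (simp add: m_def)
      show "\<forall>j\<in>{..d} - {m}. a j 0 * t ^ j = 0" using a_0 wl by (auto simp: d)
    qed simp
    from this[of t] this[of 1] show ?thesis using True by (simp add: m_def)
  next
    case False
    then have "a j 0 = 0" for j using a_0[of j] by (metis dvd_triv_right)
    then show ?thesis using False by (simp add: axis)
  qed
qed

text \<open>The top coefficient of the leading component has weighted degree zero, so it is constant, and all
  lower ones vanish at the origin: the component is a Weierstrass polynomial up to a constant.\<close>

lemma image_multiplicity_quasihomogeneous: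
  fixes f :: "complex ^ 'n \<Rightarrow> complex ^ 'n option" and l :: 'n
  assumes jpq: "{jp, jq} = {Some l, None}" "jp \<noteq> jq"
    and f_Some: "\<And>i x. i \<noteq> l \<Longrightarrow> f x $ Some i = x $ i"
    and qh: "quasihomogeneous dp w (\<lambda>x. f x $ jp)" "quasihomogeneous dq w (\<lambda>x. f x $ jq)"
    and r: "dp = r * w l" "r > 0"
    and c: "f (axis l 1) $ jp \<noteq> 0"
    and high: "\<And>j. j < r \<Longrightarrow> j * w l = dq \<Longrightarrow> f (axis l 1) $ jq = 0"
    and inj: "generically_one_to_one f"
  shows "image_multiplicity f = r"
proof -
  have wl: "w l > 0" using qh(1) unfolding quasihomogeneous_def by blast
  obtain a where a: "\<forall>j. polynomial_fun (a j)"
    "\<forall>j x x'. (\<forall>i. i \<noteq> l \<longrightarrow> x $ i = x' $ i) \<longrightarrow> a j x = a j x'"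
    "\<forall>x. f x $ jp = (\<Sum>j\<le>dp. a j x * x $ l ^ j)" "\<forall>j x. dp < j * w l \<longrightarrow> a j x = 0"
    "\<forall>j x. j * w l = dp \<longrightarrow> a j x = a j 0" "\<forall>j. j * w l \<noteq> dp \<longrightarrow> a j 0 = 0"
    using quasihomogeneous_coefficients[OF qh(1), of l] by blast
  have a_poly: "polynomial_fun (a j)" for j using a(1) ..
  have a_indep: "a j x = a j x'" if "\<And>i. i \<noteq> l \<Longrightarrow> x $ i = x' $ i" for j x x' using a(2) that by blast
  have P: "f x $ jp = (\<Sum>j\<le>dp. a j x * x $ l ^ j)" for x using a(3) ..
  have a_high: "dp < j * w l \<Longrightarrow> a j x = 0" and a_const: "j * w l = dp \<Longrightarrow> a j x = a j 0"
    and a_0: "j * w l \<noteq> dp \<Longrightarrow> a j 0 = 0" for j x using a(4,5,6) by blast+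
  obtain b where b: "\<forall>j. polynomial_fun (b j)"
    "\<forall>j x x'. (\<forall>i. i \<noteq> l \<longrightarrow> x $ i = x' $ i) \<longrightarrow> b j x = b j x'"
    "\<forall>x. f x $ jq = (\<Sum>j\<le>dq. b j x * x $ l ^ j)" "\<forall>j. j * w l \<noteq> dq \<longrightarrow> b j 0 = 0"
    using quasihomogeneous_coefficients[OF qh(2), of l] by blast
  have b_poly: "polynomial_fun (b j)" for j using b(1) ..
  have b_indep: "b j x = b j x'" if "\<And>i. i \<noteq> l \<Longrightarrow> x $ i = x' $ i" for j x x' using b(2) that by blast
  have Q: "f x $ jq = (\<Sum>j\<le>dq. b j x * x $ l ^ j)" for x using b(3) ..
  have b_0: "j * w l \<noteq> dq \<Longrightarrow> b j 0 = 0" for j using b(4) by blast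
  have rdp: "{..<r} \<union> {r} \<subseteq> {..dp}" using r wl by (cases "w l") auto
  have P': "f x $ jp = (\<Sum>j<r. a j x * x $ l ^ j) + a r 0 * x $ l ^ r" for x
  proof -
    have "f x $ jp = (\<Sum>j\<in>{..<r} \<union> {r}. a j x * x $ l ^ j)"
      unfolding P
    proof (rule sum.mono_neutral_right)
      show "\<forall>j\<in>{..dp} - ({..<r} \<union> {r}). a j x * x $ l ^ j = 0" using a_high wl r(1) by auto
    qed (use rdp in auto)
    then show ?thesis using a_const[of r x] r(1) by (simp add: sum.union_disjoint)
  qed
  have lower_0: "a j 0 = 0" if "j < r" for j using a_0[of j] that wl r(1) by simp
  have "a r 0 \<noteq> 0"
  proof
    assume "a r 0 = 0"
    moreover have "a j (axis l 1) = a j 0" for j by (rule a_indep) (simp add: axis_def)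
    ultimately have "f (axis l 1) $ jp = 0" unfolding P' by (simp add: lower_0)
    with c show False by simp
  qed
  have b_lower: "b j 0 = 0" if j: "j < r" for j
  proof (cases "j * w l = dq")
    case True
    have b_axis: "b i (axis l 1) = b i 0" for i by (rule b_indep) (simp add: axis_def)
    have "f (axis l 1) $ jq = (\<Sum>i\<in>{j}. b i (axis l 1) * axis l 1 $ l ^ i)"
      unfolding Q
    proof (rule sum.mono_neutral_right)
      show "{j} \<subseteq> {..dq}" using True wl by (cases "w l") auto
      show "\<forall>i\<in>{..dq} - {j}. b i (axis l 1) * axis l 1 $ l ^ i = 0"
      proof
        fix i assume "i \<in> {..dq} - {j}"
        then have "i * w l \<noteq> dq" using wl True by auto
        then show "b i (axis l 1) * axis l 1 $ l ^ i = 0" using b_0 b_axis by simp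
      qed
    qed simp
    then show ?thesis using high[OF j True] by (simp add: b_axis)
  qed (rule b_0)
  interpret weierstrass_map f l jp jq r dq "a r 0" a b
    by unfold_locales (fact jpq f_Some P' Q \<open>a r 0 \<noteq> 0\<close> r(2) a_poly b_poly a_indep b_indep lower_0 b_lower)+
  show ?thesis by (rule image_multiplicity_eq[OF inj])
qed

text \<open>Otherwise the fibre over the origin would contain a disc of the axis.\<close>

lemma finite_germ_not_zero_on_axis:
  fixes f :: "complex ^ 'n \<Rightarrow> complex ^ 'm"
  assumes "finite_germ f" "f 0 = 0"
  shows "\<exists>t. f (axis l t) \<noteq> 0"
proof (rule ccontr)
  assume zero: "\<not> ?thesis"
  obtain U V where U: "open U" "0 \<in> U" and V: "0 \<in> V" and fin: "\<And>y. y \<in> V \<Longrightarrow> finite {x\<in>U. f x = y}"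
    using assms(1) unfolding finite_germ_def by blast
  obtain \<epsilon> where \<epsilon>: "\<epsilon> > 0" "ball 0 \<epsilon> \<subseteq> U" using U by (meson open_contains_ball)
  have "axis l ` ball 0 \<epsilon> \<subseteq> {x\<in>U. f x = 0}"
    using zero \<epsilon>(2) by (auto simp: norm_axis_complex subset_iff)
  then have "finite (axis l ` ball (0::complex) \<epsilon> :: (complex ^ 'n) set)"
    using fin[OF V] by (rule finite_subset)
  moreover have "inj_on (axis l :: complex \<Rightarrow> complex ^ 'n) (ball 0 \<epsilon>)"
    by (rule inj_onI) (auto simp: axis_eq_axis)
  ultimately have "finite (ball (0::complex) \<epsilon>)" by (simp add: finite_image_iff)
  then show False using \<epsilon>(1) finite_imp_not_open[of "ball (0::complex) \<epsilon>"] by auto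
qed

theorem theorem5p7:
  fixes f :: "complex ^ 'n \<Rightarrow> complex ^ 'n option"
    and l :: 'n
    and d :: "'n option \<Rightarrow> nat"
    and w :: "'n \<Rightarrow> nat"
    and \<alpha> \<beta> :: complex
    and m\<^sub>1 m\<^sub>2 :: nat
    and p q :: "complex ^ 'n \<Rightarrow> complex"
  assumes "CARD('n) \<ge> 3"
    and "holo_map_germ f" and "finite_germ f" and "generically_one_to_one f"
    and "finitely_determined f"
    and "corank1 f"
    and "quasihomogeneous_map d w f"
    and "\<forall>i. i \<noteq> l \<longrightarrow> d (Some i) = w i"
    and "qh_normal_form l d w \<alpha> \<beta> m\<^sub>1 m\<^sub>2 p q f"
  shows "(w l dvd d (Some l) \<longrightarrow>
            real (image_multiplicity f) = real (d (Some l)) / real (w l)) \<and>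
         (\<not> w l dvd d (Some l) \<longrightarrow>
            real (image_multiplicity f) = real (d None) / real (w l))"
proof -
  note normal_form = assms(9)[unfolded qh_normal_form_def]
  have nf: "f x = (\<chi> j. case j of Some i \<Rightarrow> if i = l then \<alpha> * x $ l ^ m\<^sub>1 + p x else x $ i
                  | None \<Rightarrow> \<beta> * x $ l ^ m\<^sub>2 + q x)" for x
    using normal_form by simp
  have pq0: "x $ l = 0 \<Longrightarrow> p x = 0 \<and> q x = 0" for x using normal_form by simp
  have m: "0 < m\<^sub>1" "m\<^sub>1 \<le> m\<^sub>2" using normal_form by simp_all
  have dA: "w l dvd d (Some l) \<Longrightarrow> d (Some l) = m\<^sub>1 * w l"
    and dB: "w l dvd d None \<Longrightarrow> d None = m\<^sub>2 * w l" using normal_form by simp_all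
  have f_Some: "f x $ Some i = x $ i" if "i \<noteq> l" for i x using that by (simp add: nf)
  have A_0: "f x $ Some l = 0" if "x $ l = 0" for x using pq0[OF that] that m by (simp add: nf)
  have qh: "quasihomogeneous (d j) w (\<lambda>x. f x $ j)" for j
    using assms(7) unfolding quasihomogeneous_map_def by blast
  have wl: "w l > 0" using qh unfolding quasihomogeneous_def by blast
  note axisA = quasihomogeneous_on_axis[OF qh[of "Some l"], of l]
  note axisB = quasihomogeneous_on_axis[OF qh[of None], of l]
  have f0: "f 0 = 0" using assms(2) unfolding holo_map_germ_def by blast
  have B_ne: "w l dvd d None \<and> f (axis l 1) $ None \<noteq> 0" if A: "\<And>t. f (axis l t) $ Some l = 0"
  proof (rule ccontr)
    assume *: "\<not> ?thesis"
    have "f (axis l t) $ j = 0" for t j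
    proof (cases j)
      case None
      then show ?thesis using axisB[of t] * by auto
    next
      case (Some i)
      then show ?thesis using A[of t] f_Some[of i "axis l t"] by (cases "i = l") (auto simp: axis_def)
    qed
    then have "f (axis l t) = 0" for t by (simp add: Finite_Cartesian_Product.vec_eq_iff)
    then show False using finite_germ_not_zero_on_axis[OF assms(3) f0, of l] by blast
  qed
  show ?thesis
  proof (intro conjI impI)
    assume dvd: "w l dvd d (Some l)"
    have "image_multiplicity f = m\<^sub>1"
    proof (cases "f (axis l 1) $ Some l = 0")
      case False
      show ?thesis
      proof (rule image_multiplicity_quasihomogeneous[OF _ _ f_Some qh qh dA[OF dvd] m(1) False _ assms(4)])
        show "f (axis l 1) $ None = 0" if "j < m\<^sub>1" "j * w l = d None" for j
        proof -
          have "j * w l = m\<^sub>2 * w l" using dB that(2) by (metis dvd_triv_right)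
          then show ?thesis using that(1) m(2) wl by simp
        qed
      qed auto
    next
      case True
      then have A: "f (axis l t) $ Some l = 0" for t using axisA[of t] by simp
      note B = B_ne[OF A]
      have B_axis: "f (axis l t) $ None = f (axis l 1) $ None * t ^ m\<^sub>2" for t
        using axisB[of t] B dB wl by simp
      have "m\<^sub>1 = m\<^sub>2"
      proof (rule ccontr)
        assume "m\<^sub>1 \<noteq> m\<^sub>2"
        then have less: "m\<^sub>1 < m\<^sub>2" using m(2) by simp
        have B_poly: "polynomial_fun (\<lambda>x. f x $ None)" using qh unfolding quasihomogeneous_def by blast
        have "\<not> finitely_determined f"
          by (rule not_finitely_determined_if_leading_term_vanishes[OF f_Some qh dA[OF dvd] m(1) A_0 A B_poly B_axis
                conjunct2[OF B] less])
        then show False using assms(5) by blast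
      qed
      moreover have "image_multiplicity f = m\<^sub>2"
        by (rule image_multiplicity_quasihomogeneous[of None "Some l" l, OF _ _ f_Some qh qh dB _ _ _ assms(4)])
          (use B True m in auto)
      ultimately show ?thesis by simp
    qed
    then show "real (image_multiplicity f) = real (d (Some l)) / real (w l)"
      using dA[OF dvd] wl by simp
  next
    assume ndvd: "\<not> w l dvd d (Some l)"
    then have A: "f (axis l t) $ Some l = 0" for t using axisA[of t] by simp
    note B = B_ne[OF A]
    have "image_multiplicity f = m\<^sub>2"
      by (rule image_multiplicity_quasihomogeneous[of None "Some l" l, OF _ _ f_Some qh qh dB _ _ _ assms(4)])
        (use B m ndvd A in auto)
    then show "real (image_multiplicity f) = real (d None) / real (w l)"
      using dB B wl by simp
  qed
qed

end
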